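(* Let $p\in(0,1)$, and let $(\mathcal{G}_x)_{x\in\mathbb{Z}^2}$ be i.i.d. with $\mathcal{G}_x=\{e_1,e_2\}$ with probability $p$ and $\mathcal{G}_x=\{e_1,-e_1\}$ with probability $1-p$. Then the random walk $(X_n)$ in the associated uniform random environment, started at the origin, satisfies $P(n^{-1}X_n\to v)=1$ with $$v=\left(\frac{1}{p^2}+\frac{(1-p)^2}{2p\,(1-p+p\log p)}\right)^{-1}\cdot(1,1),$$ where $\log$ is the natural logarithm.
   Context: $e_1=(1,0)$ and $e_2=(0,1)$ are the unit vectors of $\mathbb{Z}^2$. Given a realization of the i.i.d. non-empty sets $(\mathcal{G}_x)_{x\in\mathbb{Z}^2}$, each a subset of $\{\pm e_1,\pm e_2\}$, the walk in the associated uniform random environment is the time-homogeneous Markov chain $(X_n)_{n\ge0}$ on $\mathbb{Z}^2$ with $X_0=0$ that moves from $x$ to $x+e$ with probability $1/|\mathcal{G}_x|$ if $e\in\mathcal{G}_x$, and with probability $0$ otherwise. The environment is sampled once and kept fixed. $P$ denotes the annealed law, i.e. the law of the walk averaged over the environment. *)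

theory Defs
  imports "HOL-Probability.Probability"
begin

type_synonym site = "int \<times> int"

definition e1 :: site where "e1 = (1, 0)"

definition e2 :: site where "e2 = (0, 1)"

definition step_sets :: "site set set" where
  "step_sets = Pow {e1, - e1, e2, - e2} - {{}}"

abbreviation path_space :: "(nat \<Rightarrow> site) measure" where
  "path_space \<equiv> PiM UNIV (\<lambda>_. count_space UNIV)"

definition uniform_step :: "(site \<Rightarrow> site set) \<Rightarrow> site \<Rightarrow> site pmf" where
  "uniform_step g x = map_pmf (\<lambda>e. x + e) (pmf_of_set (g x))"

text \<open>The conditional law of \<open>X i\<close> given \<open>X j\<close> for all \<open>j < i\<close>, in the format required by
  \<^locale>\<open>Ionescu_Tulcea\<close>.\<close>

definition walk_kernel :: "(site \<Rightarrow> site set) \<Rightarrow> nat \<Rightarrow> (nat \<Rightarrow> site) \<Rightarrow> site measure" where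
  "walk_kernel g i X =
    measure_pmf (case i of 0 \<Rightarrow> return_pmf 0 | Suc n \<Rightarrow> uniform_step g (X n))"

definition quenched_law :: "(site \<Rightarrow> site set) \<Rightarrow> (nat \<Rightarrow> site) measure" where
  "quenched_law g =
    projective_family.lim UNIV
      (Ionescu_Tulcea.CI (walk_kernel g) (\<lambda>_. count_space UNIV)) (\<lambda>_. count_space UNIV)"

definition annealed_law :: "'w measure \<Rightarrow> (site \<Rightarrow> 'w \<Rightarrow> site set) \<Rightarrow> (nat \<Rightarrow> site) measure" where
  "annealed_law M G = M \<bind> (\<lambda>\<omega>. quenched_law (\<lambda>x. G x \<omega>))"

lemma pmf_uniform_step:
  assumes "g x \<in> step_sets"
  shows "pmf (uniform_step g x) (x + e) = (if e \<in> g x then 1 / real (card (g x)) else 0)"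
proof -
  have "finite (g x)" "g x \<noteq> {}"
    using assms by (auto simp: step_sets_def intro: finite_subset)
  moreover have "pmf (uniform_step g x) (x + e) = pmf (pmf_of_set (g x)) e"
    unfolding uniform_step_def by (rule pmf_map_inj') (auto simp: inj_def)
  ultimately show ?thesis by simp
qed

lemma Ionescu_Tulcea_walk_kernel:
  "Ionescu_Tulcea (walk_kernel g) (\<lambda>_. count_space UNIV)"
proof (rule Ionescu_Tulcea.intro)
  fix i :: nat
  show "walk_kernel g i \<in> PiM {0..<i} (\<lambda>_. count_space UNIV) \<rightarrow>\<^sub>M subprob_algebra (count_space UNIV)"
  proof (cases i)
    case 0
    then show ?thesis
      by (simp add: walk_kernel_def[abs_def] space_subprob_algebra measure_pmf.subprob_space_axioms)
  next
    case (Suc n)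
    have "(\<lambda>X. X n) \<in> PiM {0..<i} (\<lambda>_. count_space (UNIV :: site set)) \<rightarrow>\<^sub>M count_space UNIV"
      using Suc by (intro measurable_component_singleton) auto
    moreover have "(\<lambda>x. measure_pmf (uniform_step g x)) \<in>
        count_space UNIV \<rightarrow>\<^sub>M subprob_algebra (count_space UNIV)"
      by (auto simp: space_subprob_algebra intro!: measure_pmf.subprob_space_axioms)
    ultimately have "(\<lambda>X. measure_pmf (uniform_step g (X n))) \<in>
        PiM {0..<i} (\<lambda>_. count_space UNIV) \<rightarrow>\<^sub>M subprob_algebra (count_space UNIV)"
      by (rule measurable_compose)
    then show ?thesis
      using Suc by (simp add: walk_kernel_def[abs_def])
  qed
next
  fix i :: nat and X :: "nat \<Rightarrow> site"
  show "prob_space (walk_kernel g i X)"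
    by (simp add: walk_kernel_def measure_pmf.prob_space_axioms)
qed

lemma sets_quenched_law [measurable_cong]: "sets (quenched_law g) = sets path_space"
proof -
  interpret Ionescu_Tulcea "walk_kernel g" "\<lambda>_. count_space UNIV"
    by (rule Ionescu_Tulcea_walk_kernel)
  show ?thesis by (simp add: quenched_law_def)
qed

lemma emeasure_quenched_law_cylinder:
  "emeasure (quenched_law g) {X. \<forall>i\<le>n. X i = x i} =
    (if x 0 = 0 then \<Prod>i<n. ennreal (pmf (uniform_step g (x i)) (x (Suc i))) else 0)"
proof -
  interpret Ionescu_Tulcea "walk_kernel g" "\<lambda>_. count_space UNIV"
    by (rule Ionescu_Tulcea_walk_kernel)
  define r where "r n = restrict x {0..<n}" for n
  have r_space: "r m \<in> space (PiM {0..<m} (\<lambda>_. count_space UNIV))" for m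
    by (auto simp: r_def space_PiM)
  have sing: "{r m} \<in> sets (PiM {0..<m} (\<lambda>_. count_space UNIV))" for m
  proof -
    have "{r m} = PiE {0..<m} (\<lambda>i. {x i})"
      by (auto simp: r_def PiE_iff extensional_def fun_eq_iff)
    then show ?thesis by (auto intro!: sets_PiM_I_finite)
  qed
  have eP: "emeasure (eP m w) {r (Suc m)} =
      indicator {r m} w * emeasure (walk_kernel g m (r m)) {x m}"
    if w: "w \<in> space (PiM {0..<m} (\<lambda>_. count_space UNIV))" for m w
  proof -
    have wext: "w i = undefined" if "i \<ge> m" for i
      using w that by (auto simp: space_PiM PiE_iff extensional_def)
    have "w(m := y) = r (Suc m) \<longleftrightarrow> w = r m \<and> y = x m" for y
      using wext by (auto simp: r_def fun_eq_iff less_Suc_eq not_less)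
    then have "(\<lambda>y. w(m := y)) -` {r (Suc m)} \<inter> space (count_space UNIV) = (if w = r m then {x m} else {})"
      by auto
    then show ?thesis
      by (subst emeasure_eP[OF w sing]) auto
  qed
  have C: "emeasure (C 0 (Suc m) (\<lambda>_. undefined)) {r (Suc m)} =
      (if x 0 = 0 then \<Prod>i<m. ennreal (pmf (uniform_step g (x i)) (x (Suc i))) else 0)" for m
  proof (induction m)
    case 0
    have r0: "r 0 = (\<lambda>_. undefined)" by (simp add: r_def fun_eq_iff)
    have "emeasure (C 0 1 (\<lambda>_. undefined)) {r 1} = emeasure (eP 0 (\<lambda>_. undefined)) {r 1}"
      using measurable_eP[of 0] by (simp add: bind_return)
    also have "\<dots> = emeasure (walk_kernel g 0 (r 0)) {x 0}"
      using eP[of "\<lambda>_. undefined" 0] r0 by simp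
    also have "\<dots> = (if x 0 = 0 then 1 else 0)"
      by (simp add: walk_kernel_def emeasure_pmf_single indicator_def)
    finally show ?case by simp
  next
    case (Suc m)
    let ?C = "C 0 (Suc m) (\<lambda>_. undefined)"
    have s: "sets ?C = sets (PiM {0..<Suc m} (\<lambda>_. count_space UNIV))"
      using sets_C[of "\<lambda>_. undefined" 0 "Suc m"] by simp
    have sp: "space ?C = space (PiM {0..<Suc m} (\<lambda>_. count_space UNIV))"
      using sets_eq_imp_space_eq[OF s] .
    have m: "eP (Suc m) \<in> ?C \<rightarrow>\<^sub>M subprob_algebra (PiM {0..<Suc (Suc m)} (\<lambda>_. count_space UNIV))"
      using measurable_eP[of "Suc m"] measurable_cong_sets[OF s refl] by blast
    have ne: "space ?C \<noteq> {}" using r_space[of "Suc m"] sp by blast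
    have "C 0 (Suc (Suc m)) (\<lambda>_. undefined) = ?C \<bind> eP (Suc m)" by simp
    then have "emeasure (C 0 (Suc (Suc m)) (\<lambda>_. undefined)) {r (Suc (Suc m))} =
        (\<integral>\<^sup>+w. emeasure (eP (Suc m) w) {r (Suc (Suc m))} \<partial>?C)"
      by (simp only: emeasure_bind[OF ne m sing])
    also have "\<dots> = (\<integral>\<^sup>+w. emeasure (walk_kernel g (Suc m) (r (Suc m))) {x (Suc m)}
        * indicator {r (Suc m)} w \<partial>?C)"
      by (rule nn_integral_cong) (simp only: eP sp mult.commute)
    also have "\<dots> = emeasure (walk_kernel g (Suc m) (r (Suc m))) {x (Suc m)} * emeasure ?C {r (Suc m)}"
      using sing s by (intro nn_integral_cmult_indicator) (simp only:)
    also have "emeasure (walk_kernel g (Suc m) (r (Suc m))) {x (Suc m)} =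
        ennreal (pmf (uniform_step g (x m)) (x (Suc m)))"
      by (simp add: walk_kernel_def r_def emeasure_pmf_single)
    finally show ?case unfolding Suc by (simp add: mult.commute)
  qed
  have emb: "{X. \<forall>i\<le>n. X i = x i} = PF.emb UNIV {0..<Suc n} {r (Suc n)}"
    by (auto simp: prod_emb_def space_PiM r_def fun_eq_iff restrict_def less_Suc_eq_le) (metis)+
  have "emeasure (quenched_law g) {X. \<forall>i\<le>n. X i = x i} = emeasure (CI {0..<Suc n}) {r (Suc n)}"
    unfolding emb quenched_law_def by (rule lim) (auto intro: sing simp del: atLeastLessThan_iff)
  also have "\<dots> = emeasure (C 0 (Suc n) (\<lambda>_. undefined)) (PF.emb {0..<Suc n} {0..<Suc n} {r (Suc n)})"
    by (rule emeasure_CI) (auto intro: sing simp del: atLeastLessThan_iff)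
  also have "PF.emb {0..<Suc n} {0..<Suc n} {r (Suc n)} = {r (Suc n)}"
    using sets.sets_into_space[OF sing] by (intro prod_emb_id) (auto simp: space_PiM)
  finally show ?thesis using C by simp
qed

lemma prob_space_quenched_law: "prob_space (quenched_law g)"
proof -
  interpret Ionescu_Tulcea "walk_kernel g" "\<lambda>_. count_space UNIV"
    by (rule Ionescu_Tulcea_walk_kernel)
  interpret CI: prob_space "CI {}" by (rule PF.prob_space_P) auto
  have "emeasure PF.lim (PF.emb UNIV {} (space (PiM {} (\<lambda>_. count_space UNIV)))) = 1"
    using lim[of "{}" "space (PiM {} (\<lambda>_. count_space UNIV))"] CI.emeasure_space_1
      sets_eq_imp_space_eq[OF PF.sets_P[of "{}"]] by simp
  moreover have "PF.emb UNIV {} (space (PiM {} (\<lambda>_. count_space UNIV))) = space PF.lim"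
    by (auto simp: prod_emb_def space_PiM PF.space_lim)
  ultimately show ?thesis
    unfolding quenched_law_def by (intro prob_spaceI) simp
qed


lemma measurable_quenched_law:
  assumes "\<And>x. G x \<in> M \<rightarrow>\<^sub>M count_space step_sets"
  shows "(\<lambda>\<omega>. quenched_law (\<lambda>x. G x \<omega>)) \<in> M \<rightarrow>\<^sub>M subprob_algebra path_space"
proof -
  define cyl where "cyl n x = {X :: nat \<Rightarrow> site. \<forall>i\<le>n. X i = x i}" for n x
  define \<C> where "\<C> = insert {} {cyl n x | n x. True}"
  have cyl_sets: "cyl n x \<in> sets path_space" for n x
  proof -
    have "cyl n x = prod_emb UNIV (\<lambda>_. count_space UNIV) {..n} (PiE {..n} (\<lambda>i. {x i}))"
      by (auto simp: cyl_def prod_emb_def PiE_iff extensional_def space_PiM)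
    then show ?thesis by (simp add: sets_PiM_I)
  qed
  have gen: "sets path_space = sigma_sets UNIV \<C>"
  proof
    have "{f :: nat \<Rightarrow> site. f i \<in> A} \<in> sigma_sets UNIV \<C>" for i A
    proof -
      have eq: "{f :: nat \<Rightarrow> site. f i \<in> A} =
          (\<Union>xs\<in>{xs. length xs = Suc i \<and> xs ! i \<in> A}. cyl i ((!) xs))"
      proof (intro set_eqI iffI)
        fix f :: "nat \<Rightarrow> site" assume "f \<in> {f. f i \<in> A}"
        then show "f \<in> (\<Union>xs\<in>{xs. length xs = Suc i \<and> xs ! i \<in> A}. cyl i ((!) xs))"
          by (intro UN_I[of "map f [0..<Suc i]"])
             (auto simp: cyl_def nth_append less_Suc_eq_le simp del: upt_Suc)
      qed (auto simp: cyl_def)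
      interpret sigma_algebra UNIV "sigma_sets UNIV \<C>"
        by (rule sigma_algebra_sigma_sets) simp
      show ?thesis
        unfolding eq
        by (intro countable_UN'' ) (auto simp: \<C>_def)
    qed
    then show "sets path_space \<subseteq> sigma_sets UNIV \<C>"
      unfolding sets_PiM_single
      by (auto simp: space_PiM intro!: sigma_sets_mono)
  next
    show "sigma_sets UNIV \<C> \<subseteq> sets path_space"
      using sets.sigma_sets_subset[of \<C> path_space] cyl_sets by (auto simp: \<C>_def space_PiM)
  qed
  have "Int_stable \<C>"
  proof (rule Int_stableI)
    have *: "cyl m x \<inter> cyl n y \<in> \<C>" for m n x y
    proof -
      have "cyl m x \<inter> cyl n y \<in> \<C>" if "m \<le> n" for m n x y
      proof (cases "\<forall>i\<le>m. x i = y i")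
        case True
        then have "cyl m x \<inter> cyl n y = cyl n y" using that by (auto simp: cyl_def)
        then show ?thesis by (auto simp: \<C>_def)
      next
        case False
        then have "cyl m x \<inter> cyl n y = {}"
          using that by (auto simp: cyl_def)
        then show ?thesis by (simp add: \<C>_def)
      qed
      then show ?thesis by (metis Int_commute linear)
    qed
    fix a b assume ab: "a \<in> \<C>" "b \<in> \<C>"
    show "a \<inter> b \<in> \<C>"
    proof (cases "a = {} \<or> b = {}")
      case True
      then show ?thesis by (auto simp: \<C>_def)
    next
      case False
      then obtain m x n y where "a = cyl m x" "b = cyl n y"
        using ab by (auto simp: \<C>_def)
      then show ?thesis using * by simp
    qed
  qed
  moreover have "(\<lambda>\<omega>. emeasure (quenched_law (\<lambda>x. G x \<omega>)) A) \<in> borel_measurable M" if "A \<in> \<C>" for A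
  proof -
    have step: "(\<lambda>\<omega>. pmf (uniform_step (\<lambda>x. G x \<omega>) x) y) \<in> borel_measurable M" for x y
    proof -
      have "(\<lambda>S. pmf (map_pmf ((+) x) (pmf_of_set S)) y) \<in> borel_measurable (count_space step_sets)"
        by simp
      from measurable_compose[OF assms[of x] this] show ?thesis
        by (simp add: uniform_step_def)
    qed
    have "(\<lambda>\<omega>. emeasure (quenched_law (\<lambda>x. G x \<omega>)) (cyl n x)) \<in> borel_measurable M" for n x
      unfolding cyl_def emeasure_quenched_law_cylinder
      by (cases "x 0 = 0") (auto intro!: borel_measurable_prod_ennreal measurable_compose[OF step measurable_ennreal])
    with that show ?thesis by (auto simp: \<C>_def)
  qed
  moreover have "emeasure (quenched_law g) UNIV = 1" for g
    using prob_space.emeasure_space_1[OF prob_space_quenched_law[of g]]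
      sets_eq_imp_space_eq[OF sets_quenched_law[of g]] by (simp add: space_PiM)
  ultimately show ?thesis
    by (intro measurable_subprob_algebra_generated[OF gen])
       (auto simp: sets_quenched_law prob_space_imp_subprob_space[OF prob_space_quenched_law])
qed

lemma emeasure_annealed_law:
  assumes "prob_space M" and "\<And>x. G x \<in> M \<rightarrow>\<^sub>M count_space step_sets" and "A \<in> sets path_space"
  shows "emeasure (annealed_law M G) A = (\<integral>\<^sup>+\<omega>. emeasure (quenched_law (\<lambda>x. G x \<omega>)) A \<partial>M)"
  unfolding annealed_law_def
  by (rule emeasure_bind[OF prob_space.not_empty[OF assms(1)] measurable_quenched_law assms(3)])
     (rule assms(2))

end

theory Submission
  imports Defs
begin

text \<open>
  Call a site an up site if its step set is \<open>{e1, e2}\<close>. The walk never returns to a line it has left,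
  so the times spent on successive horizontal lines are i.i.d. under the annealed law, and the height
  of the walk divided by the time converges to the inverse of their mean \<open>m\<close>. Moreover
  \<open>fst (X n) - snd (X n)\<close> is a simple random walk in every environment of the theorem, so both
  coordinates have the same speed.

  To compute \<open>m\<close>, let \<open>a\<close> be one plus the distance from \<open>x\<close> to the nearest up site weakly to the left,
  let \<open>b\<close> be the distance to the nearest up site \<open>y\<close> strictly to the right. The quenched expected time
  to leave the line is \<open>a * b + a / (a + b) * R y\<close>, where \<open>R\<close>, its value at up sites, satisfies
  \<open>R x = b + R y / (b + 1)\<close>. As \<open>a\<close> and \<open>b\<close> are i.i.d. geometric and independent of \<open>R y\<close>, the mean is
  \<open>1 / p\<^sup>2 + E R / 2\<close>, and \<open>E R = 1 / (p * (1 - E (1 / (b + 1))))\<close>, which contains the logarithmic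
  series. The same formula with an additional factor \<open>(a + b)\<^sup>2 + R y\<close>, which bounds the expected exit
  time on the whole gap between two up sites, gives a supersolution that controls the second moment.
  Chebyshev's inequality and the Borel-Cantelli lemma along the times \<open>j\<^sup>2\<close> then suffice, because the
  steps are bounded.
\<close>


section \<open>Marginals of the quenched walk\<close>

text \<open>The time spent on a line is not studied as a stopping time on path space. Height never
  decreases, so level \<open>k\<close> is reached by time \<open>n\<close> exactly when the height
  at time \<open>n\<close> is at least \<open>k\<close>; single-time marginals of the walk are
  therefore enough, and hitting times enter only as distributions on the natural numbers. After
  leaving a line the walk sees only fresh rows, and the mean of what happens there is the same for
  every landing site, so the exit site, which is correlated with the row just left, averages out.

  The main obstacle is that a Poisson equation on an infinite line does not identify its solution:
  the constant \<open>top\<close> solves it too. The supersolution settles this. Its mean bounds the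
  sum over \<open>n\<close> of the mean remainders left after \<open>n\<close> iterations, so these
  tend to zero and the explicit formula is the expected exit time; the same sum bounds the second
  moment. All costs take values in the extended non-negative reals, which makes series, integrals
  and exchanges of their order unconditional.\<close>

primrec walk_pmf :: "(site \<Rightarrow> site set) \<Rightarrow> nat \<Rightarrow> site \<Rightarrow> site pmf" where
  "walk_pmf g 0 x = return_pmf x"
| "walk_pmf g (Suc n) x = bind_pmf (uniform_step g x) (walk_pmf g n)"

text \<open>The definition splits off the first step, which suits recursions in the starting site;
  the path law is extended at its last step.\<close>

lemma walk_pmf_Suc_last:
  "walk_pmf g (Suc n) x = bind_pmf (walk_pmf g n x) (uniform_step g)"
proof (induction n arbitrary: x)
  case 0
  have "walk_pmf g 0 = return_pmf" by (simp add: fun_eq_iff)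
  then show ?case by (simp add: bind_return_pmf bind_return_pmf')
next
  case (Suc n)
  have IH: "walk_pmf g (Suc n) = (\<lambda>y. bind_pmf (walk_pmf g n y) (uniform_step g))"
    using Suc.IH by (intro ext)
  have "walk_pmf g (Suc (Suc n)) x = bind_pmf (uniform_step g x) (walk_pmf g (Suc n))"
    by (rule walk_pmf.simps(2))
  also have "\<dots> = bind_pmf (bind_pmf (uniform_step g x) (walk_pmf g n)) (uniform_step g)"
    unfolding IH by (rule bind_assoc_pmf[symmetric])
  also have "\<dots> = bind_pmf (walk_pmf g (Suc n) x) (uniform_step g)"
    by simp
  finally show ?case .
qed

lemma space_quenched_law [simp]: "space (quenched_law g) = UNIV"
  using sets_eq_imp_space_eq[OF sets_quenched_law] by (simp add: space_PiM)

lemma sets_quenched_law_at [measurable]: "{X. X n \<in> A} \<in> sets (quenched_law g)"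
proof -
  have "(\<lambda>X. X n) -` A \<inter> space path_space \<in> sets path_space"
    by (rule measurable_sets[OF measurable_component_singleton]) auto
  then show ?thesis by (simp add: sets_quenched_law space_PiM vimage_def)
qed

text \<open>Markov property at time \<open>n\<close>, obtained by summing the cylinder formula over
  all initial segments that end in \<open>y\<close>.\<close>

lemma emeasure_quenched_law_step:
  "emeasure (quenched_law g) {X. X n = y \<and> X (Suc n) = z} =
    emeasure (quenched_law g) {X. X n = y} * pmf (uniform_step g y) z"
proof -
  \<comment> \<open>Lists encode the initial segments because lists over a countable type form a
    countable type, so the events become countable unions of cylinders.\<close>
  define L where "L = {xs :: site list. length xs = Suc n \<and> xs ! n = y}"
  define cyl where "cyl m xs = {X. \<forall>i\<le>m. X i = (xs :: site list) ! i}" for m xs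
  have cyl_sets: "cyl m xs \<in> sets (quenched_law g)" for m xs
  proof -
    have "cyl m xs = (\<Inter>i\<in>{..m}. {X. X i \<in> {xs ! i}})" by (auto simp: cyl_def)
    also have "\<dots> \<in> sets (quenched_law g)" by (intro sets.finite_INT sets_quenched_law_at) auto
    finally show ?thesis .
  qed
  have upt: "map X [0..<Suc n] \<in> L \<longleftrightarrow> X n = y" for X :: "nat \<Rightarrow> site"
    by (simp add: L_def nth_append)
  have mem: "X \<in> cyl n (map X [0..<Suc n])" for X :: "nat \<Rightarrow> site"
    by (auto simp: cyl_def less_Suc_eq_le simp del: upt_Suc)
  have eq1: "{X. X n = y} = (\<Union>xs\<in>L. cyl n xs)"
  proof (intro set_eqI iffI)
    fix X :: "nat \<Rightarrow> site" assume "X \<in> {X. X n = y}"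
    then show "X \<in> (\<Union>xs\<in>L. cyl n xs)" using upt[of X] mem[of X] by blast
  qed (auto simp: L_def cyl_def)
  have eq2: "{X. X n = y \<and> X (Suc n) = z} = (\<Union>xs\<in>L. cyl (Suc n) (xs @ [z]))"
  proof (intro set_eqI iffI)
    fix X assume "X \<in> {X. X n = y \<and> X (Suc n) = z}"
    then show "X \<in> (\<Union>xs\<in>L. cyl (Suc n) (xs @ [z]))"
      using upt[of X] by (intro UN_I[of "map X [0..<Suc n]"])
        (auto simp: cyl_def nth_append less_Suc_eq_le le_Suc_eq simp del: upt_Suc)
  next
    fix X assume "X \<in> (\<Union>xs\<in>L. cyl (Suc n) (xs @ [z]))"
    then obtain xs where "xs \<in> L" and X: "\<And>i. i \<le> Suc n \<Longrightarrow> X i = (xs @ [z]) ! i"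
      by (auto simp: cyl_def)
    then show "X \<in> {X. X n = y \<and> X (Suc n) = z}"
      using X[of n] X[of "Suc n"] by (auto simp: L_def nth_append)
  qed
  have dis1: "disjoint_family_on (\<lambda>xs. cyl n xs) L"
  proof -
    have "xs = ys" if "xs \<in> L" "ys \<in> L" "X \<in> cyl n xs" "X \<in> cyl n ys" for xs ys X
      using that by (auto simp: L_def cyl_def less_Suc_eq_le intro!: nth_equalityI)
    then show ?thesis by (auto simp: disjoint_family_on_def)
  qed
  have sub: "cyl (Suc n) (xs @ [z]) \<subseteq> cyl n xs" if "xs \<in> L" for xs
    using that by (auto simp: cyl_def L_def nth_append)
  have dis2: "disjoint_family_on (\<lambda>xs. cyl (Suc n) (xs @ [z])) L"
    using dis1 sub unfolding disjoint_family_on_def by blast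
  have step: "emeasure (quenched_law g) (cyl (Suc n) (xs @ [z])) =
      emeasure (quenched_law g) (cyl n xs) * pmf (uniform_step g y) z" if "xs \<in> L" for xs
  proof -
    have len: "length xs = Suc n" "xs ! n = y" using that by (auto simp: L_def)
    then have nth: "i \<le> n \<Longrightarrow> (xs @ [z]) ! i = xs ! i" for i by (simp add: nth_append)
    have "(\<Prod>i<n. ennreal (pmf (uniform_step g ((xs @ [z]) ! i)) ((xs @ [z]) ! Suc i))) =
        (\<Prod>i<n. ennreal (pmf (uniform_step g (xs ! i)) (xs ! Suc i)))"
      by (intro prod.cong) (auto simp: nth)
    then show ?thesis
      using len by (simp add: cyl_def emeasure_quenched_law_cylinder nth_append[of xs "[z]" "Suc n"] nth
        del: nth_append)
  qed
  have "emeasure (quenched_law g) {X. X n = y \<and> X (Suc n) = z} =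
      (\<integral>\<^sup>+xs. emeasure (quenched_law g) (cyl (Suc n) (xs @ [z])) \<partial>count_space L)"
    unfolding eq2 by (rule emeasure_UN_countable) (auto simp: cyl_sets dis2)
  also have "\<dots> = (\<integral>\<^sup>+xs. emeasure (quenched_law g) (cyl n xs) * pmf (uniform_step g y) z \<partial>count_space L)"
    by (rule nn_integral_cong) (simp add: step)
  also have "\<dots> = (\<integral>\<^sup>+xs. emeasure (quenched_law g) (cyl n xs) \<partial>count_space L) * pmf (uniform_step g y) z"
    by (rule nn_integral_multc) simp
  also have "(\<integral>\<^sup>+xs. emeasure (quenched_law g) (cyl n xs) \<partial>count_space L) = emeasure (quenched_law g) {X. X n = y}"
    unfolding eq1 by (rule emeasure_UN_countable[symmetric]) (auto simp: cyl_sets dis1)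
  finally show ?thesis .
qed

lemma emeasure_quenched_law_single:
  "emeasure (quenched_law g) {X. X n = y} = pmf (walk_pmf g n 0) y"
proof (induction n arbitrary: y)
  case 0
  have "{X :: nat \<Rightarrow> site. X 0 = y} = {X. \<forall>i\<le>0. X i = (\<lambda>_. y) i}" by auto
  then show ?case using emeasure_quenched_law_cylinder[of g 0 "\<lambda>_. y"] by (auto simp: indicator_def)
next
  case (Suc n)
  have "{X :: nat \<Rightarrow> site. X (Suc n) = y} = (\<Union>z\<in>UNIV. {X. X n \<in> {z}} \<inter> {X. X (Suc n) \<in> {y}})" by auto
  then have "emeasure (quenched_law g) {X. X (Suc n) = y} =
      emeasure (quenched_law g) (\<Union>z\<in>UNIV. {X. X n \<in> {z}} \<inter> {X. X (Suc n) \<in> {y}})" by (rule arg_cong)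
  also have "\<dots> = (\<integral>\<^sup>+z. emeasure (quenched_law g) ({X. X n \<in> {z}} \<inter> {X. X (Suc n) \<in> {y}}) \<partial>count_space UNIV)"
    by (rule emeasure_UN_countable) (auto simp: disjoint_family_on_def intro!: sets.Int sets_quenched_law_at
      sets_quenched_law_at[of _ "{x}" for x, simplified])
  also have "\<dots> = (\<integral>\<^sup>+z. pmf (walk_pmf g n 0) z * pmf (uniform_step g z) y \<partial>count_space UNIV)"
  proof (rule nn_integral_cong)
    fix z
    have "{X :: nat \<Rightarrow> site. X n \<in> {z}} \<inter> {X. X (Suc n) \<in> {y}} = {X. X n = z \<and> X (Suc n) = y}" by auto
    then show "emeasure (quenched_law g) ({X. X n \<in> {z}} \<inter> {X. X (Suc n) \<in> {y}}) =
        ennreal (pmf (walk_pmf g n 0) z * pmf (uniform_step g z) y)"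
      by (simp only: emeasure_quenched_law_step Suc.IH) (simp add: ennreal_mult)
  qed
  also have "\<dots> = ennreal (pmf (walk_pmf g (Suc n) 0) y)"
    unfolding walk_pmf_Suc_last by (simp add: ennreal_pmf_bind nn_integral_measure_pmf ennreal_mult)
  finally show ?case .
qed

lemma emeasure_quenched_law_at:
  "emeasure (quenched_law g) {X. X n \<in> A} = emeasure (walk_pmf g n 0) A"
proof -
  have "{X :: nat \<Rightarrow> site. X n \<in> A} = (\<Union>z\<in>A. {X. X n \<in> {z}})" by auto
  then have "emeasure (quenched_law g) {X. X n \<in> A} = emeasure (quenched_law g) (\<Union>z\<in>A. {X. X n \<in> {z}})"
    by (rule arg_cong)
  also have "\<dots> = (\<integral>\<^sup>+z. emeasure (quenched_law g) {X. X n \<in> {z}} \<partial>count_space A)"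
    by (rule emeasure_UN_countable) (auto simp: disjoint_family_on_def intro!: sets_quenched_law_at
      sets_quenched_law_at[of _ "{x}" for x, simplified])
  also have "\<dots> = emeasure (walk_pmf g n 0) A"
    by (simp add: emeasure_quenched_law_single nn_integral_pmf)
  finally show ?thesis .
qed

lemma AE_quenched_law_step:
  assumes "\<And>x. g x \<in> step_sets"
  shows "AE X in quenched_law g. X (Suc n) - X n \<in> g (X n)"
proof -
  have "AE X in quenched_law g. \<not> (X n = y \<and> X (Suc n) = z)" if "z - y \<notin> g y" for y z
  proof -
    have "pmf (uniform_step g y) z = 0"
      using pmf_uniform_step[of g y "z - y"] assms that by simp
    then have "emeasure (quenched_law g) {X. X n = y \<and> X (Suc n) = z} = 0"
      by (simp add: emeasure_quenched_law_step)
    moreover have "{X. X n = y \<and> X (Suc n) = z} = {X. X n \<in> {y}} \<inter> {X. X (Suc n) \<in> {z}}" by auto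
    then have "{X. X n = y \<and> X (Suc n) = z} \<in> sets (quenched_law g)"
      using sets_quenched_law_at[of n "{y}" g] sets_quenched_law_at[of "Suc n" "{z}" g]
      by (auto simp del: singleton_iff)
    ultimately show ?thesis by (subst AE_iff_measurable) auto
  qed
  then have "AE X in quenched_law g. \<forall>y z. z - y \<notin> g y \<longrightarrow> \<not> (X n = y \<and> X (Suc n) = z)"
    by (simp add: AE_all_countable)
  then show ?thesis by (rule AE_mp) (rule AE_I2, blast)
qed

section \<open>The Bernoulli environment\<close>

text \<open>Pointwise counterpart of measurability with respect to the coordinates in
  \<open>I\<close>. It passes easily through recursions and series, and
  \<open>nn_integral_indep\<close> turns it into independence for measurable functions.\<close>

definition depends_on :: "'i set \<Rightarrow> (('i \<Rightarrow> 'a) \<Rightarrow> 'b) \<Rightarrow> bool" where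
  "depends_on I f \<longleftrightarrow> (\<forall>u v. (\<forall>z\<in>I. u z = v z) \<longrightarrow> f u = f v)"

lemma depends_onI: "(\<And>u v. (\<And>z. z \<in> I \<Longrightarrow> u z = v z) \<Longrightarrow> f u = f v) \<Longrightarrow> depends_on I f"
  unfolding depends_on_def by blast

lemma depends_onD: "depends_on I f \<Longrightarrow> (\<And>z. z \<in> I \<Longrightarrow> u z = v z) \<Longrightarrow> f u = f v"
  unfolding depends_on_def by blast

lemma depends_on_mono: "depends_on I f \<Longrightarrow> I \<subseteq> J \<Longrightarrow> depends_on J f"
  by (auto simp: depends_on_def)

lemma depends_on_const: "depends_on I (\<lambda>_. c)"
  by (simp add: depends_on_def)

lemma depends_on_coord: "z \<in> I \<Longrightarrow> depends_on I (\<lambda>u. f (u z))"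
  by (simp add: depends_on_def)

lemma depends_on_comp2: "depends_on I f \<Longrightarrow> depends_on I g \<Longrightarrow> depends_on I (\<lambda>u. h (f u) (g u))"
  unfolding depends_on_def by metis

lemma depends_on_comp: "depends_on I f \<Longrightarrow> depends_on I (\<lambda>u. h (f u))"
  unfolding depends_on_def by metis

lemma depends_on_fun: "(\<And>i. depends_on I (\<lambda>u. f u i)) \<Longrightarrow> depends_on I (\<lambda>u. h (f u))"
  unfolding depends_on_def by (metis ext)

lemma (in prob_space) indep_var_nn_integral:
  assumes "indep_var borel X borel Y"
  shows "(\<integral>\<^sup>+\<omega>. X \<omega> * Y \<omega> \<partial>M) = (\<integral>\<^sup>+\<omega>. X \<omega> \<partial>M) * (\<integral>\<^sup>+\<omega>. Y \<omega> \<partial>M)"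
proof -
  have "case_bool borel borel = (\<lambda>_. borel :: ennreal measure)" by (simp add: fun_eq_iff split: bool.split)
  then have ind: "indep_vars (\<lambda>_. borel) (case_bool X Y) UNIV"
    using assms unfolding indep_var_def by simp
  have "(\<integral>\<^sup>+\<omega>. (\<Prod>b\<in>UNIV. case_bool X Y b \<omega>) \<partial>M) = (\<Prod>b\<in>UNIV. \<integral>\<^sup>+\<omega>. case_bool X Y b \<omega> \<partial>M)"
    by (rule indep_vars_nn_integral[OF _ ind]) auto
  then show ?thesis by (simp add: UNIV_bool mult.commute)
qed

locale bernoulli_environment =
  fixes p :: real
  assumes p_pos: "0 < p" and p_less_1: "p < 1"
begin

definition \<nu> :: "(site \<Rightarrow> bool) measure" where
  "\<nu> = PiM UNIV (\<lambda>_. measure_pmf (bernoulli_pmf p))"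

sublocale env: prob_space \<nu>
  unfolding \<nu>_def by (rule prob_space_PiM) (rule measure_pmf.prob_space_axioms)

lemma sets_\<nu> [measurable_cong]: "sets \<nu> = sets (PiM UNIV (\<lambda>_. count_space UNIV))"
  unfolding \<nu>_def by (rule sets_PiM_cong) auto

lemma space_\<nu> [simp]: "space \<nu> = UNIV"
  by (simp add: \<nu>_def space_PiM)

lemma measurable_coord [measurable]: "(\<lambda>u. u z) \<in> \<nu> \<rightarrow>\<^sub>M count_space UNIV"
  using measurable_cong_sets[OF sets_\<nu> refl] measurable_component_singleton[of z UNIV "\<lambda>_. count_space UNIV"]
  by blast

lemma distr_coord: "distr \<nu> (count_space UNIV) (\<lambda>u. u z) = measure_pmf (bernoulli_pmf p)"
proof -
  have "distr \<nu> (measure_pmf (bernoulli_pmf p)) (\<lambda>u. u z) = measure_pmf (bernoulli_pmf p)"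
    unfolding \<nu>_def using distr_PiM_component[of UNIV "\<lambda>_. measure_pmf (bernoulli_pmf p)" z]
    by (simp add: measure_pmf.prob_space_axioms)
  moreover have "distr \<nu> (measure_pmf (bernoulli_pmf p)) (\<lambda>u. u z) = distr \<nu> (count_space UNIV) (\<lambda>u. u z)"
    by (rule distr_cong) auto
  ultimately show ?thesis by simp
qed

lemma indep_coords: "env.indep_vars (\<lambda>_. count_space UNIV) (\<lambda>z u. u z) UNIV"
proof -
  have "distr \<nu> (PiM UNIV (\<lambda>_. count_space UNIV)) (\<lambda>u. \<lambda>z\<in>UNIV. u z) = \<nu>"
    using distr_id2[OF sets_\<nu>[symmetric]] by (simp add: restrict_UNIV)
  also have "\<nu> = PiM UNIV (\<lambda>z. distr \<nu> (count_space UNIV) (\<lambda>u. u z))"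
    by (simp add: distr_coord) (simp add: \<nu>_def)
  finally show ?thesis
    by (subst env.indep_vars_iff_distr_eq_PiM') auto
qed

lemma nn_integral_indep:
  fixes f h :: "(site \<Rightarrow> bool) \<Rightarrow> ennreal"
  assumes [measurable]: "f \<in> borel_measurable \<nu>" "h \<in> borel_measurable \<nu>"
    and f: "depends_on I f" and h: "depends_on J h" and IJ: "I \<inter> J = {}"
  shows "(\<integral>\<^sup>+u. f u * h u \<partial>\<nu>) = (\<integral>\<^sup>+u. f u \<partial>\<nu>) * (\<integral>\<^sup>+u. h u \<partial>\<nu>)"
proof -
  \<comment> \<open>Filling the coordinates outside \<open>K\<close> with \<open>False\<close> makes
    \<open>f\<close> a function of the restricted configuration. The filler is harmless because
    \<open>f\<close> does not see these coordinates.\<close>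
  define ext where "ext K w = (\<lambda>z. if z \<in> K then w z else False)" for K and w :: "site \<Rightarrow> bool"
  have ext: "ext K \<in> PiM K (\<lambda>_. count_space UNIV) \<rightarrow>\<^sub>M \<nu>" for K
  proof -
    have "(\<lambda>w. if z \<in> K then w z else False) \<in> PiM K (\<lambda>_. count_space UNIV) \<rightarrow>\<^sub>M count_space UNIV" for z
      by (cases "z \<in> K") auto
    then have "(\<lambda>w. \<lambda>z\<in>UNIV. if z \<in> K then w z else False) \<in>
        PiM K (\<lambda>_. count_space UNIV) \<rightarrow>\<^sub>M PiM UNIV (\<lambda>_. count_space UNIV)"
      by (intro measurable_restrict) auto
    then show ?thesis
      using measurable_cong_sets[OF refl sets_\<nu>] by (simp add: ext_def[abs_def] restrict_UNIV)
  qed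
  have "env.indep_var (PiM I (\<lambda>_. count_space UNIV)) (\<lambda>u. restrict u I)
      (PiM J (\<lambda>_. count_space UNIV)) (\<lambda>u. restrict u J)"
    using env.indep_var_restrict[OF indep_coords IJ] by simp
  then have "env.indep_var borel ((f \<circ> ext I) \<circ> (\<lambda>u. restrict u I)) borel ((h \<circ> ext J) \<circ> (\<lambda>u. restrict u J))"
    by (rule env.indep_var_compose) (auto intro: measurable_comp[OF ext])
  moreover have "(f \<circ> ext I) \<circ> (\<lambda>u. restrict u I) = f"
    using f by (auto simp: fun_eq_iff ext_def intro: depends_onD)
  moreover have "(h \<circ> ext J) \<circ> (\<lambda>u. restrict u J) = h"
    using h by (auto simp: fun_eq_iff ext_def intro: depends_onD)
  ultimately show ?thesis using env.indep_var_nn_integral[of f h] by simp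
qed

lemma nn_integral_shift:
  assumes [measurable]: "f \<in> borel_measurable \<nu>"
  shows "(\<integral>\<^sup>+u. f (\<lambda>z. u (z + s)) \<partial>\<nu>) = (\<integral>\<^sup>+u. f u \<partial>\<nu>)"
proof -
  have "distr \<nu> \<nu> (\<lambda>u. \<lambda>z\<in>UNIV. u (z + s)) = \<nu>"
    unfolding \<nu>_def by (rule distr_PiM_reindex) (auto simp: inj_on_def measure_pmf.prob_space_axioms)
  then have d: "distr \<nu> \<nu> (\<lambda>u z. u (z + s)) = \<nu>" by (simp add: restrict_UNIV)
  have "(\<lambda>u. \<lambda>z\<in>UNIV. u (z + s)) \<in> \<nu> \<rightarrow>\<^sub>M PiM UNIV (\<lambda>_. count_space UNIV)"
    by (intro measurable_restrict) auto
  then have [measurable]: "(\<lambda>u z. u (z + s)) \<in> \<nu> \<rightarrow>\<^sub>M \<nu>"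
    using measurable_cong_sets[OF refl sets_\<nu>] by (simp add: restrict_UNIV)
  have "(\<integral>\<^sup>+u. f u \<partial>\<nu>) = (\<integral>\<^sup>+u. f u \<partial>distr \<nu> \<nu> (\<lambda>u z. u (z + s)))" by (simp only: d)
  also have "\<dots> = (\<integral>\<^sup>+u. f (\<lambda>z. u (z + s)) \<partial>\<nu>)" by (rule nn_integral_distr) auto
  finally show ?thesis by simp
qed

lemma nn_integral_coord:
  "(\<integral>\<^sup>+u. f (u z) \<partial>\<nu>) = ennreal p * f True + ennreal (1 - p) * f False"
proof -
  have "(\<integral>\<^sup>+u. f (u z) \<partial>\<nu>) = (\<integral>\<^sup>+b. f b \<partial>distr \<nu> (count_space UNIV) (\<lambda>u. u z))"
    by (subst nn_integral_distr) auto
  also have "\<dots> = (\<integral>\<^sup>+b. f b \<partial>measure_pmf (bernoulli_pmf p))" by (simp add: distr_coord)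
  also have "\<dots> = (\<Sum>b\<in>UNIV. f b * pmf (bernoulli_pmf p) b)"
    using p_pos p_less_1 by (subst nn_integral_measure_pmf_finite) (auto simp: set_pmf_bernoulli UNIV_bool)
  finally show ?thesis using p_pos p_less_1 by (simp add: UNIV_bool mult.commute add.commute)
qed

end

section \<open>Poisson equation for the exit time of a line\<close>

text \<open>Transition operator of the walk killed on leaving its horizontal line: at an up site the
  missing half of the mass is the jump by \<open>e2\<close>.\<close>

definition killed_step :: "(site \<Rightarrow> bool) \<Rightarrow> (site \<Rightarrow> ennreal) \<Rightarrow> site \<Rightarrow> ennreal" where
  "killed_step u h x = (h (x + e1) + (if u x then 0 else h (x - e1))) / 2"

lemma killed_step_add: "killed_step u (\<lambda>x. f x + h x) = (\<lambda>x. killed_step u f x + killed_step u h x)"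
  by (auto simp: killed_step_def fun_eq_iff add_divide_distrib_ennreal[symmetric] ac_simps)

lemma killed_step_mono: "(\<And>x. f x \<le> h x) \<Longrightarrow> killed_step u f x \<le> killed_step u h x"
  unfolding killed_step_def by (intro divide_right_mono_ennreal add_mono) simp_all

lemma killed_step_funpow_add:
  "(killed_step u ^^ n) (\<lambda>x. f x + h x) x = (killed_step u ^^ n) f x + (killed_step u ^^ n) h x"
proof -
  have "(killed_step u ^^ n) (\<lambda>x. f x + h x) = (\<lambda>x. (killed_step u ^^ n) f x + (killed_step u ^^ n) h x)"
    by (induction n) (simp_all add: killed_step_add)
  then show ?thesis by simp
qed

lemma killed_step_funpow_mono:
  "(\<And>x. f x \<le> h x) \<Longrightarrow> (killed_step u ^^ n) f x \<le> (killed_step u ^^ n) h x"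
  by (induction n arbitrary: x) (auto intro: killed_step_mono)

lemma killed_step_funpow_shift: "(killed_step u ^^ n) (killed_step u h) x = (killed_step u ^^ Suc n) h x"
  by (simp only: funpow_Suc_right comp_apply)

abbreviation survival :: "(site \<Rightarrow> bool) \<Rightarrow> nat \<Rightarrow> site \<Rightarrow> ennreal" where
  "survival u n \<equiv> (killed_step u ^^ n) (\<lambda>_. 1)"

text \<open>Probability that the line is left exactly at step \<open>n + 1\<close>: after
  \<open>n\<close> steps on the line the walk stands at an up site and then jumps.\<close>

abbreviation exit_prob :: "(site \<Rightarrow> bool) \<Rightarrow> nat \<Rightarrow> site \<Rightarrow> ennreal" where
  "exit_prob u n \<equiv> (killed_step u ^^ n) (\<lambda>x. of_bool (u x) / 2)"

lemma ennreal_half_add: "(1::ennreal) / 2 + 1 / 2 = 1"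
proof -
  have "(1::ennreal) / 2 + 1 / 2 = 2 / 2" by (simp add: add_divide_distrib_ennreal[symmetric])
  also have "\<dots> = 1" by (rule ennreal_divide_self) auto
  finally show ?thesis .
qed

lemma survival_eq: "survival u n x = survival u (Suc n) x + exit_prob u n x"
proof -
  have "killed_step u (\<lambda>_. 1) x + of_bool (u x) / 2 = 1" for x
    by (auto simp: killed_step_def ennreal_half_add intro: ennreal_divide_self)
  then have "survival u n x = (killed_step u ^^ n) (\<lambda>x. killed_step u (\<lambda>_. 1) x + of_bool (u x) / 2) x"
    by simp
  also have "\<dots> = survival u (Suc n) x + exit_prob u n x"
    by (simp only: killed_step_funpow_add killed_step_funpow_shift)
  finally show ?thesis .
qed

text \<open>The term after \<open>n\<close> iterations cannot be discarded here, since
  \<open>V = top\<close> also satisfies the hypothesis. It is shown to vanish in the mean in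
  \<open>suminf_tail\<close>.\<close>

lemma poisson_telescope:
  assumes "\<And>x. V x = 1 + killed_step u V x"
  shows "V x = (\<Sum>j<n. survival u j x) + (killed_step u ^^ n) V x"
proof (induction n)
  case (Suc n)
  have V: "V = (\<lambda>x. 1 + killed_step u V x)" using assms by (rule ext)
  have "(killed_step u ^^ n) V x = (killed_step u ^^ n) (\<lambda>x. 1 + killed_step u V x) x"
    using arg_cong[OF V, of "\<lambda>h. (killed_step u ^^ n) h x"] .
  also have "\<dots> = survival u n x + (killed_step u ^^ Suc n) V x"
    by (simp only: killed_step_funpow_add killed_step_funpow_shift)
  finally show ?case using Suc by (simp add: ac_simps)
qed simp

text \<open>With the expected exit time as \<open>h\<close>, the sum adds up the expected remaining
  times after each number of steps. For an exit time \<open>T\<close> the full sum is the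
  expectation of \<open>T (T + 1) / 2\<close>, which is how \<open>V\<close> controls a second
  moment.\<close>

lemma supersolution_telescope:
  assumes "\<And>x. h x + killed_step u V x \<le> V x"
  shows "(\<Sum>j<n. (killed_step u ^^ j) h x) + (killed_step u ^^ n) V x \<le> V x"
proof (induction n)
  case (Suc n)
  have "(killed_step u ^^ n) h x + (killed_step u ^^ Suc n) V x =
      (killed_step u ^^ n) (\<lambda>x. h x + killed_step u V x) x"
    by (simp only: killed_step_funpow_add killed_step_funpow_shift)
  also have "\<dots> \<le> (killed_step u ^^ n) V x"
    by (rule killed_step_funpow_mono) (rule assms)
  finally have "(\<Sum>j<n. (killed_step u ^^ j) h x) + ((killed_step u ^^ n) h x + (killed_step u ^^ Suc n) V x)
      \<le> V x"
    using Suc by (meson add_left_mono order_trans)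
  then show ?case by (simp add: ac_simps)
qed simp

lemma killed_step_funpow_ge_survival:
  assumes "\<And>x. V x = 1 + killed_step u V x"
  shows "(\<Sum>j<m. survival u (n + j) x) \<le> (killed_step u ^^ n) V x"
proof -
  have "(killed_step u ^^ n) V x = (\<Sum>j<m. survival u (n + j) x) + (killed_step u ^^ (n + m)) V x"
  proof (induction m)
    case (Suc m)
    have V: "V = (\<lambda>x. 1 + killed_step u V x)" using assms by (rule ext)
    have "(killed_step u ^^ (n + m)) V x = (killed_step u ^^ (n + m)) (\<lambda>x. 1 + killed_step u V x) x"
      using arg_cong[OF V, of "\<lambda>h. (killed_step u ^^ (n + m)) h x"] .
    also have "\<dots> = survival u (n + m) x + (killed_step u ^^ Suc (n + m)) V x"
      by (simp only: killed_step_funpow_add killed_step_funpow_shift)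
    finally show ?case using Suc by (simp add: ac_simps)
  qed simp
  then show ?thesis by simp
qed

text \<open>The indices of \<open>next_up\<close> and \<open>prev_up\<close> count the flat sites up to the up site, so they are smaller
  by one than the lengths \<open>a\<close> and \<open>b\<close> of the introduction.\<close>

primrec next_up :: "(site \<Rightarrow> bool) \<Rightarrow> nat \<Rightarrow> site \<Rightarrow> bool" where
  "next_up u 0 x \<longleftrightarrow> u (x + e1)"
| "next_up u (Suc b) x \<longleftrightarrow> \<not> u (x + e1) \<and> next_up u b (x + e1)"

primrec prev_up :: "(site \<Rightarrow> bool) \<Rightarrow> nat \<Rightarrow> site \<Rightarrow> bool" where
  "prev_up u 0 x \<longleftrightarrow> u x"
| "prev_up u (Suc a) x \<longleftrightarrow> \<not> u x \<and> prev_up u a (x - e1)"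

definition east :: "nat \<Rightarrow> site \<Rightarrow> site" where "east b x = x + (int b, 0)"

lemma east_Suc: "east (Suc b) x = east b (x + e1)"
  by (cases x) (simp add: east_def e1_def)

lemma east_1: "east (Suc 0) x = x + e1"
  by (simp add: east_def e1_def)

lemma east_Suc_minus: "east (Suc b) (x - e1) = east b x"
  by (cases x) (simp add: east_def e1_def)

section \<open>Nearest up sites and the costs determined by them\<close>

lemma next_up_unique: "next_up u b x \<Longrightarrow> next_up u b' x \<Longrightarrow> b = b'"
proof (induction b arbitrary: x b')
  case 0 then show ?case by (cases b') auto
next
  case (Suc b)
  show ?case
  proof (cases b')
    case 0 with Suc.prems show ?thesis by simp
  next
    case (Suc k) with Suc.prems Suc.IH[of "x + e1" k] show ?thesis by simp
  qed
qed

lemma prev_up_unique: "prev_up u a x \<Longrightarrow> prev_up u a' x \<Longrightarrow> a = a'"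
proof (induction a arbitrary: x a')
  case 0 then show ?case by (cases a') auto
next
  case (Suc a)
  show ?case
  proof (cases a')
    case 0 with Suc.prems show ?thesis by simp
  next
    case (Suc k) with Suc.prems Suc.IH[of "x - e1" k] show ?thesis by simp
  qed
qed

lemma suminf_single_ennreal:
  fixes F :: "nat \<Rightarrow> ennreal"
  assumes "\<And>i. P i \<longleftrightarrow> i = k"
  shows "(\<Sum>i. of_bool (P i) * F i) = F k"
proof -
  have "(\<lambda>i. of_bool (P i) * F i) = (\<lambda>i. if i = k then F k else 0)"
    using assms by (auto simp: fun_eq_iff)
  then show ?thesis using sums_single[of k "\<lambda>_. F k"] by (metis sums_unique)
qed

lemma suminf_next_up: "next_up u b x \<Longrightarrow> (\<Sum>i. of_bool (next_up u i x) * F i) = (F b :: ennreal)"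
  by (rule suminf_single_ennreal) (auto dest: next_up_unique)

lemma suminf_prev_up: "prev_up u a x \<Longrightarrow> (\<Sum>i. of_bool (prev_up u i x) * F i) = (F a :: ennreal)"
  by (rule suminf_single_ennreal) (auto dest: prev_up_unique)

text \<open>Expectation of \<open>h\<close> at the next up site, for the walk started at an up site.
  At \<open>x\<close> the upward jump replaces the step to the left, so the walk performs a
  gambler's ruin on an interval of length \<open>b + 2\<close>, starting at distance one from its
  left end; it wins with probability \<open>1 / (b + 2)\<close>. The series has at most one non-zero
  term, and it can be measured and integrated termwise.\<close>

definition hop :: "(site \<Rightarrow> bool) \<Rightarrow> (site \<Rightarrow> ennreal) \<Rightarrow> site \<Rightarrow> ennreal" where
  "hop u h x = (\<Sum>b. of_bool (next_up u b x) * (h (east (Suc b) x) / of_nat (b + 2)))"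

text \<open>The argument \<open>C\<close> of the following definitions is the cost per time step: \<open>C s y\<close> is charged on the gap
  to the left of the up site \<open>y\<close> if it has length \<open>s - 1\<close>.\<close>

definition gap_cost :: "(nat \<Rightarrow> site \<Rightarrow> ennreal) \<Rightarrow> (site \<Rightarrow> bool) \<Rightarrow> site \<Rightarrow> ennreal" where
  "gap_cost C u x = (\<Sum>b. of_bool (next_up u b x) * (C (b + 2) (east (Suc b) x) * of_nat (b + 1)))"

text \<open>An up site is never crossed to the left, so the walk visits up sites of a line from left
  to right. The term with index \<open>k\<close> is the cost incurred between the up site numbered
  \<open>k\<close> after \<open>x\<close> and the following one. The series unrolls a recursion that
  runs to the right without end.\<close>

definition up_cost :: "(nat \<Rightarrow> site \<Rightarrow> ennreal) \<Rightarrow> (site \<Rightarrow> bool) \<Rightarrow> site \<Rightarrow> ennreal" where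
  "up_cost C u x = (\<Sum>k. (hop u ^^ k) (gap_cost C u) x)"

text \<open>Gambler's ruin again: leaving the line acts as absorption one site left of the previous
  up site. The interval has length \<open>a + b + 2\<close>, and \<open>x\<close> has distances
  \<open>a + 1\<close> and \<open>b + 1\<close> from its ends. Hence the mean duration is
  \<open>(a + 1) * (b + 1)\<close>, and the right end is reached with probability
  \<open>(a + 1) / (a + b + 2)\<close>.\<close>

definition line_cost :: "(nat \<Rightarrow> site \<Rightarrow> ennreal) \<Rightarrow> (site \<Rightarrow> bool) \<Rightarrow> site \<Rightarrow> ennreal" where
  "line_cost C u x = (\<Sum>a. of_bool (prev_up u a x) * (\<Sum>b. of_bool (next_up u b x) *
    (C (a + b + 2) (east (Suc b) x) * of_nat ((a + 1) * (b + 1)) +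
     of_nat (a + 1) * (up_cost C u (east (Suc b) x) / of_nat (a + b + 2)))))"

lemma hop_eq: "next_up u b x \<Longrightarrow> hop u h x = h (east (Suc b) x) / of_nat (b + 2)"
  unfolding hop_def by (rule suminf_next_up)

lemma gap_cost_eq: "next_up u b x \<Longrightarrow> gap_cost C u x = C (b + 2) (east (Suc b) x) * of_nat (b + 1)"
  unfolding gap_cost_def by (rule suminf_next_up)

lemma up_cost_eq:
  assumes "next_up u b x"
  shows "up_cost C u x = C (b + 2) (east (Suc b) x) * of_nat (b + 1) + up_cost C u (east (Suc b) x) / of_nat (b + 2)"
proof -
  have "up_cost C u x = (hop u ^^ 0) (gap_cost C u) x + (\<Sum>k. (hop u ^^ Suc k) (gap_cost C u) x)"
    unfolding up_cost_def
    using suminf_offset[of "\<lambda>k. (hop u ^^ k) (gap_cost C u) x" 1] by (simp add: add.commute)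
  also have "(\<Sum>k. (hop u ^^ Suc k) (gap_cost C u) x) =
      (\<Sum>k. (hop u ^^ k) (gap_cost C u) (east (Suc b) x) * inverse (of_nat (b + 2)))"
    using assms by (simp add: hop_eq divide_ennreal_def)
  also have "\<dots> = up_cost C u (east (Suc b) x) / of_nat (b + 2)"
    by (simp only: ennreal_suminf_multc up_cost_def divide_ennreal_def)
  finally show ?thesis by (simp add: gap_cost_eq[OF assms])
qed

lemma line_cost_eq:
  assumes "prev_up u a x" "next_up u b x"
  shows "line_cost C u x = C (a + b + 2) (east (Suc b) x) * of_nat ((a + 1) * (b + 1)) +
     of_nat (a + 1) * (up_cost C u (east (Suc b) x) / of_nat (a + b + 2))"
  unfolding line_cost_def by (simp only: suminf_prev_up[OF assms(1)] suminf_next_up[OF assms(2)])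

section \<open>Poisson equation and supersolution between up sites\<close>

definition good_env :: "(site \<Rightarrow> bool) \<Rightarrow> bool" where
  "good_env u \<longleftrightarrow> (\<forall>x. (\<exists>a. prev_up u a x) \<and> (\<exists>b. next_up u b x))"

text \<open>The discrete Laplacian of \<open>a * b\<close> is constant when \<open>a + b\<close> is, and the linear term is harmonic. Since
  the formula vanishes for \<open>a = 0\<close> and continues to the next up site, it also holds at both ends.\<close>

lemma gap_parabola_identity:
  fixes c r :: ennreal
  shows "c * of_nat ((a + 1) * (b + 1)) + of_nat (a + 1) * r =
    c + ((c * of_nat ((a + 2) * b) + of_nat (a + 2) * r) + (c * of_nat (a * (b + 2)) + of_nat a * r)) / 2"
    (is "?X = c + ?N / 2")
proof -
  have "?X * 2 = c * of_nat (2 * ((a + 1) * (b + 1))) + of_nat (2 * (a + 1)) * r"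
  proof -
    have "(c * of_nat m + of_nat n * r) * 2 = c * of_nat (2 * m) + of_nat (2 * n) * r" for m n
      by (simp add: distrib_right mult_ac)
    then show ?thesis .
  qed
  also have "2 * ((a + 1) * (b + 1)) = 2 + ((a + 2) * b + a * (b + 2))" by simp
  also have "2 * (a + 1) = (a + 2) + a" by simp
  finally have "?X * 2 = c * 2 + ?N"
  proof -
    have "c * of_nat (2 + (m + k)) + of_nat (i + j) * r =
        c * 2 + ((c * of_nat m + of_nat i * r) + (c * of_nat k + of_nat j * r))" for m k i j
      by (simp add: distrib_left distrib_right mult_2_right add_ac)
    then show "?X * 2 = c * of_nat (2 + ((a + 2) * b + a * (b + 2))) + of_nat (a + 2 + a) * r \<Longrightarrow>
        ?X * 2 = c * 2 + ?N" by (simp only:)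
  qed
  then have "?X * 2 / 2 = c * 2 / 2 + ?N / 2" by (simp add: add_divide_distrib_ennreal)
  moreover have "z * 2 / 2 = z" for z :: ennreal by (rule mult_divide_eq_ennreal) auto
  ultimately show ?thesis by (simp only:)
qed

lemma line_cost_poisson:
  assumes u: "good_env u" and a: "prev_up u a x" and b: "next_up u b x"
  shows "line_cost C u x = C (a + b + 2) (east (Suc b) x) + killed_step u (line_cost C u) x"
proof -
  define y where "y = east (Suc b) x"
  define c where "c = C (a + b + 2) y"
  define r where "r = up_cost C u y / of_nat (a + b + 2)"
  have east: "line_cost C u (x + e1) = c * of_nat ((a + 2) * b) + of_nat (a + 2) * r"
  proof (cases b)
    case 0
    then have "u (x + e1)" using b by simp
    moreover obtain b' where b': "next_up u b' (x + e1)" using u unfolding good_env_def by blast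
    \<comment> \<open>The site \<open>x + e1\<close> belongs to the following gap. Its cost has left
      index \<open>0\<close> and is \<open>up_cost\<close> by the recursion of the latter, so the
      terms of the new gap disappear.\<close>
    ultimately have "line_cost C u (x + e1) = up_cost C u (x + e1)"
      using line_cost_eq[of u 0 "x + e1" b' C] up_cost_eq[OF b', of C] by simp
    also have "\<dots> = of_nat (a + 2) * r"
      using ennreal_times_divide[of "of_nat (a + 2)" "up_cost C u y" "of_nat (a + 2)"]
        mult_divide_eq_ennreal[of "of_nat (a + 2)" "up_cost C u y"] 0
      by (simp add: r_def y_def east_1 mult.commute)
    finally show ?thesis using 0 by simp
  next
    case (Suc b')
    have "prev_up u (Suc a) (x + e1)" "next_up u b' (x + e1)" using a b Suc by simp_all
    from line_cost_eq[OF this, of C] show ?thesis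
      by (simp add: Suc c_def r_def y_def east_Suc)
  qed
  have west: "(if u x then 0 else line_cost C u (x - e1)) = c * of_nat (a * (b + 2)) + of_nat a * r"
  proof (cases a)
    case 0 then show ?thesis using a by simp
  next
    case (Suc a')
    then have "prev_up u a' (x - e1)" "next_up u (Suc b) (x - e1)" "\<not> u x" using a b by simp_all
    with line_cost_eq[OF this(1,2), of C] show ?thesis
      by (simp add: Suc c_def r_def y_def east_Suc_minus)
  qed
  have "line_cost C u x = c * of_nat ((a + 1) * (b + 1)) + of_nat (a + 1) * r"
    using line_cost_eq[OF a b, of C] by (simp only: c_def r_def y_def)
  also have "\<dots> = c + killed_step u (line_cost C u) x"
    by (subst gap_parabola_identity) (simp only: killed_step_def east west)
  finally show ?thesis by (simp only: c_def y_def)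
qed

abbreviation "exit_time \<equiv> line_cost (\<lambda>_ _. 1)"

text \<open>The Poisson equation for \<open>line_cost\<close> requires a charge that is constant on
  each gap. The exit time is not, so it is replaced by an upper bound that depends on the gap
  alone.\<close>

abbreviation "time_bound u s y \<equiv> of_nat s ^ 2 + up_cost (\<lambda>_ _. 1) u y"

lemma exit_time_poisson: "good_env u \<Longrightarrow> exit_time u x = 1 + killed_step u (exit_time u) x"
  using line_cost_poisson[of u _ x] unfolding good_env_def by blast

lemma exit_time_le:
  assumes "prev_up u a x" "next_up u b x"
  shows "exit_time u x \<le> time_bound u (a + b + 2) (east (Suc b) x)"
proof -
  have "(a + 1) * (b + 1) \<le> (a + b + 2)\<^sup>2"
    by (simp add: power2_eq_square algebra_simps)
  then have "of_nat ((a + 1) * (b + 1)) \<le> (of_nat (a + b + 2)^2 :: ennreal)"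
    unfolding of_nat_power[symmetric] by (rule of_nat_mono)
  moreover have "of_nat (a + 1) * (z / of_nat (a + b + 2)) \<le> z" for z :: ennreal
  proof -
    have "of_nat (a + 1) * (z / of_nat (a + b + 2)) \<le> of_nat (a + b + 2) * (z / of_nat (a + b + 2))"
      by (intro mult_right_mono of_nat_mono) auto
    also have "\<dots> = z"
      using ennreal_times_divide[of "of_nat (a + b + 2)" z "of_nat (a + b + 2)"]
        mult_divide_eq_ennreal[of "of_nat (a + b + 2)" z]
      by (simp add: mult.commute)
    finally show ?thesis .
  qed
  ultimately show ?thesis
    unfolding line_cost_eq[OF assms] by (intro add_mono) simp_all
qed

lemma time_bound_supersolution:
  assumes "good_env u"
  shows "exit_time u x + killed_step u (line_cost (time_bound u) u) x \<le> line_cost (time_bound u) u x"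
proof -
  obtain a b where "prev_up u a x" "next_up u b x" using assms unfolding good_env_def by blast
  then show ?thesis
    using exit_time_le line_cost_poisson[OF assms, of a x b "time_bound u"] by (simp add: add_right_mono)
qed

section \<open>Expectations over a line of the environment\<close>

lemma measurable_of_bool_ennreal [measurable]:
  "Measurable.pred M P \<Longrightarrow> (\<lambda>x. of_bool (P x) :: ennreal) \<in> borel_measurable M"
  by (rule measurable_compose[of P M "count_space UNIV"]) auto

definition right_of :: "site \<Rightarrow> site set" where
  "right_of x = {z. snd z = snd x \<and> fst x < fst z}"

definition left_upto :: "site \<Rightarrow> site set" where
  "left_upto x = {z. snd z = snd x \<and> fst z \<le> fst x}"

definition segment :: "nat \<Rightarrow> site \<Rightarrow> site set" where
  "segment b x = {z. snd z = snd x \<and> fst x < fst z \<and> fst z \<le> fst x + int b}"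

lemma right_of_east: "right_of (east b x) \<subseteq> right_of x"
  by (auto simp: right_of_def east_def)

lemma segment_subset_right_of: "segment b x \<subseteq> right_of x"
  by (auto simp: right_of_def segment_def)

text \<open>Renewal property: the event that the next up site is a given one inspects no site beyond
  it, and is thus independent of everything to the right of that site.\<close>

lemma next_up_depends: "depends_on (segment (Suc b) x) (\<lambda>u. next_up u b x)"
proof (induction b arbitrary: x)
  case 0
  have "x + e1 \<in> segment (Suc 0) x" by (auto simp: segment_def e1_def)
  then show ?case by (simp add: depends_on_def)
next
  case (Suc b)
  have "x + e1 \<in> segment (Suc (Suc b)) x" by (auto simp: segment_def e1_def)
  moreover have "segment (Suc b) (x + e1) \<subseteq> segment (Suc (Suc b)) x" by (auto simp: segment_def e1_def)
  ultimately show ?case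
    using Suc[of "x + e1"] unfolding depends_on_def next_up.simps by blast
qed

lemma prev_up_depends: "depends_on (left_upto x) (\<lambda>u. prev_up u a x)"
proof (induction a arbitrary: x)
  case 0
  have "x \<in> left_upto x" by (auto simp: left_upto_def)
  then show ?case by (simp add: depends_on_def)
next
  case (Suc a)
  have "x \<in> left_upto x" by (auto simp: left_upto_def)
  moreover have "left_upto (x - e1) \<subseteq> left_upto x" by (auto simp: left_upto_def e1_def)
  ultimately show ?case
    using Suc[of "x - e1"] unfolding depends_on_def prev_up.simps by blast
qed

lemma hop_depends:
  assumes "\<And>y. depends_on (right_of y) (\<lambda>u. Z u y)"
  shows "depends_on (right_of x) (\<lambda>u. hop u (Z u) x)"
proof (rule depends_onI)
  fix u v :: "site \<Rightarrow> bool" assume uv: "\<And>z. z \<in> right_of x \<Longrightarrow> u z = v z"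
  have "next_up u b x = next_up v b x" for b
    by (rule depends_onD[OF next_up_depends]) (use uv segment_subset_right_of in blast)
  moreover have "Z u (east (Suc b) x) = Z v (east (Suc b) x)" for b
    by (rule depends_onD[OF assms]) (use uv right_of_east in blast)
  ultimately show "hop u (Z u) x = hop v (Z v) x" by (simp only: hop_def)
qed

lemma hop_funpow_depends:
  assumes "\<And>y. depends_on (right_of y) (\<lambda>u. Z u y)"
  shows "depends_on (right_of x) (\<lambda>u. (hop u ^^ k) (Z u) x)"
proof (induction k arbitrary: x)
  case 0 then show ?case using assms by simp
next
  case (Suc k)
  from hop_depends[OF this] show ?case by simp
qed

lemma gap_cost_depends:
  assumes "\<And>s y. depends_on (right_of y) (\<lambda>u. C u s y)"
  shows "depends_on (right_of x) (\<lambda>u. gap_cost (C u) u x)"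
proof (rule depends_onI)
  fix u v :: "site \<Rightarrow> bool" assume uv: "\<And>z. z \<in> right_of x \<Longrightarrow> u z = v z"
  have "next_up u b x = next_up v b x" for b
    by (rule depends_onD[OF next_up_depends]) (use uv segment_subset_right_of in blast)
  moreover have "C u s (east (Suc b) x) = C v s (east (Suc b) x)" for b s
    by (rule depends_onD[OF assms]) (use uv right_of_east in blast)
  ultimately show "gap_cost (C u) u x = gap_cost (C v) v x" by (simp only: gap_cost_def)
qed

lemma up_cost_depends:
  assumes "\<And>s y. depends_on (right_of y) (\<lambda>u. C u s y)"
  shows "depends_on (right_of x) (\<lambda>u. up_cost (C u) u x)"
  unfolding up_cost_def
  by (rule depends_on_fun[where h = suminf and f = "\<lambda>u k. (hop u ^^ k) (gap_cost (C u) u) x"])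
    (rule hop_funpow_depends[OF gap_cost_depends[OF assms]])

lemma suminf_swap_ennreal:
  "(\<Sum>a. \<Sum>b. f a b :: ennreal) = (\<Sum>b. \<Sum>a. f a b)" for f :: "nat \<Rightarrow> nat \<Rightarrow> ennreal"
  using nn_integral_suminf[of "\<lambda>b a. f a b" "count_space UNIV"]
  by (simp add: nn_integral_count_space_nat)

context bernoulli_environment
begin

definition geo :: "nat \<Rightarrow> ennreal" where "geo b = ennreal (p * (1 - p) ^ b)"

lemma measurable_next_up [measurable]: "Measurable.pred \<nu> (\<lambda>u. next_up u b x)"
  by (induction b arbitrary: x) simp_all

lemma measurable_prev_up [measurable]: "Measurable.pred \<nu> (\<lambda>u. prev_up u b x)"
  by (induction b arbitrary: x) simp_all

lemma measurable_hop:
  assumes [measurable]: "\<And>y. (\<lambda>u. Z u y) \<in> borel_measurable \<nu>"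
  shows "(\<lambda>u. hop u (Z u) x) \<in> borel_measurable \<nu>"
  unfolding hop_def by measurable

lemma measurable_hop_funpow:
  assumes "\<And>y. (\<lambda>u. Z u y) \<in> borel_measurable \<nu>"
  shows "(\<lambda>u. (hop u ^^ k) (Z u) x) \<in> borel_measurable \<nu>"
proof (induction k arbitrary: x)
  case (Suc k)
  from measurable_hop[OF this] show ?case by simp
qed (simp add: assms)

lemma measurable_gap_cost:
  assumes [measurable]: "\<And>s y. (\<lambda>u. C u s y) \<in> borel_measurable \<nu>"
  shows "(\<lambda>u. gap_cost (C u) u x) \<in> borel_measurable \<nu>"
  unfolding gap_cost_def by measurable

lemma measurable_up_cost:
  assumes "\<And>s y. (\<lambda>u. C u s y) \<in> borel_measurable \<nu>"
  shows "(\<lambda>u. up_cost (C u) u x) \<in> borel_measurable \<nu>"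
proof -
  note [measurable] = measurable_hop_funpow[OF measurable_gap_cost[OF assms]]
  show ?thesis unfolding up_cost_def by measurable
qed

lemma measurable_line_cost:
  assumes [measurable]: "\<And>s y. (\<lambda>u. C u s y) \<in> borel_measurable \<nu>"
  shows "(\<lambda>u. line_cost (C u) u x) \<in> borel_measurable \<nu>"
proof -
  note [measurable] = measurable_up_cost[OF assms]
  show ?thesis unfolding line_cost_def by measurable
qed

lemma geo_0: "geo 0 = ennreal p" and geo_Suc: "geo (Suc b) = ennreal (1 - p) * geo b"
  using p_pos p_less_1 by (simp_all add: geo_def ennreal_mult[symmetric] mult.left_commute)

lemma nn_integral_next_up: "(\<integral>\<^sup>+u. of_bool (next_up u b x) \<partial>\<nu>) = geo b"
proof (induction b arbitrary: x)
  case 0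
  then show ?case using nn_integral_coord[of of_bool "x + e1"] by (simp add: geo_0)
next
  case (Suc b)
  have "(\<integral>\<^sup>+u. of_bool (next_up u (Suc b) x) \<partial>\<nu>) =
      (\<integral>\<^sup>+u. of_bool (\<not> u (x + e1)) * of_bool (next_up u b (x + e1)) \<partial>\<nu>)"
    by (intro nn_integral_cong) auto
  also have "\<dots> = (\<integral>\<^sup>+u. of_bool (\<not> u (x + e1)) \<partial>\<nu>) * (\<integral>\<^sup>+u. of_bool (next_up u b (x + e1)) \<partial>\<nu>)"
    by (rule nn_integral_indep[where I = "{x + e1}",
          OF _ _ depends_on_coord depends_on_comp[OF next_up_depends]])
      (auto simp: segment_def)
  also have "\<dots> = geo (Suc b)"
    using nn_integral_coord[of "\<lambda>b. of_bool (\<not> b)" "x + e1"] by (simp add: Suc geo_Suc)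
  finally show ?case .
qed

lemma nn_integral_prev_up: "(\<integral>\<^sup>+u. of_bool (prev_up u a x) \<partial>\<nu>) = geo a"
proof (induction a arbitrary: x)
  case 0
  then show ?case using nn_integral_coord[of of_bool x] by (simp add: geo_0)
next
  case (Suc a)
  have "(\<integral>\<^sup>+u. of_bool (prev_up u (Suc a) x) \<partial>\<nu>) =
      (\<integral>\<^sup>+u. of_bool (\<not> u x) * of_bool (prev_up u a (x - e1)) \<partial>\<nu>)"
    by (intro nn_integral_cong) auto
  also have "\<dots> = (\<integral>\<^sup>+u. of_bool (\<not> u x) \<partial>\<nu>) * (\<integral>\<^sup>+u. of_bool (prev_up u a (x - e1)) \<partial>\<nu>)"
    by (rule nn_integral_indep[where I = "{x}", OF _ _ depends_on_coord depends_on_comp[OF prev_up_depends]])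
      (auto simp: left_upto_def e1_def)
  also have "\<dots> = geo (Suc a)"
    using nn_integral_coord[of "\<lambda>b. of_bool (\<not> b)" x] by (simp add: Suc geo_Suc)
  finally show ?case .
qed

text \<open>Split according to the next up site. On each piece the indicator and \<open>Z\<close>
  live on disjoint sets of sites, and the mean of \<open>Z\<close> is the same wherever the next up
  site lies.\<close>

lemma nn_integral_at_next_up:
  assumes meas [measurable]: "\<And>y. (\<lambda>u. Z u y) \<in> borel_measurable \<nu>"
    and dep: "\<And>y. depends_on (right_of y) (\<lambda>u. Z u y)"
    and Z: "\<And>y. (\<integral>\<^sup>+u. Z u y \<partial>\<nu>) = z"
  shows "(\<integral>\<^sup>+u. (\<Sum>b. of_bool (next_up u b x) * (w b * Z u (east (Suc b) x))) \<partial>\<nu>) = (\<Sum>b. geo b * w b) * z"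
proof -
  have "(\<integral>\<^sup>+u. of_bool (next_up u b x) * (w b * Z u (east (Suc b) x)) \<partial>\<nu>) = geo b * w b * z" for b
  proof -
    have "(\<integral>\<^sup>+u. of_bool (next_up u b x) * (w b * Z u (east (Suc b) x)) \<partial>\<nu>) =
        w b * (\<integral>\<^sup>+u. of_bool (next_up u b x) * Z u (east (Suc b) x) \<partial>\<nu>)"
      by (subst nn_integral_cmult[symmetric]) (auto simp: mult_ac)
    also have "(\<integral>\<^sup>+u. of_bool (next_up u b x) * Z u (east (Suc b) x) \<partial>\<nu>) =
        (\<integral>\<^sup>+u. of_bool (next_up u b x) \<partial>\<nu>) * (\<integral>\<^sup>+u. Z u (east (Suc b) x) \<partial>\<nu>)"
      by (rule nn_integral_indep[OF _ _ depends_on_comp[OF next_up_depends] dep])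
        (auto simp: segment_def right_of_def east_def)
    finally show ?thesis by (simp add: nn_integral_next_up Z mult_ac)
  qed
  then show ?thesis
    by (subst nn_integral_suminf) (auto simp: ennreal_suminf_multc)
qed

text \<open>Annealed probability of getting from an up site to the next one before leaving the line;
  each application of \<open>hop\<close> contributes this factor in the mean.\<close>

definition \<kappa> :: ennreal where "\<kappa> = (\<Sum>b. geo b * inverse (of_nat (b + 2)))"

lemma nn_integral_hop_funpow:
  assumes meas: "\<And>y. (\<lambda>u. Z u y) \<in> borel_measurable \<nu>"
    and dep: "\<And>y. depends_on (right_of y) (\<lambda>u. Z u y)"
    and Z: "\<And>y. (\<integral>\<^sup>+u. Z u y \<partial>\<nu>) = z"
  shows "(\<integral>\<^sup>+u. (hop u ^^ k) (Z u) x \<partial>\<nu>) = \<kappa> ^ k * z"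
proof (induction k arbitrary: x)
  case 0 then show ?case by (simp add: Z)
next
  case (Suc k)
  have "(\<integral>\<^sup>+u. (hop u ^^ Suc k) (Z u) x \<partial>\<nu>) =
      (\<integral>\<^sup>+u. (\<Sum>b. of_bool (next_up u b x) * (inverse (of_nat (b + 2)) * (hop u ^^ k) (Z u) (east (Suc b) x))) \<partial>\<nu>)"
    by (simp add: hop_def divide_ennreal_def mult_ac)
  also have "\<dots> = \<kappa> * (\<kappa> ^ k * z)"
    by (subst nn_integral_at_next_up[OF measurable_hop_funpow[OF meas] hop_funpow_depends[OF dep] Suc])
      (simp add: \<kappa>_def)
  finally show ?case by (simp add: mult_ac)
qed

lemma nn_integral_up_cost:
  assumes meas: "\<And>s y. (\<lambda>u. C u s y) \<in> borel_measurable \<nu>"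
    and dep: "\<And>s y. depends_on (right_of y) (\<lambda>u. C u s y)"
    and c: "\<And>y. (\<integral>\<^sup>+u. gap_cost (C u) u y \<partial>\<nu>) = c"
  shows "(\<integral>\<^sup>+u. up_cost (C u) u x \<partial>\<nu>) = (\<Sum>k. \<kappa> ^ k) * c"
proof -
  note [measurable] = measurable_hop_funpow[OF measurable_gap_cost[OF meas]]
  show ?thesis
    unfolding up_cost_def
    by (subst nn_integral_suminf)
      (auto simp: nn_integral_hop_funpow[OF measurable_gap_cost[OF meas] gap_cost_depends[OF dep] c]
        ennreal_suminf_multc)
qed

lemma nn_integral_line:
  assumes [measurable]: "\<And>a. (\<lambda>u. Z u a) \<in> borel_measurable \<nu>"
    and dep: "\<And>a. depends_on (right_of x) (\<lambda>u. Z u a)"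
  shows "(\<integral>\<^sup>+u. (\<Sum>a. of_bool (prev_up u a x) * Z u a) \<partial>\<nu>) = (\<Sum>a. geo a * (\<integral>\<^sup>+u. Z u a \<partial>\<nu>))"
proof -
  have "(\<integral>\<^sup>+u. of_bool (prev_up u a x) * Z u a \<partial>\<nu>) = geo a * (\<integral>\<^sup>+u. Z u a \<partial>\<nu>)" for a
    unfolding nn_integral_prev_up[of a x, symmetric]
    by (rule nn_integral_indep[OF _ _ depends_on_comp[OF prev_up_depends] dep])
      (auto simp: left_upto_def right_of_def)
  then show ?thesis by (subst nn_integral_suminf) auto
qed

end

section \<open>The mean exit time\<close>

lemma summable_power_times_geometric:
  fixes r :: real
  assumes "0 \<le> r" "r < 1"
  shows "summable (\<lambda>n. real (n + 1) ^ k * r ^ n)"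
proof (cases "r = 0")
  case True
  then show ?thesis by (intro summable_finite[of "{0}"]) (auto simp: power_0_left)
next
  case False
  have "(\<lambda>n. real (n + 2) / real (n + 1)) \<longlonglongrightarrow> 1"
  proof -
    have "(\<lambda>n. 1 + 1 / real (Suc n)) \<longlonglongrightarrow> 1 + 0"
      by (intro tendsto_add tendsto_const LIMSEQ_Suc[OF lim_1_over_n])
    moreover have "1 + 1 / real (Suc n) = real (n + 2) / real (n + 1)" for n by (simp add: field_simps)
    ultimately show ?thesis by simp
  qed
  then have "(\<lambda>n. (real (n + 2) / real (n + 1)) ^ k * r) \<longlonglongrightarrow> 1 ^ k * r"
    by (intro tendsto_intros)
  moreover obtain c where c: "r < c" "c < 1" using assms(2) dense by blast
  ultimately have "eventually (\<lambda>n. (real (n + 2) / real (n + 1)) ^ k * r < c) sequentially"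
    by (intro order_tendstoD(2)) auto
  then obtain N where N: "\<And>n. n \<ge> N \<Longrightarrow> (real (n + 2) / real (n + 1)) ^ k * r < c"
    by (auto simp: eventually_sequentially)
  show ?thesis
  proof (rule summable_ratio_test[OF c(2)])
    fix n assume "N \<le> n"
    have "real (Suc n + 1) ^ k * r ^ Suc n = ((real (n + 2) / real (n + 1)) ^ k * r) * (real (n + 1) ^ k * r ^ n)"
      by (simp add: power_divide field_simps)
    also have "\<dots> \<le> c * (real (n + 1) ^ k * r ^ n)"
      using N[OF \<open>N \<le> n\<close>] assms(1) by (intro mult_right_mono) auto
    finally show "norm (real (Suc n + 1) ^ k * r ^ Suc n) \<le> c * norm (real (n + 1) ^ k * r ^ n)"
      using assms(1) by simp
  qed
qed

lemma of_nat_mult_inverse_ennreal: "0 < n \<Longrightarrow> of_nat n * inverse (of_nat n) = (1 :: ennreal)"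
  using ennreal_divide_self[of "of_nat n"] of_nat_less_top[of n] by (simp add: divide_ennreal_def)

lemma inverse_of_nat_mono_ennreal:
  assumes "0 < m" "m \<le> n"
  shows "inverse (of_nat n) \<le> (inverse (of_nat m) :: ennreal)"
  using assms by (simp add: ennreal_of_nat_eq_real_of_nat inverse_ennreal le_imp_inverse_le ennreal_leI)

context bernoulli_environment
begin

section \<open>Moments of the geometric distances\<close>

lemma nn_integral_next_up_weight:
  "(\<integral>\<^sup>+u. (\<Sum>b. of_bool (next_up u b x) * w b) \<partial>\<nu>) = (\<Sum>b. geo b * w b)"
  by (subst nn_integral_suminf) (auto simp: nn_integral_multc nn_integral_next_up)

lemma suminf_geo: "(\<Sum>b. geo b) = 1"
proof -
  have "(\<lambda>b. p * (1 - p) ^ b) sums (p * (1 / (1 - (1 - p))))"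
    using p_pos p_less_1 by (intro sums_mult geometric_sums) auto
  then have "(\<Sum>b. ennreal (p * (1 - p) ^ b)) = ennreal (p * (1 / (1 - (1 - p))))"
    using p_pos p_less_1 by (intro suminf_ennreal_eq) auto
  then show ?thesis using p_pos by (simp add: geo_def)
qed

lemma suminf_geo_mean: "(\<Sum>b. geo b * of_nat (b + 1)) = ennreal (1 / p)"
proof -
  have "(\<lambda>b. p * (of_nat (Suc b) * (1 - p) ^ b)) sums (p * (1 / (1 - (1 - p))\<^sup>2))"
    using p_pos p_less_1 by (intro sums_mult geometric_deriv_sums) auto
  then have "(\<Sum>b. ennreal (p * (of_nat (Suc b) * (1 - p) ^ b))) = ennreal (p * (1 / (1 - (1 - p))\<^sup>2))"
    using p_pos p_less_1 by (intro suminf_ennreal_eq) auto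
  moreover have "ennreal (p * (of_nat (Suc b) * (1 - p) ^ b)) = geo b * of_nat (b + 1)" for b
    using p_pos p_less_1
    by (simp add: geo_def ennreal_of_nat_eq_real_of_nat ennreal_mult[symmetric] mult_ac del: of_nat_Suc)
  ultimately show ?thesis using p_pos by (simp add: power2_eq_square)
qed

lemma suminf_geo_power_finite: "(\<Sum>b. geo b * of_nat (b + 1) ^ k) < top"
proof -
  have "summable (\<lambda>b. p * (real (b + 1) ^ k * (1 - p) ^ b))"
    using p_pos p_less_1 by (intro summable_mult summable_power_times_geometric) auto
  then have "(\<Sum>b. ennreal (p * (real (b + 1) ^ k * (1 - p) ^ b))) \<noteq> top"
    using p_pos p_less_1 by (subst suminf_ennreal2) auto
  moreover have "ennreal (p * (real (b + 1) ^ k * (1 - p) ^ b)) = geo b * of_nat (b + 1) ^ k" for b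
    using p_pos p_less_1
    by (simp add: geo_def ennreal_of_nat_eq_real_of_nat ennreal_mult[symmetric] ennreal_power mult_ac del: of_nat_Suc)
  ultimately show ?thesis by (simp add: top.not_eq_extremum)
qed

text \<open>The series of \<open>\<kappa>\<close> is the logarithmic series at \<open>1 - p\<close>
  without its first two terms, divided by \<open>(1 - p)^2\<close> to undo the shift of the
  exponent.\<close>

definition q :: real where "q = - p * (ln p + (1 - p)) / (1 - p)\<^sup>2"

lemma kappa_eq: "\<kappa> = ennreal q"
proof -
  define z where "z = 1 - p"
  have z: "0 < z" "z < 1" using p_pos p_less_1 by (auto simp: z_def)
  have "(\<lambda>n. - ((- (- z)) ^ n) / of_nat n) sums ln (1 + (- z))"
    by (rule ln_series') (use z in auto)
  then have "(\<lambda>n. - (z ^ n) / of_nat n) sums ln p" by (simp add: z_def)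
  then have "(\<lambda>n. - (z ^ (n + 2)) / of_nat (n + 2)) sums (ln p - (\<Sum>i<2. - (z ^ i) / of_nat i))"
    by (rule sums_split_initial_segment)
  then have "(\<lambda>n. (- p / z\<^sup>2) * (- (z ^ (n + 2)) / of_nat (n + 2))) sums
      ((- p / z\<^sup>2) * (ln p - (\<Sum>i<2. - (z ^ i) / of_nat i)))"
    by (rule sums_mult)
  moreover have "(- p / z\<^sup>2) * (- (z ^ (n + 2)) / of_nat (n + 2)) = p * z ^ n / of_nat (n + 2)" for n
  proof -
    have *: "(- p / z\<^sup>2) * (- (z\<^sup>2 * y) / c) = p * y / c" if "c > 0" for y c
      using z that by (simp add: field_simps)
    have "z ^ (n + 2) = z\<^sup>2 * z ^ n" by (simp add: power_add power2_eq_square)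
    then show ?thesis using *[of "of_nat (n + 2)" "z ^ n"] by (simp only:)
  qed
  moreover have "(- p / z\<^sup>2) * (ln p - (\<Sum>i<2. - (z ^ i) / of_nat i)) = q"
  proof -
    \<comment> \<open>The summand for \<open>i = 0\<close> is a division by zero and hence
      zero.\<close>
    have "(\<Sum>i<2. - (z ^ i) / of_nat i) = - z" by (simp add: numeral_2_eq_2)
    then show ?thesis by (simp only: q_def z_def diff_minus_eq_add times_divide_eq_left)
  qed
  ultimately have "(\<lambda>n. p * z ^ n / of_nat (n + 2)) sums q" by (simp del: of_nat_add)
  then have "(\<Sum>n. ennreal (p * z ^ n / of_nat (n + 2))) = ennreal q"
    using p_pos z by (intro suminf_ennreal_eq) auto
  moreover have "geo n * inverse (of_nat (n + 2)) = ennreal (p * z ^ n / of_nat (n + 2))" for n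
    unfolding geo_def z_def[symmetric] ennreal_of_nat_eq_real_of_nat
    using p_pos z by (subst inverse_ennreal) (auto simp: ennreal_mult[symmetric] divide_inverse)
  ultimately show ?thesis by (simp only: \<kappa>_def)
qed

text \<open>From an up site the walk leaves at once with probability one half, so the probability of
  reaching the next up site is at most one half. This makes the geometric series over successive up
  sites converge.\<close>

lemma q_bounds: "0 \<le> q" "q \<le> 1 / 2"
proof -
  have "ln p \<le> p - 1" using p_pos by (intro ln_le_minus_one)
  then have "0 \<le> p * (- (ln p + (1 - p))) / (1 - p)\<^sup>2"
    using p_pos by (intro divide_nonneg_nonneg mult_nonneg_nonneg) auto
  also have "p * (- (ln p + (1 - p))) / (1 - p)\<^sup>2 = q"
    unfolding q_def by (simp only: mult_minus_left mult_minus_right)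
  finally show "0 \<le> q" .
  have "\<kappa> \<le> (\<Sum>b. geo b * inverse 2)"
    unfolding \<kappa>_def
  proof (intro suminf_le mult_left_mono)
    fix b :: nat
    show "inverse (of_nat (b + 2)) \<le> inverse (2 :: ennreal)"
      using inverse_of_nat_mono_ennreal[of 2 "b + 2"] by simp
  qed auto
  also have "\<dots> = ennreal (1 / 2)"
    using inverse_ennreal[of 2] by (simp only: ennreal_suminf_multc suminf_geo) simp
  finally have "ennreal q \<le> ennreal (1 / 2)" by (simp only: kappa_eq)
  then show "q \<le> 1 / 2" by (subst (asm) ennreal_le_iff) auto
qed

lemma one_minus_q: "1 - q = (1 - p + p * ln p) / (1 - p)\<^sup>2"
proof -
  have "1 - q = ((1 - p)\<^sup>2 + p * (ln p + (1 - p))) / (1 - p)\<^sup>2"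
    using p_less_1 by (simp add: q_def add_divide_distrib)
  also have "(1 - p)\<^sup>2 + p * (ln p + (1 - p)) = 1 - p + p * ln p"
    by (simp add: power2_eq_square algebra_simps)
  finally show ?thesis .
qed

lemma suminf_kappa_power: "(\<Sum>k. \<kappa> ^ k) = ennreal (1 / (1 - q))"
proof -
  have "(\<lambda>k. q ^ k) sums (1 / (1 - q))" using q_bounds by (intro geometric_sums) auto
  then have "(\<Sum>k. ennreal (q ^ k)) = ennreal (1 / (1 - q))"
    using q_bounds by (intro suminf_ennreal_eq) auto
  then show ?thesis using q_bounds by (simp add: kappa_eq ennreal_power)
qed

text \<open>Exchanging \<open>a\<close> and \<open>b\<close> and adding turns the fraction into one.\<close>

lemma suminf_geo_balance:
  "(\<Sum>a. geo a * (\<Sum>b. geo b * (of_nat (a + 1) * inverse (of_nat (a + b + 2))))) = ennreal (1 / 2)"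
    (is "?S = _")
proof -
  let ?f = "\<lambda>a b. geo a * (geo b * (of_nat (a + 1) * inverse (of_nat (a + b + 2))))"
  have S: "?S = (\<Sum>a. \<Sum>b. ?f a b)" by simp
  also have "\<dots> = (\<Sum>a. \<Sum>b. ?f b a)" by (rule suminf_swap_ennreal)
  finally have "?S + ?S = (\<Sum>a. \<Sum>b. ?f a b + ?f b a)"
    using S by (simp add: suminf_add[symmetric])
  also have "\<dots> = (\<Sum>a. \<Sum>b. geo a * geo b)"
  proof (intro suminf_cong)
    fix a b
    have "?f a b + ?f b a = geo a * geo b * ((of_nat (a + 1) + of_nat (b + 1)) * inverse (of_nat (a + b + 2)))"
      by (simp add: distrib_left distrib_right mult_ac add_ac del: of_nat_add)
    also have "of_nat (a + 1) + of_nat (b + 1) = (of_nat (a + b + 2) :: ennreal)"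
      unfolding of_nat_add[symmetric] by simp
    also have "\<dots> * inverse (of_nat (a + b + 2)) = 1"
      by (rule of_nat_mult_inverse_ennreal) simp
    finally show "?f a b + ?f b a = geo a * geo b" by (simp only: mult_1_right)
  qed
  also have "\<dots> = 1" by (simp add: suminf_geo)
  finally have "?S * 2 = 1" by (simp add: mult_2_right)
  then have "?S * 2 / 2 = 1 / 2" by simp
  moreover have "?S * 2 / 2 = ?S" by (rule mult_divide_eq_ennreal) auto
  moreover have "1 / 2 = ennreal (1 / 2)" by (metis divide_ennreal ennreal_1 ennreal_numeral zero_le_numeral zero_le_one zero_less_numeral)
  ultimately show ?thesis by simp
qed

lemma suminf_geo_product:
  "(\<Sum>a. geo a * (\<Sum>b. geo b * of_nat ((a + 1) * (b + 1)))) = ennreal (1 / p\<^sup>2)"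
proof -
  have "(\<Sum>a. geo a * (\<Sum>b. geo b * of_nat ((a + 1) * (b + 1)))) =
      (\<Sum>a. geo a * of_nat (a + 1) * (\<Sum>b. geo b * of_nat (b + 1)))"
  proof -
    have "geo b * of_nat ((a + 1) * (b + 1)) = of_nat (a + 1) * (geo b * of_nat (b + 1))" for a b
      by (simp only: of_nat_mult mult_ac)
    then show ?thesis by (simp only: ennreal_suminf_cmult mult.assoc)
  qed
  also have "\<dots> = ennreal (1 / p) * ennreal (1 / p)"
    by (simp only: suminf_geo_mean ennreal_suminf_multc)
  also have "\<dots> = ennreal (1 / p\<^sup>2)" using p_pos by (simp add: ennreal_mult[symmetric] power2_eq_square)
  finally show ?thesis .
qed

section \<open>Averaging the exit time over the environment\<close>

definition mean_exit_time :: real where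
  "mean_exit_time = 1 / p\<^sup>2 + (1 - p)\<^sup>2 / (2 * p * (1 - p + p * ln p))"

lemma mean_exit_time_eq: "mean_exit_time = 1 / p\<^sup>2 + 1 / 2 * (1 / (1 - q) * (1 / p))"
  by (simp add: mean_exit_time_def one_minus_q)

lemma mean_exit_time_pos: "0 < mean_exit_time"
  using p_pos q_bounds by (auto simp: mean_exit_time_eq intro!: add_pos_nonneg)

lemma nn_integral_up_time: "(\<integral>\<^sup>+u. up_cost (\<lambda>_ _. 1) u x \<partial>\<nu>) = ennreal (1 / (1 - q) * (1 / p))"
proof -
  have "(\<integral>\<^sup>+u. gap_cost (\<lambda>_ _. 1) u y \<partial>\<nu>) = ennreal (1 / p)" for y
    by (simp only: gap_cost_def mult_1_left nn_integral_next_up_weight suminf_geo_mean)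
  then have "(\<integral>\<^sup>+u. up_cost (\<lambda>_ _. 1) u x \<partial>\<nu>) = (\<Sum>k. \<kappa> ^ k) * ennreal (1 / p)"
    by (intro nn_integral_up_cost) (auto intro: depends_on_const)
  then show ?thesis using q_bounds p_pos by (simp add: suminf_kappa_power ennreal_mult[symmetric])
qed

lemma measurable_up_time [measurable]: "(\<lambda>u. up_cost (\<lambda>_ _. 1) u x) \<in> borel_measurable \<nu>"
  using measurable_up_cost[of "\<lambda>_ _ _. 1" x] by simp

lemma up_time_depends: "depends_on (right_of x) (\<lambda>u. up_cost (\<lambda>_ _. 1) u x)"
  using up_cost_depends[of "\<lambda>_ _ _. 1" x, OF depends_on_const] .

lemma next_sum_depends:
  assumes "\<And>b. depends_on (right_of (east (Suc b) x)) (\<lambda>u. F u b)"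
  shows "depends_on (right_of x) (\<lambda>u. (\<Sum>b. of_bool (next_up u b x) * F u b) :: ennreal)"
proof (rule depends_onI)
  fix u v :: "site \<Rightarrow> bool" assume uv: "\<And>z. z \<in> right_of x \<Longrightarrow> u z = v z"
  have "next_up u b x = next_up v b x" for b
    by (rule depends_onD[OF next_up_depends]) (use uv segment_subset_right_of in blast)
  moreover have "F u b = F v b" for b
    by (rule depends_onD[OF assms]) (use uv right_of_east in blast)
  ultimately show "(\<Sum>b. of_bool (next_up u b x) * F u b) = (\<Sum>b. of_bool (next_up v b x) * F v b)" by simp
qed

lemma nn_integral_exit_time: "(\<integral>\<^sup>+u. exit_time u x \<partial>\<nu>) = ennreal mean_exit_time"
proof -
  let ?w = "\<lambda>a b. of_nat (a + 1) * inverse (of_nat (a + b + 2)) :: ennreal"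
  define r where "r = 1 / (1 - q) * (1 / p)"
  have "0 \<le> r" using p_pos q_bounds by (simp add: r_def)
  \<comment> \<open>With the left distance \<open>a\<close> as a parameter, what remains depends
    only on sites to the right of \<open>x\<close>, so \<open>nn_integral_line\<close> can detach
    the factor for the previous up site.\<close>
  define Z where "Z u a = (\<Sum>b. of_bool (next_up u b x) *
    (of_nat ((a + 1) * (b + 1)) + ?w a b * up_cost (\<lambda>_ _. 1) u (east (Suc b) x)))" for u a
  have Z_eq: "Z u a = (\<Sum>b. of_bool (next_up u b x) * of_nat ((a + 1) * (b + 1))) +
      (\<Sum>b. of_bool (next_up u b x) * (?w a b * up_cost (\<lambda>_ _. 1) u (east (Suc b) x)))" for u a
    unfolding Z_def by (subst suminf_add) (auto simp: distrib_left)
  have Z: "(\<integral>\<^sup>+u. Z u a \<partial>\<nu>) = (\<Sum>b. geo b * of_nat ((a + 1) * (b + 1))) + (\<Sum>b. geo b * ?w a b) * ennreal r" for a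
    unfolding Z_eq r_def
    by (subst nn_integral_add)
       (simp_all only: nn_integral_next_up_weight
         nn_integral_at_next_up[OF measurable_up_time up_time_depends nn_integral_up_time], auto)
  have "(\<integral>\<^sup>+u. exit_time u x \<partial>\<nu>) = (\<integral>\<^sup>+u. (\<Sum>a. of_bool (prev_up u a x) * Z u a) \<partial>\<nu>)"
    by (simp add: line_cost_def Z_def divide_ennreal_def mult_ac del: of_nat_add of_nat_Suc of_nat_mult)
  also have "\<dots> = (\<Sum>a. geo a * (\<integral>\<^sup>+u. Z u a \<partial>\<nu>))"
    by (rule nn_integral_line)
      (auto simp: Z_def intro!: next_sum_depends depends_on_comp[OF up_time_depends])
  also have "\<dots> = (\<Sum>a. geo a * (\<Sum>b. geo b * of_nat ((a + 1) * (b + 1)))) +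
      (\<Sum>a. geo a * (\<Sum>b. geo b * ?w a b)) * ennreal r"
    unfolding Z by (subst ennreal_suminf_multc[symmetric], subst suminf_add)
      (auto simp only: distrib_left mult.assoc summableI)
  also have "\<dots> = ennreal (1 / p\<^sup>2) + ennreal (1 / 2) * ennreal r"
    by (simp only: suminf_geo_product suminf_geo_balance)
  also have "\<dots> = ennreal mean_exit_time"
    unfolding mean_exit_time_eq r_def[symmetric]
    using \<open>0 \<le> r\<close> by (subst ennreal_mult[symmetric]) (auto intro!: ennreal_plus[symmetric])
  finally show ?thesis .
qed

lemma AE_good_env: "AE u in \<nu>. good_env u"
proof -
  have *: "AE u in \<nu>. \<exists>b. P b u"
    if P: "\<And>b. (\<integral>\<^sup>+u. of_bool (P b u) \<partial>\<nu>) = geo b" and [measurable]: "\<And>b. Measurable.pred \<nu> (P b)"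
      and unique: "\<And>u b b'. P b u \<Longrightarrow> P b' u \<Longrightarrow> b = b'" for P
  proof -
    \<comment> \<open>At most one of the events holds, so the series is the indicator of their union
      and integrates to the total mass of \<open>geo\<close>, which is one.\<close>
    have "(\<Sum>b. of_bool (P b u)) = (indicator {u. \<exists>b. P b u} u :: ennreal)" for u
    proof (cases "\<exists>b. P b u")
      case True
      then obtain b where "P b u" by blast
      then have "P i u \<longleftrightarrow> i = b" for i using unique by blast
      from suminf_single_ennreal[OF this, of "\<lambda>_. 1"] True show ?thesis by simp
    qed simp
    then have "(\<integral>\<^sup>+u. indicator {u. \<exists>b. P b u} u \<partial>\<nu>) = (\<integral>\<^sup>+u. (\<Sum>b. of_bool (P b u)) \<partial>\<nu>)" by simp
    also have "\<dots> = 1" by (subst nn_integral_suminf) (auto simp: P suminf_geo)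
    finally have one: "(\<integral>\<^sup>+u. indicator {u. \<exists>b. P b u} u \<partial>\<nu>) = 1" .
    have "{u \<in> space \<nu>. \<exists>b. P b u} \<in> sets \<nu>" by measurable
    then have "emeasure \<nu> {u \<in> space \<nu>. \<exists>b. P b u} = 1"
      using one by (subst (asm) nn_integral_indicator) auto
    then show ?thesis by (intro env.AE_iff_emeasure_eq_1[THEN iffD2]) auto
  qed
  have "AE u in \<nu>. \<exists>b. next_up u b x" "AE u in \<nu>. \<exists>a. prev_up u a x" for x
    by (rule *; auto simp: nn_integral_next_up nn_integral_prev_up dest: next_up_unique prev_up_unique)+
  then show ?thesis by (simp add: good_env_def AE_all_countable)
qed

end

section \<open>Tails of the exit time\<close>

lemma killed_step_translate:
  "(killed_step (\<lambda>z. u (z + s)) ^^ n) (\<lambda>x. h (x + s)) x = (killed_step u ^^ n) h (x + s)"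
proof (induction n arbitrary: x)
  case (Suc n)
  have "killed_step (\<lambda>z. u (z + s)) f x = killed_step u g (x + s)" if "\<And>y. f y = g (y + s)" for f g
  proof -
    have "x + e + s = (x + s) + e" "x - e + s = (x + s) - e" for e by (simp_all add: algebra_simps)
    then show ?thesis by (simp only: killed_step_def that)
  qed
  then show ?case by (simp only: funpow.simps comp_apply) (use Suc in blast)
qed simp

lemma suminf_finite_imp_tendsto_zero:
  fixes f :: "nat \<Rightarrow> ennreal"
  assumes "(\<Sum>n. f n) < top"
  shows "f \<longlonglongrightarrow> 0"
proof -
  have f: "f n = ennreal (enn2real (f n))" for n
    using sum_le_suminf[of f "{n}"] assms by (auto intro: le_less_trans)
  then have "(\<Sum>n. ennreal (enn2real (f n))) \<noteq> top" using assms by simp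
  then have "summable (\<lambda>n. enn2real (f n))" by (intro summable_suminf_not_top) auto
  then have "(\<lambda>n. ennreal (enn2real (f n))) \<longlonglongrightarrow> ennreal 0"
    by (intro tendsto_ennrealI summable_LIMSEQ_zero)
  then show ?thesis using f by simp
qed

context bernoulli_environment
begin

lemma time_bound_depends: "depends_on (right_of y) (\<lambda>u. time_bound u s y)"
  by (rule depends_on_comp[OF up_time_depends])

lemma nn_integral_line_time_bound_finite: "(\<integral>\<^sup>+u. line_cost (time_bound u) u x \<partial>\<nu>) < top"
proof -
  define g where "g k = (\<Sum>b. geo b * of_nat (b + 1) ^ k)" for k
  have g_fin: "g k < top" for k unfolding g_def by (rule suminf_geo_power_finite)
  define r1 where "r1 = ennreal (1 / (1 - q) * (1 / p))"
  let ?w = "\<lambda>a b. of_nat (a + 1) * inverse (of_nat (a + b + 2)) :: ennreal"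
  let ?s = "\<lambda>a b. of_nat (a + b + 2) ^ 2 * of_nat ((a + 1) * (b + 1)) :: ennreal"
  have s_le: "(\<Sum>b. geo b * ?s a b) \<le> 4 * (of_nat (a + 1) ^ 3 * g 3)" for a
  proof -
    have "?s a b \<le> 4 * of_nat (a + 1) ^ 3 * of_nat (b + 1) ^ 3" for b
    proof -
      \<comment> \<open>This decouples \<open>a\<close> and \<open>b\<close>: the square of the gap
        length times the parabola becomes a product of third powers, and geometric variables have
        all moments.\<close>
      have "a + b + 2 \<le> 2 * ((a + 1) * (b + 1))" by simp
      then have "(a + b + 2)\<^sup>2 \<le> (2 * ((a + 1) * (b + 1)))\<^sup>2" by (rule power_mono) simp
      then have "(a + b + 2)\<^sup>2 * ((a + 1) * (b + 1)) \<le> (2 * ((a + 1) * (b + 1)))\<^sup>2 * ((a + 1) * (b + 1))"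
        by (rule mult_right_mono) simp
      also have "\<dots> = 4 * (a + 1) ^ 3 * (b + 1) ^ 3"
        by (simp only: power_mult_distrib power2_eq_square power3_eq_cube mult_ac)
      finally have "of_nat ((a + b + 2)\<^sup>2 * ((a + 1) * (b + 1))) \<le> (of_nat (4 * (a + 1) ^ 3 * (b + 1) ^ 3) :: ennreal)"
        by (rule of_nat_mono)
      then show ?thesis by (simp only: of_nat_mult of_nat_power of_nat_numeral)
    qed
    then have "(\<Sum>b. geo b * ?s a b) \<le> (\<Sum>b. 4 * of_nat (a + 1) ^ 3 * (geo b * of_nat (b + 1) ^ 3))"
      by (intro suminf_le) (auto simp: mult_left_mono mult.left_commute simp del: of_nat_add of_nat_Suc of_nat_mult)
    then show ?thesis by (simp only: ennreal_suminf_cmult g_def mult.assoc)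
  qed
  \<comment> \<open>The gap cost belongs to a walk at the left up site, that is to left index
    \<open>0\<close>. The second part is the mean of \<open>b + 1\<close> times the mean
    \<open>r1\<close> of the independent cost at the next up site.\<close>
  define c2 where "c2 = (\<Sum>b. geo b * ?s 0 b) + g 1 * r1"
  have "c2 < top"
    using s_le[of 0] g_fin[of 3] g_fin[of 1]
    by (auto simp: c2_def r1_def ennreal_mult_less_top intro: le_less_trans)
  have gap: "(\<integral>\<^sup>+u. gap_cost (time_bound u) u y \<partial>\<nu>) = c2" for y
  proof -
    have "gap_cost (time_bound u) u y = (\<Sum>b. of_bool (next_up u b y) * ?s 0 b) +
        (\<Sum>b. of_bool (next_up u b y) * (of_nat (b + 1) * up_cost (\<lambda>_ _. 1) u (east (Suc b) y)))" for u
      unfolding gap_cost_def by (subst suminf_add) (auto simp: distrib_left distrib_right mult_ac)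
    then show ?thesis
      unfolding c2_def g_def r1_def
      by (simp only:) (subst nn_integral_add, simp_all only: nn_integral_next_up_weight power_one_right
         nn_integral_at_next_up[OF measurable_up_time up_time_depends nn_integral_up_time], auto)
  qed
  define r2 where "r2 = ennreal (1 / (1 - q)) * c2"
  have "r2 < top" using \<open>c2 < top\<close> by (simp add: r2_def ennreal_mult_less_top)
  have meas: "(\<lambda>u. time_bound u s y) \<in> borel_measurable \<nu>" for s y by measurable
  have up2: "(\<integral>\<^sup>+u. up_cost (time_bound u) u y \<partial>\<nu>) = r2" for y
    unfolding r2_def suminf_kappa_power[symmetric]
    by (rule nn_integral_up_cost[OF meas time_bound_depends gap])
  note meas_up2 = measurable_up_cost[of time_bound, OF meas]
  note dep_up2 = up_cost_depends[of time_bound, OF time_bound_depends]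
  note [measurable] = meas_up2
  define Z where "Z u a = (\<Sum>b. of_bool (next_up u b x) * (?s a b +
      (of_nat ((a + 1) * (b + 1)) * up_cost (\<lambda>_ _. 1) u (east (Suc b) x) +
       ?w a b * up_cost (time_bound u) u (east (Suc b) x))))" for u a
  have Z_eq: "Z u a = (\<Sum>b. of_bool (next_up u b x) * ?s a b) +
      ((\<Sum>b. of_bool (next_up u b x) * (of_nat ((a + 1) * (b + 1)) * up_cost (\<lambda>_ _. 1) u (east (Suc b) x))) +
      (\<Sum>b. of_bool (next_up u b x) * (?w a b * up_cost (time_bound u) u (east (Suc b) x))))" for u a
    unfolding Z_def by (simp only: distrib_left) (subst suminf_add[symmetric]; simp)+
  have Z: "(\<integral>\<^sup>+u. Z u a \<partial>\<nu>) = (\<Sum>b. geo b * ?s a b) +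
      ((\<Sum>b. geo b * of_nat ((a + 1) * (b + 1))) * r1 + (\<Sum>b. geo b * ?w a b) * r2)" for a
    unfolding Z_eq r1_def
    by (subst nn_integral_add, measurable, subst nn_integral_add, measurable)
       (simp only: nn_integral_next_up_weight
         nn_integral_at_next_up[OF measurable_up_time up_time_depends nn_integral_up_time]
         nn_integral_at_next_up[of "\<lambda>u. up_cost (time_bound u) u", OF meas_up2 dep_up2 up2])
  \<comment> \<open>Each of the three parts of the mean of \<open>Z\<close> is at most
    \<open>(a + 1) ^ 3\<close> times a constant; \<open>m\<close> adds these constants.\<close>
  define m where "m = 4 * g 3 + g 1 * r1 + r2"
  have "m < top"
    using g_fin \<open>r2 < top\<close> by (auto simp: m_def r1_def ennreal_mult_less_top)
  have Z_le: "(\<integral>\<^sup>+u. Z u a \<partial>\<nu>) \<le> of_nat (a + 1) ^ 3 * m" for a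
  proof -
    have a1: "of_nat (a + 1) \<le> (of_nat (a + 1) ^ 3 :: ennreal)"
    proof -
      have "(a + 1) ^ 1 \<le> (a + 1) ^ 3" by (rule power_increasing) auto
      from of_nat_mono[OF this, where 'a = ennreal] show ?thesis by (simp only: of_nat_power power_one_right)
    qed
    have "(\<Sum>b. geo b * of_nat ((a + 1) * (b + 1))) = of_nat (a + 1) * g 1"
      unfolding g_def ennreal_suminf_cmult[symmetric] by (simp only: of_nat_mult mult_ac power_one_right)
    also have "\<dots> \<le> of_nat (a + 1) ^ 3 * g 1" using a1 by (rule mult_right_mono) simp
    finally have 2: "(\<Sum>b. geo b * of_nat ((a + 1) * (b + 1))) \<le> of_nat (a + 1) ^ 3 * g 1" .
    have "(\<Sum>b. geo b * ?w a b) \<le> (\<Sum>b. geo b * of_nat (a + 1))"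
    proof (intro suminf_le mult_left_mono)
      fix b
      have "inverse (of_nat (a + b + 2)) \<le> inverse (1 :: ennreal)"
        using inverse_of_nat_mono_ennreal[of 1 "a + b + 2"] by simp
      then have "?w a b \<le> of_nat (a + 1) * inverse 1" by (rule mult_left_mono) simp
      then show "?w a b \<le> of_nat (a + 1)" by simp
    qed auto
    also have "\<dots> = of_nat (a + 1)" by (simp only: ennreal_suminf_multc suminf_geo mult_1_left)
    also have "\<dots> \<le> of_nat (a + 1) ^ 3" by (rule a1)
    finally have 3: "(\<Sum>b. geo b * ?w a b) \<le> of_nat (a + 1) ^ 3" .
    have "(\<integral>\<^sup>+u. Z u a \<partial>\<nu>) \<le> 4 * (of_nat (a + 1) ^ 3 * g 3) + (of_nat (a + 1) ^ 3 * g 1 * r1 + of_nat (a + 1) ^ 3 * r2)"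
      unfolding Z by (intro add_mono mult_right_mono s_le 2 3) auto
    also have "\<dots> = of_nat (a + 1) ^ 3 * m"
      by (simp only: m_def distrib_left mult_ac add_ac)
    finally show ?thesis .
  qed
  have "(\<integral>\<^sup>+u. line_cost (time_bound u) u x \<partial>\<nu>) = (\<integral>\<^sup>+u. (\<Sum>a. of_bool (prev_up u a x) * Z u a) \<partial>\<nu>)"
    by (simp only: line_cost_def Z_def divide_ennreal_def mult_ac distrib_left add_ac)
  also have "\<dots> = (\<Sum>a. geo a * (\<integral>\<^sup>+u. Z u a \<partial>\<nu>))"
  proof (rule nn_integral_line)
    show "(\<lambda>u. Z u a) \<in> borel_measurable \<nu>" for a unfolding Z_def by measurable
    show "depends_on (right_of x) (\<lambda>u. Z u a)" for a
      unfolding Z_def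
      by (intro next_sum_depends depends_on_comp2[OF up_time_depends dep_up2])
  qed
  also have "\<dots> \<le> (\<Sum>a. geo a * (of_nat (a + 1) ^ 3 * m))"
    by (intro suminf_le mult_left_mono Z_le) auto
  also have "\<dots> = g 3 * m"
    by (simp only: mult.assoc[symmetric] ennreal_suminf_multc g_def)
  also have "\<dots> < top" using g_fin \<open>m < top\<close> by (simp add: ennreal_mult_less_top)
  finally show ?thesis .
qed

section \<open>Annealed tails and densities of the exit time\<close>

lemma measurable_killed_step:
  assumes [measurable]: "\<And>y. (\<lambda>u. h u y) \<in> borel_measurable \<nu>"
  shows "(\<lambda>u. killed_step u (h u) x) \<in> borel_measurable \<nu>"
  unfolding killed_step_def by measurable

lemma measurable_killed_step_funpow:
  assumes "\<And>y. (\<lambda>u. h u y) \<in> borel_measurable \<nu>"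
  shows "(\<lambda>u. (killed_step u ^^ n) (h u) x) \<in> borel_measurable \<nu>"
proof (induction n arbitrary: x)
  case (Suc n)
  from measurable_killed_step[OF this] show ?case by simp
qed (simp add: assms)

lemma measurable_survival [measurable]: "(\<lambda>u. survival u n x) \<in> borel_measurable \<nu>"
  by (rule measurable_killed_step_funpow) simp

lemma measurable_exit_prob [measurable]: "(\<lambda>u. exit_prob u n x) \<in> borel_measurable \<nu>"
  by (rule measurable_killed_step_funpow) measurable

definition tail :: "nat \<Rightarrow> ennreal" where "tail n = (\<integral>\<^sup>+u. survival u n 0 \<partial>\<nu>)"

text \<open>Annealed probability that the starting line is left exactly at step
  \<open>n + 1\<close>. The choice of the origin is immaterial by shift invariance, see
  \<open>nn_integral_exit_prob\<close>.\<close>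

definition exit_density :: "nat \<Rightarrow> ennreal" where "exit_density n = (\<integral>\<^sup>+u. exit_prob u n 0 \<partial>\<nu>)"

lemma nn_integral_exit_prob: "(\<integral>\<^sup>+u. exit_prob u n x \<partial>\<nu>) = exit_density n"
proof -
  have "(\<integral>\<^sup>+u. exit_prob u n 0 \<partial>\<nu>) = (\<integral>\<^sup>+u. exit_prob (\<lambda>z. u (z + x)) n 0 \<partial>\<nu>)"
    by (rule nn_integral_shift[symmetric]) measurable
  also have "\<dots> = (\<integral>\<^sup>+u. exit_prob u n x \<partial>\<nu>)"
  proof (rule nn_integral_cong)
    show "exit_prob (\<lambda>z. u (z + x)) n 0 = exit_prob u n x" for u
      using killed_step_translate[where u = u and s = x and n = n and h = "\<lambda>y. of_bool (u y) / 2" and x = 0] by simp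
  qed
  finally show ?thesis by (simp add: exit_density_def)
qed

lemma tail_0: "tail 0 = 1"
  using env.emeasure_space_1 by (simp add: tail_def)

lemma tail_eq: "tail n = tail (Suc n) + exit_density n"
  unfolding tail_def exit_density_def by (subst survival_eq, subst nn_integral_add) measurable

text \<open>Here \<open>m n\<close> is the mean remainder of the telescoped Poisson equation. The
  first two facts compare it with the tails before and after time \<open>n\<close>, and the third
  bounds the sum of all remainders by the supersolution.\<close>

lemma mean_killed_exit_time:
  defines "m n \<equiv> (\<integral>\<^sup>+u. (killed_step u ^^ n) (exit_time u) 0 \<partial>\<nu>)"
  shows "(\<Sum>j<n. tail j) + m n = ennreal mean_exit_time" "(\<Sum>j<k. tail (n + j)) \<le> m n"
    "(\<Sum>j<n. m j) \<le> (\<integral>\<^sup>+u. line_cost (time_bound u) u 0 \<partial>\<nu>)"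
proof -
  have "(\<lambda>u. exit_time u y) \<in> borel_measurable \<nu>" for y
    using measurable_line_cost[of "\<lambda>_ _ _. 1"] by simp
  note [measurable] = measurable_killed_step_funpow[of exit_time, OF this]
  have "ennreal mean_exit_time = (\<integral>\<^sup>+u. (\<Sum>j<n. survival u j 0) + (killed_step u ^^ n) (exit_time u) 0 \<partial>\<nu>)"
    unfolding nn_integral_exit_time[of 0, symmetric]
    by (rule nn_integral_cong_AE, rule AE_mp[OF AE_good_env], rule AE_I2)
      (auto intro!: poisson_telescope exit_time_poisson)
  also have "\<dots> = (\<Sum>j<n. tail j) + m n"
    unfolding m_def tail_def by (subst nn_integral_add) (auto simp: nn_integral_sum)
  finally show "(\<Sum>j<n. tail j) + m n = ennreal mean_exit_time" ..
  have "(\<Sum>j<k. tail (n + j)) = (\<integral>\<^sup>+u. (\<Sum>j<k. survival u (n + j) 0) \<partial>\<nu>)"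
    unfolding tail_def by (subst nn_integral_sum) auto
  also have "\<dots> \<le> m n"
    unfolding m_def
    by (rule nn_integral_mono_AE, rule AE_mp[OF AE_good_env], rule AE_I2)
      (auto intro!: killed_step_funpow_ge_survival exit_time_poisson)
  finally show "(\<Sum>j<k. tail (n + j)) \<le> m n" .
  have "(\<Sum>j<n. m j) = (\<integral>\<^sup>+u. (\<Sum>j<n. (killed_step u ^^ j) (exit_time u) 0) \<partial>\<nu>)"
    unfolding m_def by (subst nn_integral_sum) auto
  also have "\<dots> \<le> (\<integral>\<^sup>+u. line_cost (time_bound u) u 0 \<partial>\<nu>)"
  proof (rule nn_integral_mono_AE, rule AE_mp[OF AE_good_env], rule AE_I2, rule impI)
    fix u assume "good_env u"
    then show "(\<Sum>j<n. (killed_step u ^^ j) (exit_time u) 0) \<le> line_cost (time_bound u) u 0"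
      using supersolution_telescope[where h = "exit_time u" and u = u and V = "line_cost (time_bound u) u" and n = n and x = 0]
        time_bound_supersolution[of u] order_trans[OF add_increasing2[OF zero_le order_refl]] by blast
  qed
  finally show "(\<Sum>j<n. m j) \<le> (\<integral>\<^sup>+u. line_cost (time_bound u) u 0 \<partial>\<nu>)" .
qed

text \<open>The supersolution has finite mean, so the remainders are summable and tend to zero. This
  removes the remainder from the telescoped equation, and since remainders dominate tail sums, the
  double series converges as well.\<close>

lemma suminf_tail: "(\<Sum>n. tail n) = ennreal mean_exit_time"
  and suminf_tail_tail: "(\<Sum>n. \<Sum>j. tail (n + j)) < top"
proof -
  define m where "m n = (\<integral>\<^sup>+u. (killed_step u ^^ n) (exit_time u) 0 \<partial>\<nu>)" for n
  note m = mean_killed_exit_time[folded m_def]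
  have "(\<Sum>n. m n) \<le> (\<integral>\<^sup>+u. line_cost (time_bound u) u 0 \<partial>\<nu>)"
    using m(3) by (intro suminf_le_const) auto
  then have fin: "(\<Sum>n. m n) < top" using nn_integral_line_time_bound_finite le_less_trans by blast
  have "(\<Sum>j. tail (n + j)) \<le> m n" for n
    using m(2) by (intro suminf_le_const) auto
  then show "(\<Sum>n. \<Sum>j. tail (n + j)) < top"
    using fin by (meson suminf_le le_less_trans summableI)
  have "m \<longlonglongrightarrow> 0" using fin by (rule suminf_finite_imp_tendsto_zero)
  moreover have "(\<lambda>n. \<Sum>j<n. tail j) \<longlonglongrightarrow> (\<Sum>n. tail n)" by (rule summable_LIMSEQ) simp
  ultimately have "(\<lambda>n. (\<Sum>j<n. tail j) + m n) \<longlonglongrightarrow> (\<Sum>n. tail n) + 0" by (intro tendsto_add)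
  then show "(\<Sum>n. tail n) = ennreal mean_exit_time"
    unfolding m(1) by (simp add: LIMSEQ_const_iff)
qed

end

section \<open>The height of the walk\<close>

definition env_sets :: "(site \<Rightarrow> bool) \<Rightarrow> site \<Rightarrow> site set" where
  "env_sets u x = (if u x then {e1, e2} else {e1, - e1})"

lemma site_vectors_distinct: "e1 \<noteq> e2" "e1 \<noteq> - e1" "e2 \<noteq> - e1"
  by (simp_all add: e1_def e2_def)

lemma nn_integral_uniform_step:
  "(\<integral>\<^sup>+y. f y \<partial>uniform_step (env_sets u) x) = (f (x + e1) + (if u x then f (x + e2) else f (x - e1))) / 2"
proof -
  have "(\<integral>\<^sup>+y. f y \<partial>uniform_step (env_sets u) x) = (\<Sum>e\<in>env_sets u x. f (x + e)) / of_nat (card (env_sets u x))"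
    unfolding uniform_step_def by (simp add: env_sets_def nn_integral_pmf_of_set)
  then show ?thesis using site_vectors_distinct by (simp add: env_sets_def)
qed

lemma nn_integral_walk_pmf_Suc:
  "(\<integral>\<^sup>+y. f y \<partial>walk_pmf (env_sets u) (Suc n) x) =
    ((\<integral>\<^sup>+y. f y \<partial>walk_pmf (env_sets u) n (x + e1)) +
     (if u x then (\<integral>\<^sup>+y. f y \<partial>walk_pmf (env_sets u) n (x + e2))
      else (\<integral>\<^sup>+y. f y \<partial>walk_pmf (env_sets u) n (x - e1)))) / 2"
  by (simp only: walk_pmf.simps nn_integral_bind_pmf nn_integral_uniform_step)

text \<open>Both step sets pair \<open>e1\<close>, which raises the difference by one, with an
  equally likely step that lowers it by one. The square of the difference therefore grows by one per
  step in the mean.\<close>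

lemma nn_integral_walk_pmf_diagonal:
  "(\<integral>\<^sup>+y. ennreal (real_of_int ((fst y - snd y)\<^sup>2)) \<partial>walk_pmf (env_sets u) n x) =
    ennreal (real_of_int ((fst x - snd x)\<^sup>2) + real n)"
proof (induction n arbitrary: x)
  case (Suc n)
  define d where "d = real_of_int (fst x - snd x)"
  have east: "real_of_int ((fst (x + e1) - snd (x + e1))\<^sup>2) = (d + 1)\<^sup>2"
    by (simp add: d_def e1_def algebra_simps)
  have other: "real_of_int ((fst (x + e2) - snd (x + e2))\<^sup>2) = (d - 1)\<^sup>2"
      "real_of_int ((fst (x - e1) - snd (x - e1))\<^sup>2) = (d - 1)\<^sup>2"
    by (simp_all add: d_def e1_def e2_def algebra_simps)
  have "(\<integral>\<^sup>+y. ennreal (real_of_int ((fst y - snd y)\<^sup>2)) \<partial>walk_pmf (env_sets u) (Suc n) x) =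
      (ennreal ((d + 1)\<^sup>2 + real n) + ennreal ((d - 1)\<^sup>2 + real n)) / 2"
    unfolding nn_integral_walk_pmf_Suc Suc east other by simp
  also have "\<dots> = ennreal (((d + 1)\<^sup>2 + real n) + ((d - 1)\<^sup>2 + real n)) / ennreal 2"
    by (simp add: ennreal_plus[symmetric] del: ennreal_plus)
  also have "\<dots> = ennreal ((((d + 1)\<^sup>2 + real n) + ((d - 1)\<^sup>2 + real n)) / 2)"
    by (rule divide_ennreal) auto
  also have "(((d + 1)\<^sup>2 + real n) + ((d - 1)\<^sup>2 + real n)) / 2 = d\<^sup>2 + real (Suc n)"
    by (simp add: power2_eq_square algebra_simps)
  finally show ?case by (simp add: d_def)
qed (simp)

text \<open>First-step recursion for the quenched probability that \<open>n\<close> steps gain at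
  least \<open>k\<close> levels; the value \<open>1\<close> for \<open>k = 0\<close> reflects that
  the height never decreases.\<close>

fun reach :: "(site \<Rightarrow> bool) \<Rightarrow> nat \<Rightarrow> nat \<Rightarrow> site \<Rightarrow> ennreal" where
  "reach u 0 n x = 1"
| "reach u (Suc k) 0 x = 0"
| "reach u (Suc k) (Suc n) x =
    (reach u (Suc k) n (x + e1) + (if u x then reach u k n (x + e2) else reach u (Suc k) n (x - e1))) / 2"

lemma walk_pmf_height_mono: "y \<in> set_pmf (walk_pmf (env_sets u) n x) \<Longrightarrow> snd x \<le> snd y"
proof (induction n arbitrary: x)
  case (Suc n)
  have "finite (env_sets u x)" "env_sets u x \<noteq> {}" by (simp_all add: env_sets_def)
  then obtain e where "e \<in> env_sets u x" "y \<in> set_pmf (walk_pmf (env_sets u) n (x + e))"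
    using Suc.prems by (auto simp: uniform_step_def)
  moreover from this(1) have "snd x \<le> snd (x + e)" by (auto simp: env_sets_def e1_def e2_def split: if_splits)
  ultimately show ?case using Suc.IH order_trans by blast
qed simp

lemma emeasure_walk_pmf_height:
  "emeasure (walk_pmf (env_sets u) n x) {y. snd x + int k \<le> snd y} = reach u k n x"
proof (induction u k n x rule: reach.induct)
  case (1 u n x)
  have "AE y in walk_pmf (env_sets u) n x. snd x \<le> snd y"
    by (rule AE_pmfI) (rule walk_pmf_height_mono)
  then show ?case by (simp add: measure_pmf.emeasure_eq_1_AE)
next
  case (2 u k x)
  then show ?case by simp
next
  case (3 u k n x)
  have heights: "snd (x + e1) = snd x" "snd (x - e1) = snd x" "snd (x + e2) + int k = snd x + int (Suc k)"
    by (simp_all add: e1_def e2_def)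
  have "emeasure (walk_pmf (env_sets u) (Suc n) x) A = (emeasure (walk_pmf (env_sets u) n (x + e1)) A +
      (if u x then emeasure (walk_pmf (env_sets u) n (x + e2)) A
       else emeasure (walk_pmf (env_sets u) n (x - e1)) A)) / 2" for A
    using nn_integral_walk_pmf_Suc[where f = "indicator A" and u = u and n = n and x = x] by simp
  then show ?case
    using 3 by (simp only: reach.simps heights) (simp split: if_splits)
qed

lemma killed_step_sum:
  "killed_step u (\<lambda>x. \<Sum>a\<in>A. f a x) x = (\<Sum>a\<in>A. killed_step u (f a) x)"
  by (simp add: killed_step_def divide_ennreal_def sum_distrib_right[symmetric] sum.distrib)

text \<open>Decomposition at the first upward jump: \<open>a\<close> steps on the line that end at
  an up site \<open>z\<close>, the jump with probability one half, and the remaining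
  \<open>n - Suc a\<close> steps from \<open>z + e2\<close>.\<close>

lemma reach_Suc_eq:
  "reach u (Suc k) n x =
    (\<Sum>a<n. (killed_step u ^^ a) (\<lambda>z. of_bool (u z) / 2 * reach u k (n - Suc a) (z + e2)) x)"
proof (induction n arbitrary: x)
  case (Suc n)
  let ?h = "\<lambda>m z. of_bool (u z) / 2 * reach u k m (z + e2)"
  have "reach u (Suc k) (Suc n) x = ?h n x + killed_step u (reach u (Suc k) n) x"
    by (simp add: killed_step_def add_divide_distrib_ennreal divide_ennreal_def distrib_left distrib_right mult.commute add.commute)
  also have "killed_step u (reach u (Suc k) n) x =
      killed_step u (\<lambda>x. \<Sum>a<n. (killed_step u ^^ a) (?h (n - Suc a)) x) x"
    using arg_cong[OF ext[OF Suc], of "\<lambda>h. killed_step u h x"] .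
  also have "\<dots> = (\<Sum>a<n. (killed_step u ^^ Suc a) (?h (n - Suc a)) x)"
    by (simp add: killed_step_sum)
  finally show ?case
    by (simp only: sum.lessThan_Suc_shift diff_Suc_Suc minus_nat.diff_0 funpow_0)
qed simp

lemma reach_depends: "depends_on {z. snd x \<le> snd z} (\<lambda>u. reach u k n x)"
proof (rule depends_onI)
  fix u v :: "site \<Rightarrow> bool" assume uv: "\<And>z. z \<in> {z. snd x \<le> snd z} \<Longrightarrow> u z = v z"
  \<comment> \<open>A fixed row \<open>r\<close> keeps the region of agreement unchanged during the
    induction while the row of \<open>x\<close> rises.\<close>
  define r where "r = snd x"
  then have "r \<le> snd x" "\<And>z. r \<le> snd z \<Longrightarrow> u z = v z" using uv by auto
  then show "reach u k n x = reach v k n x"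
  proof (induction u k n x rule: reach.induct)
    case (3 u k n x)
    have "r \<le> snd (x + e1)" "r \<le> snd (x + e2)" "r \<le> snd (x - e1)" using 3 by (auto simp: e1_def e2_def)
    with 3 show ?case by auto
  qed auto
qed

context bernoulli_environment
begin

section \<open>Independence of successive rows\<close>

lemma measurable_reach [measurable]: "(\<lambda>u. reach u k n x) \<in> borel_measurable \<nu>"
proof -
  have "\<forall>k x. (\<lambda>u. reach u k n x) \<in> borel_measurable \<nu>"
  proof (induction n)
    case 0
    have "(\<lambda>u. reach u k 0 x) \<in> borel_measurable \<nu>" for k x by (cases k) simp_all
    then show ?case by blast
  next
    case (Suc n)
    then have [measurable]: "(\<lambda>u. reach u k n x) \<in> borel_measurable \<nu>" for k x by blast
    have "(\<lambda>u. reach u k (Suc n) x) \<in> borel_measurable \<nu>" for k x by (cases k) simp_all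
    then show ?case by blast
  qed
  then show ?thesis by blast
qed

text \<open>The factor \<open>\<eta>\<close> strengthens the induction: it collects the killing indicators of the steps made.\<close>

lemma nn_integral_exit_then:
  assumes meas [measurable]: "\<And>z. (\<lambda>u. \<psi> u z) \<in> borel_measurable \<nu>"
    and dep: "\<And>z. depends_on {w. snd z < snd w} (\<lambda>u. \<psi> u z)"
    and c: "\<And>z. (\<integral>\<^sup>+u. \<psi> u z \<partial>\<nu>) = c"
    and \<eta>: "\<eta> \<in> borel_measurable \<nu>" "depends_on {w. snd w = snd x} \<eta>"
  shows "(\<integral>\<^sup>+u. \<eta> u * (killed_step u ^^ a) (\<lambda>z. of_bool (u z) / 2 * \<psi> u z) x \<partial>\<nu>) =
    (\<integral>\<^sup>+u. \<eta> u * exit_prob u a x \<partial>\<nu>) * c"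
  using \<eta>
proof (induction a arbitrary: x \<eta>)
  case 0
  note [measurable] = 0(1)
  have "(\<integral>\<^sup>+u. (\<eta> u * (of_bool (u x) / 2)) * \<psi> u x \<partial>\<nu>) =
      (\<integral>\<^sup>+u. \<eta> u * (of_bool (u x) / 2) \<partial>\<nu>) * (\<integral>\<^sup>+u. \<psi> u x \<partial>\<nu>)"
    by (rule nn_integral_indep[OF _ _ depends_on_comp2[OF 0(2) depends_on_coord[of x]] dep[of x]]) auto
  then show ?case by (simp add: c mult.assoc)
next
  case (Suc a)
  note [measurable] = Suc.prems(1)
  let ?h = "\<lambda>u z. of_bool (u z) / 2 * \<psi> u z"
  have split: "\<eta> u * (killed_step u ^^ Suc a) h x =
      (\<eta> u / 2) * (killed_step u ^^ a) h (x + e1) +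
      (\<eta> u * (of_bool (\<not> u x) / 2)) * (killed_step u ^^ a) h (x - e1)" for u h
    by (auto simp: killed_step_def[of u "(killed_step u ^^ a) h"] divide_ennreal_def distrib_left distrib_right mult_ac)
  have [measurable]: "(\<lambda>u. (killed_step u ^^ a) (?h u) y) \<in> borel_measurable \<nu>" for y
    by (rule measurable_killed_step_funpow) measurable
  have rows: "snd (x + e1) = snd x" "snd (x - e1) = snd x" by (simp_all add: e1_def)
  have dep1: "depends_on {w. snd w = snd (x + e1)} (\<lambda>u. \<eta> u / 2)"
    unfolding rows by (rule depends_on_comp[OF Suc.prems(2)])
  have dep2: "depends_on {w. snd w = snd (x - e1)} (\<lambda>u. \<eta> u * (of_bool (\<not> u x) / 2))"
    unfolding rows by (rule depends_on_comp2[OF Suc.prems(2) depends_on_coord]) simp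
  have IH1: "(\<integral>\<^sup>+u. (\<eta> u / 2) * (killed_step u ^^ a) (?h u) (x + e1) \<partial>\<nu>) =
      (\<integral>\<^sup>+u. (\<eta> u / 2) * exit_prob u a (x + e1) \<partial>\<nu>) * c"
    by (rule Suc.IH[OF _ dep1]) measurable
  have IH2: "(\<integral>\<^sup>+u. (\<eta> u * (of_bool (\<not> u x) / 2)) * (killed_step u ^^ a) (?h u) (x - e1) \<partial>\<nu>) =
      (\<integral>\<^sup>+u. (\<eta> u * (of_bool (\<not> u x) / 2)) * exit_prob u a (x - e1) \<partial>\<nu>) * c"
    by (rule Suc.IH[OF _ dep2]) measurable
  show ?case
    unfolding split by (subst (1 2) nn_integral_add) (simp_all only: IH1 IH2 distrib_right, measurable)
qed

text \<open>The recursion for distribution functions of sums of \<open>k\<close> independent exit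
  times, matched with such a sum in \<open>emeasure_hitting_time\<close>.\<close>

fun mean_reach :: "nat \<Rightarrow> nat \<Rightarrow> ennreal" where
  "mean_reach 0 n = 1"
| "mean_reach (Suc k) n = (\<Sum>a<n. exit_density a * mean_reach k (n - Suc a))"

text \<open>After the jump only strictly higher rows matter, which are independent of the row just
  left. The mean from the landing site does not depend on that site, so the unknown exit position
  drops out of the convolution.\<close>

lemma nn_integral_reach: "(\<integral>\<^sup>+u. reach u k n x \<partial>\<nu>) = mean_reach k n"
proof (induction k arbitrary: n x)
  case 0
  then show ?case using env.emeasure_space_1 by simp
next
  case (Suc k)
  have dep: "depends_on {w. snd z < snd w} (\<lambda>u. reach u k m (z + e2))" for z m
    by (rule depends_on_mono[OF reach_depends]) (auto simp: e2_def)
  have meas: "(\<lambda>u. (killed_step u ^^ a) (\<lambda>z. of_bool (u z) / 2 * reach u k m (z + e2)) x) \<in> borel_measurable \<nu>"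
    for a m by (rule measurable_killed_step_funpow) measurable
  have "(\<integral>\<^sup>+u. (killed_step u ^^ a) (\<lambda>z. of_bool (u z) / 2 * reach u k m (z + e2)) x \<partial>\<nu>) =
      exit_density a * mean_reach k m" for a m
    using nn_integral_exit_then[of "\<lambda>u z. reach u k m (z + e2)" "mean_reach k m" "\<lambda>_. 1" x a,
        OF _ dep Suc _ depends_on_const]
    by (simp add: nn_integral_exit_prob)
  then show ?case
    unfolding reach_Suc_eq by (simp add: nn_integral_sum meas)
qed

end

section \<open>Hitting times of the levels\<close>

text \<open>Summation by parts through Tonelli. Applied to the density with \<open>w = 1\<close> it
  gives the mean as a sum of tails; a second application, to the tails, yields the second
  moment.\<close>

lemma suminf_weighted_tail:
  fixes f w :: "nat \<Rightarrow> ennreal"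
  shows "(\<Sum>n. w n * (\<Sum>j. f (n + j))) = (\<Sum>k. (\<Sum>n\<le>k. w n) * f k)"
proof -
  have tail: "(\<Sum>j. f (n + j)) = (\<Sum>k. if n \<le> k then f k else 0)" for n
  proof -
    have "(\<Sum>i<n. if n \<le> i then f i else 0) = 0" by (intro sum.neutral) auto
    then show ?thesis
      using suminf_offset[of "\<lambda>k. if n \<le> k then f k else 0" n] by (simp add: add.commute)
  qed
  have "(\<Sum>n. w n * (\<Sum>j. f (n + j))) = (\<Sum>n. \<Sum>k. w n * (if n \<le> k then f k else 0))"
    by (simp only: tail ennreal_suminf_cmult)
  also have "\<dots> = (\<Sum>k. \<Sum>n. w n * (if n \<le> k then f k else 0))"
    by (rule suminf_swap_ennreal)
  also have "\<dots> = (\<Sum>k. \<Sum>n\<le>k. w n * (if n \<le> k then f k else 0))"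
    by (intro suminf_cong suminf_finite) auto
  also have "\<dots> = (\<Sum>k. (\<Sum>n\<le>k. w n) * f k)"
    by (simp add: sum_distrib_right)
  finally show ?thesis .
qed

context bernoulli_environment
begin

lemma suminf_exit_density: "(\<Sum>j. exit_density (n + j)) = tail n"
proof -
  have "(\<Sum>j<m. exit_density (n + j)) + tail (n + m) = tail n" for m
  proof (induction m)
    case (Suc m)
    then show ?case using tail_eq[of "n + m"] by (simp add: ac_simps)
  qed simp
  moreover have "(\<lambda>m. (\<Sum>j<m. exit_density (n + j)) + tail (n + m)) \<longlonglongrightarrow> (\<Sum>j. exit_density (n + j)) + 0"
  proof (intro tendsto_add summable_LIMSEQ)
    have "tail \<longlonglongrightarrow> 0" by (rule suminf_finite_imp_tendsto_zero) (simp add: suminf_tail)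
    from LIMSEQ_ignore_initial_segment[OF this, of n]
    show "(\<lambda>m. tail (n + m)) \<longlonglongrightarrow> 0" by (simp add: add.commute)
  qed simp
  ultimately show ?thesis by (simp add: LIMSEQ_const_iff)
qed

lemma exit_density_finite: "exit_density a < top"
proof -
  have "exit_density a \<le> (\<Sum>j. exit_density (a + j))"
    using sum_le_suminf[of "\<lambda>j. exit_density (a + j)" "{0}"] by simp
  also have "\<dots> \<le> (\<Sum>n. tail n)"
    unfolding suminf_exit_density using sum_le_suminf[of tail "{a}"] by simp
  also have "\<dots> < top" by (simp add: suminf_tail)
  finally show ?thesis .
qed

text \<open>Law of the time needed to gain one level. The shift by one counts the upward jump
  itself.\<close>

definition level_time :: "nat pmf" where
  "level_time = embed_pmf (\<lambda>n. case n of 0 \<Rightarrow> 0 | Suc a \<Rightarrow> enn2real (exit_density a))"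

lemma suminf_nat_split: "(\<Sum>n. f n :: ennreal) = f 0 + (\<Sum>n. f (Suc n))"
  using suminf_offset[of f 1] by (simp add: add.commute)

lemma pmf_level_time: "pmf level_time n = (case n of 0 \<Rightarrow> 0 | Suc a \<Rightarrow> enn2real (exit_density a))"
  unfolding level_time_def
proof (rule pmf_embed_pmf)
  show "(\<integral>\<^sup>+n. ennreal (case n of 0 \<Rightarrow> 0 | Suc a \<Rightarrow> enn2real (exit_density a)) \<partial>count_space UNIV) = 1"
    using suminf_exit_density[of 0]
    by (simp add: nn_integral_count_space_nat suminf_nat_split[of "\<lambda>n. ennreal (case n of 0 \<Rightarrow> _ n | Suc a \<Rightarrow> _ n a)"]
      exit_density_finite tail_0)
qed (auto split: nat.split)

lemma nn_integral_level_time: "(\<integral>\<^sup>+a. f a \<partial>level_time) = (\<Sum>a. exit_density a * f (Suc a))"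
  by (simp add: nn_integral_measure_pmf nn_integral_count_space_nat suminf_nat_split[of "\<lambda>n. _ n * f n"]
    pmf_level_time exit_density_finite)

lemma nn_integral_level_time_mean: "(\<integral>\<^sup>+a. of_nat a \<partial>level_time) = ennreal mean_exit_time"
proof -
  have "(\<integral>\<^sup>+a. of_nat a \<partial>level_time) = (\<Sum>a. (\<Sum>n\<le>a. 1) * exit_density a)"
    by (simp add: nn_integral_level_time mult.commute)
  also have "\<dots> = (\<Sum>n. 1 * (\<Sum>j. exit_density (n + j)))"
    by (rule suminf_weighted_tail[symmetric])
  finally show ?thesis by (simp add: suminf_exit_density suminf_tail)
qed

lemma nn_integral_level_time_square: "(\<integral>\<^sup>+a. of_nat a ^ 2 \<partial>level_time) < top"
proof -
  have "(\<integral>\<^sup>+a. of_nat a ^ 2 \<partial>level_time) = (\<Sum>a. of_nat (Suc a) ^ 2 * exit_density a)"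
    by (simp only: nn_integral_level_time mult.commute)
  also have "\<dots> \<le> (\<Sum>a. (\<Sum>n\<le>a. 2 * of_nat (Suc n)) * exit_density a)"
  proof (intro suminf_le mult_right_mono)
    fix a
    \<comment> \<open>The right side is \<open>(a + 1) (a + 2)\<close>, twice an iterated sum of
      ones, which permits two applications of the tail formula.\<close>
    have "(Suc a)\<^sup>2 \<le> (\<Sum>n\<le>a. 2 * Suc n)" by (induction a) (auto simp: power2_eq_square)
    from of_nat_mono[OF this, where 'a = ennreal]
    show "of_nat (Suc a) ^ 2 \<le> (\<Sum>n\<le>a. 2 * of_nat (Suc n) :: ennreal)"
      by (simp only: of_nat_power of_nat_sum of_nat_mult of_nat_numeral)
  qed auto
  also have "\<dots> = (\<Sum>n. 2 * of_nat (Suc n) * tail n)"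
    by (simp only: suminf_weighted_tail[symmetric] suminf_exit_density)
  also have "\<dots> = 2 * (\<Sum>n. (\<Sum>i\<le>n. 1) * tail n)"
    by (simp add: mult.assoc del: of_nat_Suc)
  also have "(\<Sum>n. (\<Sum>i\<le>n. 1) * tail n) = (\<Sum>n. 1 * (\<Sum>j. tail (n + j)))"
    by (rule suminf_weighted_tail[symmetric])
  also have "2 * \<dots> < top" using suminf_tail_tail by (simp add: ennreal_mult_less_top)
  finally show ?thesis .
qed

text \<open>Sum of \<open>k\<close> independent level times. Only this distribution is compared with
  the walk; no random variable on path space is attached to it.\<close>

primrec hitting_time :: "nat \<Rightarrow> nat pmf" where
  "hitting_time 0 = return_pmf 0"
| "hitting_time (Suc k) = bind_pmf level_time (\<lambda>a. map_pmf ((+) a) (hitting_time k))"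

lemma emeasure_hitting_time: "emeasure (hitting_time k) {..n} = mean_reach k n"
proof (induction k arbitrary: n)
  case (Suc k)
  have "emeasure (hitting_time (Suc k)) {..n} = (\<Sum>a. exit_density a * emeasure (hitting_time k) {s. Suc (a + s) \<le> n})"
    by (simp add: nn_integral_level_time vimage_def)
  also have "\<dots> = (\<Sum>a<n. exit_density a * emeasure (hitting_time k) {s. Suc (a + s) \<le> n})"
    by (rule suminf_finite) auto
  also have "\<dots> = mean_reach (Suc k) n"
  proof -
    have "{s. Suc (a + s) \<le> n} = {..n - Suc a}" if "a < n" for a using that by auto
    then show ?thesis by (simp add: Suc)
  qed
  finally show ?case .
qed simp

lemma nn_integral_hitting_time: "(\<integral>\<^sup>+s. of_nat s \<partial>hitting_time k) = of_nat k * ennreal mean_exit_time"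
proof (induction k)
  case (Suc k)
  have "(\<integral>\<^sup>+s. of_nat s \<partial>hitting_time (Suc k)) = (\<integral>\<^sup>+a. of_nat a + of_nat k * ennreal mean_exit_time \<partial>level_time)"
    by (simp add: nn_integral_add Suc)
  then show ?case by (simp add: nn_integral_add nn_integral_level_time_mean distrib_right)
qed simp

text \<open>Additivity of the variance for independent summands, with the negative terms moved to
  the other side because subtraction in \<open>ennreal\<close> is truncated.\<close>

lemma nn_integral_hitting_time_square:
  "(\<integral>\<^sup>+s. of_nat s ^ 2 \<partial>hitting_time k) + of_nat k * ennreal mean_exit_time ^ 2 =
    of_nat k * (\<integral>\<^sup>+a. of_nat a ^ 2 \<partial>level_time) + of_nat k ^ 2 * ennreal mean_exit_time ^ 2"
proof (induction k)
  case (Suc k)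
  define m where "m = ennreal mean_exit_time"
  define m2 where "m2 = (\<integral>\<^sup>+a. of_nat a ^ 2 \<partial>level_time)"
  define s2 where "s2 = (\<integral>\<^sup>+s. of_nat s ^ 2 \<partial>hitting_time k)"
  have sq: "(of_nat (a + s) :: ennreal) ^ 2 = of_nat a ^ 2 + 2 * of_nat a * of_nat s + of_nat s ^ 2" for a s
    by (simp add: power2_sum add_ac)
  have "(\<integral>\<^sup>+s. of_nat s ^ 2 \<partial>hitting_time (Suc k)) =
      (\<integral>\<^sup>+a. (\<integral>\<^sup>+s. of_nat a ^ 2 + 2 * of_nat a * of_nat s + of_nat s ^ 2 \<partial>hitting_time k) \<partial>level_time)"
    by (simp only: hitting_time.simps nn_integral_bind_pmf nn_integral_map_pmf sq)
  also have "\<dots> = (\<integral>\<^sup>+a. of_nat a ^ 2 + 2 * (of_nat k * m) * of_nat a + s2 \<partial>level_time)"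
  proof (rule nn_integral_cong)
    fix a :: nat
    have "(\<integral>\<^sup>+s. of_nat a ^ 2 + 2 * of_nat a * of_nat s + of_nat s ^ 2 \<partial>hitting_time k) =
        of_nat a ^ 2 + 2 * of_nat a * (of_nat k * m) + s2"
      by (simp add: nn_integral_add nn_integral_cmult nn_integral_hitting_time s2_def m_def del: of_nat_Suc)
    then show "(\<integral>\<^sup>+s. of_nat a ^ 2 + 2 * of_nat a * of_nat s + of_nat s ^ 2 \<partial>hitting_time k) =
        of_nat a ^ 2 + 2 * (of_nat k * m) * of_nat a + s2" by (simp only: mult_ac)
  qed
  also have "\<dots> = m2 + 2 * (of_nat k * m) * m + s2"
    by (simp add: nn_integral_add nn_integral_cmult nn_integral_level_time_mean m2_def m_def)
  finally have square: "(\<integral>\<^sup>+s. of_nat s ^ 2 \<partial>hitting_time (Suc k)) = m2 + 2 * (of_nat k * m) * m + s2" .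
  have "(\<integral>\<^sup>+s. of_nat s ^ 2 \<partial>hitting_time (Suc k)) + of_nat (Suc k) * m ^ 2 =
      m2 + 2 * of_nat k * m ^ 2 + m ^ 2 + (s2 + of_nat k * m ^ 2)"
    unfolding square by (simp add: distrib_left distrib_right power2_eq_square mult_ac add_ac)
  also have "s2 + of_nat k * m ^ 2 = of_nat k * m2 + of_nat k ^ 2 * m ^ 2"
    using Suc by (simp only: s2_def m_def m2_def)
  also have "m2 + 2 * of_nat k * m ^ 2 + m ^ 2 + (of_nat k * m2 + of_nat k ^ 2 * m ^ 2) =
      of_nat (Suc k) * m2 + of_nat (Suc k) ^ 2 * m ^ 2"
    by (simp add: power2_sum distrib_left distrib_right add_ac mult_ac)
  finally show ?case by (simp only: m_def m2_def)
qed simp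

text \<open>Chebyshev's inequality. The second moment of \<open>level_time\<close> serves as
  \<open>v\<close>, since it dominates the variance of one level time.\<close>

lemma hitting_time_deviation:
  obtains v where "0 \<le> v" and "\<And>k a. 0 < a \<Longrightarrow>
    measure_pmf.prob (hitting_time k) {s. a \<le> \<bar>real s - real k * mean_exit_time\<bar>} \<le> real k * v / a\<^sup>2"
proof -
  define m2 where "m2 = enn2real (\<integral>\<^sup>+a. of_nat a ^ 2 \<partial>level_time)"
  have m2: "(\<integral>\<^sup>+a. of_nat a ^ 2 \<partial>level_time) = ennreal m2" "0 \<le> m2"
    using nn_integral_level_time_square by (simp_all add: m2_def)
  have bound: "measure_pmf.prob (hitting_time k) {s. a \<le> \<bar>real s - real k * mean_exit_time\<bar>} \<le> real k * m2 / a\<^sup>2"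
    if "0 < a" for k a
  proof -
    let ?M = "measure_pmf (hitting_time k)"
    have mean: "(\<integral>\<^sup>+s. ennreal (real s) \<partial>?M) = ennreal (real k * mean_exit_time)"
      using nn_integral_hitting_time[of k] mean_exit_time_pos
      by (simp add: ennreal_of_nat_eq_real_of_nat ennreal_mult)
    have "has_bochner_integral ?M real (real k * mean_exit_time)"
      by (rule has_bochner_integral_nn_integral) (use mean mean_exit_time_pos in auto)
    then have int1: "integrable ?M real" and E1: "measure_pmf.expectation (hitting_time k) real = real k * mean_exit_time"
      by (auto simp: has_bochner_integral_iff)
    have sq: "(\<integral>\<^sup>+s. ennreal ((real s)\<^sup>2) \<partial>?M) + ennreal (real k * mean_exit_time\<^sup>2) =
        ennreal (real k * m2 + (real k)\<^sup>2 * mean_exit_time\<^sup>2)"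
      using nn_integral_hitting_time_square[of k] mean_exit_time_pos m2
      by (simp add: ennreal_of_nat_eq_real_of_nat ennreal_mult ennreal_power)
    have fin: "(\<integral>\<^sup>+s. ennreal ((real s)\<^sup>2) \<partial>?M) < top"
    proof -
      have "(\<integral>\<^sup>+s. ennreal ((real s)\<^sup>2) \<partial>?M) \<le> ennreal (real k * m2 + (real k)\<^sup>2 * mean_exit_time\<^sup>2)"
        unfolding sq[symmetric] by simp
      then show ?thesis by (rule le_less_trans) simp
    qed
    then have int2: "integrable ?M (\<lambda>s. (real s)\<^sup>2)"
      by (intro integrableI_nonneg) auto
    have E2: "measure_pmf.expectation (hitting_time k) (\<lambda>s. (real s)\<^sup>2) =
        real k * m2 + (real k)\<^sup>2 * mean_exit_time\<^sup>2 - real k * mean_exit_time\<^sup>2"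
    proof -
      let ?e = "measure_pmf.expectation (hitting_time k) (\<lambda>s. (real s)\<^sup>2)"
      have "0 \<le> ?e" by simp
      have "(\<integral>\<^sup>+s. ennreal ((real s)\<^sup>2) \<partial>?M) = ennreal ?e"
        by (rule nn_integral_eq_integral[OF int2]) auto
      with sq have "ennreal (?e + real k * mean_exit_time\<^sup>2) = ennreal (real k * m2 + (real k)\<^sup>2 * mean_exit_time\<^sup>2)"
        using \<open>0 \<le> ?e\<close> by simp
      then show ?thesis using \<open>0 \<le> ?e\<close> m2(2) by (subst (asm) ennreal_inj) auto
    qed
    have "measure_pmf.variance (hitting_time k) real = real k * m2 - real k * mean_exit_time\<^sup>2"
      using measure_pmf.variance_eq[OF int1 int2] E1 E2 by (simp add: power_mult_distrib)
    also have "\<dots> \<le> real k * m2" by simp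
    finally have var: "measure_pmf.variance (hitting_time k) real \<le> real k * m2" .
    have "measure_pmf.prob (hitting_time k) {s. a \<le> \<bar>real s - real k * mean_exit_time\<bar>} \<le>
        measure_pmf.variance (hitting_time k) real / a\<^sup>2"
      using measure_pmf.Chebyshev_inequality[of real "hitting_time k" a] int2 that E1 by simp
    also have "\<dots> \<le> real k * m2 / a\<^sup>2" using var by (rule divide_right_mono) simp
    finally show ?thesis .
  qed
  show ?thesis by (rule that[OF m2(2) bound])
qed

end

section \<open>Almost sure convergence\<close>

lemma filterlim_nat_sqrt: "filterlim (\<lambda>n. nat \<lfloor>sqrt (real n)\<rfloor>) at_top sequentially"
proof (rule filterlim_at_top[THEN iffD2], rule allI)
  fix Z :: nat
  have "Z \<le> nat \<lfloor>sqrt (real n)\<rfloor>" if "n \<ge> Z\<^sup>2" for n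
  proof -
    have "real Z \<le> sqrt (real n)"
      using that by (intro real_le_rsqrt) (metis of_nat_le_iff of_nat_power)
    then show ?thesis by (simp add: le_nat_iff le_floor_iff)
  qed
  then show "eventually (\<lambda>n. Z \<le> nat \<lfloor>sqrt (real n)\<rfloor>) sequentially"
    by (auto simp: eventually_sequentially)
qed

text \<open>Consecutive squares near \<open>n\<close> differ by order \<open>sqrt n\<close>, so
  bounded increments change \<open>g\<close> between them by a quantity negligible against
  \<open>n\<close>. Subtracting \<open>L * real n\<close> reduces the claim to limit zero.\<close>

lemma LIMSEQ_from_squares:
  fixes g :: "nat \<Rightarrow> real"
  assumes step: "\<And>n. \<bar>g (Suc n) - g n\<bar> \<le> B"
    and lim: "(\<lambda>j. g (j\<^sup>2) / real (j\<^sup>2)) \<longlonglongrightarrow> L"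
  shows "(\<lambda>n. g n / real n) \<longlonglongrightarrow> L"
proof -
  define h where "h n = g n - L * real n" for n
  define b where "b = B + \<bar>L\<bar>"
  have "0 \<le> B" using step[of 0] by linarith
  then have "0 \<le> b" by (simp add: b_def)
  have h_step: "\<bar>h (Suc n) - h n\<bar> \<le> b" for n
    using step[of n] by (simp add: h_def b_def algebra_simps)
  have h_diff: "\<bar>h (n + i) - h n\<bar> \<le> b * real i" for n i
  proof (induction i)
    case (Suc i)
    then show ?case using h_step[of "n + i"] by (simp add: algebra_simps)
  qed simp
  define s where "s n = nat \<lfloor>sqrt (real n)\<rfloor>" for n :: nat
  have s: "filterlim s at_top sequentially"
    unfolding s_def by (rule filterlim_nat_sqrt)
  have hsq: "(\<lambda>j. \<bar>h (j\<^sup>2) / real (j\<^sup>2)\<bar> + 2 * b / real j) \<longlonglongrightarrow> \<bar>L - L\<bar> + 0"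
  proof (intro tendsto_add tendsto_rabs)
    have "(\<lambda>j. g (j\<^sup>2) / real (j\<^sup>2) - L) \<longlonglongrightarrow> L - L"
      by (intro tendsto_diff lim tendsto_const)
    then show "(\<lambda>j. h (j\<^sup>2) / real (j\<^sup>2)) \<longlonglongrightarrow> L - L"
      by (rule Lim_transform_eventually)
        (auto simp: h_def field_simps eventually_sequentially intro!: exI[of _ 1])
    show "(\<lambda>j. 2 * b / real j) \<longlonglongrightarrow> 0" by (rule lim_const_over_n)
  qed
  have bound: "\<bar>h n / real n\<bar> \<le> \<bar>h ((s n)\<^sup>2) / real ((s n)\<^sup>2)\<bar> + 2 * b / real (s n)" if "n \<ge> 1" for n
  proof -
    define j where "j = s n"
    have "1 \<le> sqrt (real n)" using that by simp
    define z where "z = \<lfloor>sqrt (real n)\<rfloor>"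
    have "1 \<le> z" using \<open>1 \<le> sqrt (real n)\<close> unfolding z_def by (simp add: le_floor_iff)
    moreover have "j = nat z" by (simp add: j_def s_def z_def)
    ultimately have j1: "1 \<le> j" and j_eq: "real j = of_int \<lfloor>sqrt (real n)\<rfloor>" unfolding z_def by linarith+
    have lower: "real j \<le> sqrt (real n)" and upper: "sqrt (real n) < real j + 1"
      unfolding j_eq by linarith+
    have jn: "real (j\<^sup>2) \<le> real n" and nj: "real n < real ((j + 1)\<^sup>2)"
      using power_mono[OF lower, of 2] power_strict_mono[OF upper, of 2] by (simp_all add: add.commute)
    obtain i where i: "n = j\<^sup>2 + i" using jn by (metis of_nat_le_iff nat_le_iff_add)
    \<comment> \<open>The time \<open>n\<close> lies strictly below the next square, which is
      \<open>2 * j + 1\<close> steps after the square of \<open>j\<close>.\<close>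
    have "i \<le> 2 * j" using nj unfolding of_nat_less_iff i by (simp add: power2_eq_square)
    have "\<bar>h n\<bar> \<le> \<bar>h (j\<^sup>2)\<bar> + b * real i" using h_diff[of "j\<^sup>2" i] by (simp add: i)
    also have "\<dots> \<le> \<bar>h (j\<^sup>2)\<bar> + b * (2 * real j)"
      using \<open>i \<le> 2 * j\<close> \<open>0 \<le> b\<close> by (intro add_left_mono mult_left_mono) auto
    finally have "\<bar>h n\<bar> / real n \<le> (\<bar>h (j\<^sup>2)\<bar> + b * (2 * real j)) / real n"
      by (rule divide_right_mono) simp
    also have "\<dots> \<le> (\<bar>h (j\<^sup>2)\<bar> + b * (2 * real j)) / real (j\<^sup>2)"
    proof (intro divide_left_mono jn)
      show "0 < real n * real (j\<^sup>2)" using that j1 by simp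
    qed (use \<open>0 \<le> b\<close> in auto)
    also have "\<dots> = \<bar>h (j\<^sup>2)\<bar> / real (j\<^sup>2) + 2 * b / real j"
      using j1 by (simp add: field_simps power2_eq_square)
    finally show ?thesis by (simp add: j_def)
  qed
  have "(\<lambda>n. h n / real n) \<longlonglongrightarrow> 0"
  proof (rule Lim_null_comparison)
    show "eventually (\<lambda>n. norm (h n / real n) \<le> \<bar>h ((s n)\<^sup>2) / real ((s n)\<^sup>2)\<bar> + 2 * b / real (s n)) sequentially"
      using bound by (auto simp: eventually_sequentially simp del: abs_divide)
    show "(\<lambda>n. \<bar>h ((s n)\<^sup>2) / real ((s n)\<^sup>2)\<bar> + 2 * b / real (s n)) \<longlonglongrightarrow> 0"
      using filterlim_compose[OF hsq s] by simp
  qed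
  then have "(\<lambda>n. h n / real n + L) \<longlonglongrightarrow> 0 + L" by (intro tendsto_add tendsto_const)
  then have "(\<lambda>n. h n / real n + L) \<longlonglongrightarrow> L" by simp
  then show ?thesis
    by (rule Lim_transform_eventually)
       (auto simp: h_def field_simps eventually_sequentially intro!: exI[of _ 1])
qed

text \<open>Small \<epsilon> suffices for convergence. The threshold
  \<open>\<epsilon>\<^sub>0\<close> lets the height estimate assume that \<epsilon> is below the
  speed, so that the levels just below the expected height are not negative.\<close>

lemma (in prob_space) AE_LIMSEQ_along_squares:
  fixes f :: "nat \<Rightarrow> 'a \<Rightarrow> real"
  assumes [measurable]: "\<And>n. f n \<in> borel_measurable M" and "0 < \<epsilon>\<^sub>0"
    and bound: "\<And>\<epsilon>. 0 < \<epsilon> \<Longrightarrow> \<epsilon> < \<epsilon>\<^sub>0 \<Longrightarrow>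
      \<exists>C. eventually (\<lambda>n. prob {x \<in> space M. \<epsilon> * real n \<le> \<bar>f n x\<bar>} \<le> C / real n) sequentially"
  shows "AE x in M. (\<lambda>j. f (j\<^sup>2) x / real (j\<^sup>2)) \<longlonglongrightarrow> 0"
proof -
  define \<epsilon> where "\<epsilon> i = \<epsilon>\<^sub>0 / real (i + 2)" for i :: nat
  have \<epsilon>: "0 < \<epsilon> i" "\<epsilon> i < \<epsilon>\<^sub>0" for i
    using \<open>0 < \<epsilon>\<^sub>0\<close> by (auto simp: \<epsilon>_def field_simps intro!: add_pos_nonneg)
  have "AE x in M. eventually (\<lambda>j. x \<in> space M - {x \<in> space M. \<epsilon> i * real (j\<^sup>2) \<le> \<bar>f (j\<^sup>2) x\<bar>}) sequentially" for i
  proof (rule borel_cantelli_AE1)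
    obtain C where "eventually (\<lambda>n. prob {x \<in> space M. \<epsilon> i * real n \<le> \<bar>f n x\<bar>} \<le> C / real n) sequentially"
      using bound[OF \<epsilon>] by blast
    then obtain N where C: "\<And>n. n \<ge> N \<Longrightarrow> prob {x \<in> space M. \<epsilon> i * real n \<le> \<bar>f n x\<bar>} \<le> C / real n"
      by (auto simp: eventually_sequentially)
    show "summable (\<lambda>j. prob {x \<in> space M. \<epsilon> i * real (j\<^sup>2) \<le> \<bar>f (j\<^sup>2) x\<bar>})"
    proof (rule summable_comparison_test)
      show "\<exists>N. \<forall>j\<ge>N. norm (prob {x \<in> space M. \<epsilon> i * real (j\<^sup>2) \<le> \<bar>f (j\<^sup>2) x\<bar>}) \<le> C * (1 / real j ^ 2)"
      proof (intro exI allI impI)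
        fix j assume "N \<le> j"
        moreover have "j \<le> j\<^sup>2" by (cases j) (simp_all add: power2_eq_square)
        ultimately have "N \<le> j\<^sup>2" by (rule le_trans)
        from C[OF this] show "norm (prob {x \<in> space M. \<epsilon> i * real (j\<^sup>2) \<le> \<bar>f (j\<^sup>2) x\<bar>}) \<le> C * (1 / real j ^ 2)"
          by simp
      qed
      show "summable (\<lambda>j. C * (1 / real j ^ 2))"
        using inverse_power_summable[of 2, where 'a = real] by (intro summable_mult) (simp add: inverse_eq_divide)
    qed
  qed (auto simp: less_top[symmetric])
  then have "AE x in M. \<forall>i. eventually (\<lambda>j. x \<in> space M - {x \<in> space M. \<epsilon> i * real (j\<^sup>2) \<le> \<bar>f (j\<^sup>2) x\<bar>}) sequentially"
    by (simp add: AE_all_countable)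
  then show ?thesis
  proof eventually_elim
    case (elim x)
    show ?case
    proof (rule tendstoI)
      fix e :: real assume "0 < e"
      obtain i :: nat where "\<epsilon>\<^sub>0 / e < real i" using reals_Archimedean2 by blast
      then have i: "\<epsilon> i < e" using \<open>0 < e\<close> \<open>0 < \<epsilon>\<^sub>0\<close> by (simp add: \<epsilon>_def field_simps)
      have "eventually (\<lambda>j. x \<in> space M - {x \<in> space M. \<epsilon> i * real (j\<^sup>2) \<le> \<bar>f (j\<^sup>2) x\<bar>} \<and> 1 \<le> j) sequentially"
        using elim eventually_ge_at_top[of 1] by (intro eventually_conj) auto
      then show "eventually (\<lambda>j. dist (f (j\<^sup>2) x / real (j\<^sup>2)) 0 < e) sequentially"
      proof eventually_elim
        case (elim j)
        then have "\<bar>f (j\<^sup>2) x\<bar> < \<epsilon> i * real (j\<^sup>2)" "0 < real (j\<^sup>2)" by auto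
        then have "\<bar>f (j\<^sup>2) x\<bar> / real (j\<^sup>2) < \<epsilon> i" by (simp add: pos_divide_less_eq)
        with i show ?case by simp
      qed
    qed
  qed
qed

context bernoulli_environment
begin

section \<open>The annealed walk in the Bernoulli environment\<close>

lemma env_sets_in_step_sets: "env_sets u x \<in> step_sets"
  by (auto simp: env_sets_def step_sets_def)

lemma measurable_env_sets: "(\<lambda>u. env_sets u x) \<in> \<nu> \<rightarrow>\<^sub>M count_space step_sets"
proof -
  have "(\<lambda>b. if b then {e1, e2} else {e1, - e1}) \<in> count_space UNIV \<rightarrow>\<^sub>M count_space step_sets"
    by (auto simp: step_sets_def)
  from measurable_compose[OF measurable_coord[of x] this] show ?thesis by (simp add: env_sets_def)
qed

definition walk_law :: "(nat \<Rightarrow> site) measure" where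
  "walk_law = annealed_law \<nu> (\<lambda>x u. env_sets u x)"

lemma emeasure_walk_law:
  "A \<in> sets path_space \<Longrightarrow> emeasure walk_law A = (\<integral>\<^sup>+u. emeasure (quenched_law (env_sets u)) A \<partial>\<nu>)"
  unfolding walk_law_def
  using emeasure_annealed_law[OF env.prob_space_axioms measurable_env_sets] by simp

lemma sets_annealed_law:
  assumes "prob_space M" "\<And>x. G x \<in> M \<rightarrow>\<^sub>M count_space step_sets"
  shows "sets (annealed_law M G) = sets path_space"
  unfolding annealed_law_def
  by (rule sets_bind[OF _ prob_space.not_empty[OF assms(1)]]) (rule sets_quenched_law)

lemma sets_walk_law [measurable_cong]: "sets walk_law = sets path_space"
  unfolding walk_law_def by (rule sets_annealed_law[OF env.prob_space_axioms measurable_env_sets])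

lemma space_walk_law [simp]: "space walk_law = UNIV"
  using sets_eq_imp_space_eq[OF sets_walk_law] by (simp add: space_PiM)

sublocale walk: prob_space walk_law
proof
  have "UNIV \<in> sets path_space" using sets.top[of path_space] by (simp add: space_PiM)
  then show "emeasure walk_law (space walk_law) = 1"
    using prob_space.emeasure_space_1[OF prob_space_quenched_law] env.emeasure_space_1
    by (simp add: emeasure_walk_law)
qed

lemma measurable_walk_at [measurable]: "(\<lambda>X. X n) \<in> walk_law \<rightarrow>\<^sub>M count_space UNIV"
  using measurable_cong_sets[OF sets_walk_law refl]
    measurable_component_singleton[of n UNIV "\<lambda>_. count_space (UNIV :: site set)"] by blast

lemma sets_walk_law_at: "{X. X n \<in> A} \<in> sets path_space"
  using sets_quenched_law_at sets_quenched_law by blast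

lemma emeasure_walk_law_at:
  "emeasure walk_law {X. X n \<in> A} = (\<integral>\<^sup>+u. emeasure (walk_pmf (env_sets u) n 0) A \<partial>\<nu>)"
  by (simp add: emeasure_walk_law[OF sets_walk_law_at] emeasure_quenched_law_at)

text \<open>Both sides equal \<open>mean_reach k n\<close>. This duality transfers deviations of
  hitting times to deviations of the height.\<close>

lemma prob_height:
  "walk.prob {X. int k \<le> snd (X n)} = measure_pmf.prob (hitting_time k) {..n}"
proof -
  have "emeasure walk_law {X. X n \<in> {y. int k \<le> snd y}} = emeasure (hitting_time k) {..n}"
    unfolding emeasure_walk_law_at emeasure_hitting_time nn_integral_reach[of k n 0, symmetric]
    using emeasure_walk_pmf_height[of _ n 0 k] by simp
  then show ?thesis by (simp add: measure_def)
qed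

text \<open>Markov's inequality for the squared difference, with a bound that is the same in every
  environment and hence survives averaging.\<close>

lemma prob_diagonal:
  assumes "0 < a"
  shows "walk.prob {X. a \<le> \<bar>real_of_int (fst (X n) - snd (X n))\<bar>} \<le> real n / a\<^sup>2"
proof -
  let ?A = "{y :: site. a \<le> \<bar>real_of_int (fst y - snd y)\<bar>}"
  have "emeasure (walk_pmf (env_sets u) n 0) ?A \<le> ennreal (real n / a\<^sup>2)" for u
  proof -
    let ?d = "\<lambda>y :: site. ennreal (real_of_int ((fst y - snd y)\<^sup>2))"
    have "?A \<subseteq> {y \<in> UNIV. 1 \<le> ennreal (1 / a\<^sup>2) * ?d y}"
    proof
      fix y assume "y \<in> ?A"
      then have "a\<^sup>2 \<le> \<bar>real_of_int (fst y - snd y)\<bar>\<^sup>2" using assms by (intro power_mono) auto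
      then have "1 \<le> 1 / a\<^sup>2 * real_of_int ((fst y - snd y)\<^sup>2)" using assms by (simp add: field_simps)
      then show "y \<in> {y \<in> UNIV. 1 \<le> ennreal (1 / a\<^sup>2) * ?d y}"
        by (simp add: ennreal_mult[symmetric] del: of_int_power of_int_diff)
    qed
    then have "emeasure (walk_pmf (env_sets u) n 0) ?A \<le>
        emeasure (walk_pmf (env_sets u) n 0) {y \<in> UNIV. 1 \<le> ennreal (1 / a\<^sup>2) * ?d y}"
      by (intro emeasure_mono) auto
    also have "\<dots> \<le> ennreal (1 / a\<^sup>2) * (\<integral>\<^sup>+y. ?d y * indicator UNIV y \<partial>walk_pmf (env_sets u) n 0)"
      by (rule nn_integral_Markov_inequality) auto
    also have "\<dots> = ennreal (1 / a\<^sup>2) * ennreal (real n)"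
      using nn_integral_walk_pmf_diagonal[where u = u and n = n and x = 0] by simp
    finally show ?thesis by (simp add: ennreal_mult[symmetric])
  qed
  then have "emeasure walk_law {X. X n \<in> ?A} \<le> (\<integral>\<^sup>+u. ennreal (real n / a\<^sup>2) \<partial>\<nu>)"
    unfolding emeasure_walk_law_at by (intro nn_integral_mono)
  also have "\<dots> = ennreal (real n / a\<^sup>2)" using env.emeasure_space_1 by simp
  finally show ?thesis by (simp add: walk.emeasure_eq_measure)
qed

text \<open>If the height is too large, level \<open>k1\<close> is reached by time \<open>n\<close>
  although its mean hitting time exceeds \<open>n\<close> by at least
  \<open>m * \<epsilon> * real n\<close>. If it is too small, level \<open>k2\<close> is missed
  although its mean hitting time is below \<open>n\<close> by nearly that amount. Both are Chebyshev
  events.\<close>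

lemma prob_height_deviation:
  assumes "0 < \<epsilon>" "\<epsilon> < 1 / mean_exit_time"
  shows "\<exists>C. eventually (\<lambda>n. walk.prob {X \<in> space walk_law.
    \<epsilon> * real n \<le> \<bar>real_of_int (snd (X n)) - real n / mean_exit_time\<bar>} \<le> C / real n) sequentially"
proof -
  define m where "m = mean_exit_time"
  define c where "c = 1 / m"
  have m: "0 < m" and c: "0 < c" "m * c = 1" and \<epsilon>: "0 < \<epsilon>" "\<epsilon> < c"
    using mean_exit_time_pos assms by (auto simp: m_def c_def)
  obtain v where v: "0 \<le> v" and dev: "\<And>k a. 0 < a \<Longrightarrow>
      measure_pmf.prob (hitting_time k) {s. a \<le> \<bar>real s - real k * m\<bar>} \<le> real k * v / a\<^sup>2"
    using hitting_time_deviation unfolding m_def by blast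
  \<comment> \<open>Deviations of size \<open>m * \<epsilon> / 2 * real n\<close> are used; the
    other half of the available margin absorbs the rounding in \<open>k2\<close>. The factor
    \<open>c + \<epsilon> + 1\<close> bounds the levels considered, divided by
    \<open>n\<close>.\<close>
  define K where "K = (c + \<epsilon> + 1) * v / (m * \<epsilon> / 2)\<^sup>2"
  have dev': "measure_pmf.prob (hitting_time k) {s. m * \<epsilon> / 2 * real n \<le> \<bar>real s - real k * m\<bar>} \<le> K / real n"
    if "1 \<le> n" "real k \<le> (c + \<epsilon>) * real n + 1" for n k
  proof -
    have "real k \<le> (c + \<epsilon> + 1) * real n" using that by (simp add: algebra_simps)
    have "measure_pmf.prob (hitting_time k) {s. m * \<epsilon> / 2 * real n \<le> \<bar>real s - real k * m\<bar>} \<le>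
        real k * v / (m * \<epsilon> / 2 * real n)\<^sup>2"
      using m \<epsilon> that by (intro dev) auto
    also have "\<dots> \<le> (c + \<epsilon> + 1) * real n * v / (m * \<epsilon> / 2 * real n)\<^sup>2"
      using \<open>real k \<le> (c + \<epsilon> + 1) * real n\<close> v by (intro divide_right_mono mult_right_mono) auto
    also have "\<dots> = K / real n" using that by (simp add: K_def power_mult_distrib power2_eq_square)
    finally show ?thesis .
  qed
  \<comment> \<open>From here on \<open>\<epsilon> * real n\<close> is at least \<open>2\<close>, so
    rounding a level by one, which changes the mean hitting time by \<open>m\<close>, costs at most
    half of the margin.\<close>
  define N where "N = nat \<lceil>2 / \<epsilon>\<rceil> + 1"
  have "walk.prob {X \<in> space walk_law. \<epsilon> * real n \<le> \<bar>real_of_int (snd (X n)) - real n / m\<bar>} \<le> 2 * K / real n"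
    if n: "n \<ge> N" for n
  proof -
    have n1: "1 \<le> n" and "2 / \<epsilon> \<le> real n" using n by (auto simp: N_def) linarith
    then have n2: "2 \<le> \<epsilon> * real n" using \<epsilon> by (simp add: field_simps)
    define k1 where "k1 = nat \<lceil>(c + \<epsilon>) * real n\<rceil>"
    \<comment> \<open>The added one makes \<open>k2\<close> exceed every integer height of at most
      \<open>(c - \<epsilon>) * real n\<close>, so such a height misses the level.\<close>
    define k2 where "k2 = nat \<lfloor>(c - \<epsilon>) * real n\<rfloor> + 1"
    have "0 \<le> (c + \<epsilon>) * real n" "0 \<le> (c - \<epsilon>) * real n" using c \<epsilon> by auto
    then have k1: "(c + \<epsilon>) * real n \<le> real k1" "real k1 \<le> (c + \<epsilon>) * real n + 1"
      and k2: "(c - \<epsilon>) * real n \<le> real k2" "real k2 \<le> (c - \<epsilon>) * real n + 1"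
      by (auto simp: k1_def k2_def) linarith+
    have n_eq: "real n = m * (c * real n)" using c by (simp add: mult.assoc[symmetric])
    have nm: "real n / m = c * real n" by (simp add: c_def)
    have up: "walk.prob {X. int k1 \<le> snd (X n)} \<le> K / real n"
    proof -
      have "{..n} \<subseteq> {s. m * \<epsilon> / 2 * real n \<le> \<bar>real s - real k1 * m\<bar>}"
      proof
        fix s assume "s \<in> {..n}"
        then have "real s \<le> real n" by simp
        then have "real s \<le> m * (c * real n)" using n_eq by linarith
        moreover have "m * ((c + \<epsilon>) * real n) \<le> m * real k1" using k1(1) m by (intro mult_left_mono) auto
        moreover have "0 \<le> m * \<epsilon> * real n" using m \<epsilon> by auto
        ultimately show "s \<in> {s. m * \<epsilon> / 2 * real n \<le> \<bar>real s - real k1 * m\<bar>}"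
          by (simp add: algebra_simps; linarith)
      qed
      then have "measure_pmf.prob (hitting_time k1) {..n} \<le>
          measure_pmf.prob (hitting_time k1) {s. m * \<epsilon> / 2 * real n \<le> \<bar>real s - real k1 * m\<bar>}"
        by (intro measure_pmf.finite_measure_mono) auto
      also have "\<dots> \<le> K / real n" using n1 k1(2) by (intro dev') auto
      finally show ?thesis by (simp add: prob_height)
    qed
    have low: "walk.prob {X. \<not> int k2 \<le> snd (X n)} \<le> K / real n"
    proof -
      have ev: "{X. int k2 \<le> snd (X n)} \<in> sets walk_law"
        using sets_walk_law_at[of n "{y. int k2 \<le> snd y}"] by (simp add: sets_walk_law)
      have "walk.prob {X. \<not> int k2 \<le> snd (X n)} = 1 - measure_pmf.prob (hitting_time k2) {..n}"
        using walk.prob_compl[OF ev] by (simp add: prob_height Compl_eq_Diff_UNIV[symmetric] Collect_neg_eq)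
      also have "\<dots> = measure_pmf.prob (hitting_time k2) (- {..n})"
        using measure_pmf.prob_compl[of "{..n}" "hitting_time k2"] by (simp add: Compl_eq_Diff_UNIV)
      also have "\<dots> \<le> measure_pmf.prob (hitting_time k2) {s. m * \<epsilon> / 2 * real n \<le> \<bar>real s - real k2 * m\<bar>}"
      proof (intro measure_pmf.finite_measure_mono subsetI)
        fix s assume "s \<in> - {..n}"
        then have "real n \<le> real s" by simp
        then have "m * (c * real n) \<le> real s" using n_eq by linarith
        moreover have "m * real k2 \<le> m * ((c - \<epsilon>) * real n + 1)" using k2(2) m by (intro mult_left_mono) auto
        moreover have "m * 2 \<le> m * (\<epsilon> * real n)" using n2 m by (intro mult_left_mono) auto
        moreover have "m * ((c - \<epsilon>) * real n + 1) = m * (c * real n) - m * (\<epsilon> * real n) + m"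
          by (simp add: algebra_simps)
        ultimately have "m * (\<epsilon> * real n) / 2 \<le> real s - m * real k2" by linarith
        also have "\<dots> \<le> \<bar>real s - m * real k2\<bar>" by (rule abs_ge_self)
        finally show "s \<in> {s. m * \<epsilon> / 2 * real n \<le> \<bar>real s - real k2 * m\<bar>}"
          by (simp add: mult.commute mult.left_commute)
      qed auto
      also have "\<dots> \<le> K / real n"
      proof (rule dev'[OF n1])
        have "(c - \<epsilon>) * real n \<le> (c + \<epsilon>) * real n" using \<epsilon> by (intro mult_right_mono) auto
        with k2(2) show "real k2 \<le> (c + \<epsilon>) * real n + 1" by linarith
      qed
      finally show ?thesis .
    qed
    have "{X \<in> space walk_law. \<epsilon> * real n \<le> \<bar>real_of_int (snd (X n)) - real n / m\<bar>} \<subseteq>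
        {X. int k1 \<le> snd (X n)} \<union> {X. \<not> int k2 \<le> snd (X n)}"
    proof
      fix X assume "X \<in> {X \<in> space walk_law. \<epsilon> * real n \<le> \<bar>real_of_int (snd (X n)) - real n / m\<bar>}"
      then consider "(c + \<epsilon>) * real n \<le> real_of_int (snd (X n))" | "real_of_int (snd (X n)) \<le> (c - \<epsilon>) * real n"
        unfolding nm by (auto simp: abs_if algebra_simps split: if_splits)
      then show "X \<in> {X. int k1 \<le> snd (X n)} \<union> {X. \<not> int k2 \<le> snd (X n)}"
      proof cases
        case 1
        then have "\<lceil>(c + \<epsilon>) * real n\<rceil> \<le> snd (X n)" by (simp add: ceiling_le_iff)
        then show ?thesis using \<open>0 \<le> (c + \<epsilon>) * real n\<close> by (simp add: k1_def)
      next
        case 2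
        then have "snd (X n) \<le> \<lfloor>(c - \<epsilon>) * real n\<rfloor>" by (simp add: le_floor_iff)
        then show ?thesis using \<open>0 \<le> (c - \<epsilon>) * real n\<close> by (simp add: k2_def)
      qed
    qed
    then have "walk.prob {X \<in> space walk_law. \<epsilon> * real n \<le> \<bar>real_of_int (snd (X n)) - real n / m\<bar>} \<le>
        walk.prob ({X. int k1 \<le> snd (X n)} \<union> {X. \<not> int k2 \<le> snd (X n)})"
      using sets_walk_law_at[of n "{y. int k1 \<le> snd y}"] sets_walk_law_at[of n "{y. \<not> int k2 \<le> snd y}"]
      by (intro walk.finite_measure_mono) (auto simp: sets_walk_law)
    also have "\<dots> \<le> walk.prob {X. int k1 \<le> snd (X n)} + walk.prob {X. \<not> int k2 \<le> snd (X n)}"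
      using sets_walk_law_at[of n "{y. int k1 \<le> snd y}"] sets_walk_law_at[of n "{y. \<not> int k2 \<le> snd y}"]
      by (intro measure_Un_le) (auto simp: sets_walk_law)
    also have "\<dots> \<le> 2 * K / real n" using up low by simp
    finally show ?thesis .
  qed
  then show ?thesis unfolding m_def eventually_sequentially by blast
qed

lemma AE_walk_law_step: "AE X in walk_law. X (Suc n) - X n \<in> {e1, e2, - e1}"
proof -
  let ?B = "{X. X (Suc n) - X n \<notin> {e1, e2, - e1}}"
  have "?B = {X \<in> space walk_law. X (Suc n) - X n \<notin> {e1, e2, - e1}}" by simp
  also have "\<dots> \<in> sets walk_law" by measurable
  finally have B: "?B \<in> sets walk_law" .
  have "emeasure (quenched_law (env_sets u)) ?B = 0" for u
  proof -
    have "AE X in quenched_law (env_sets u). X (Suc n) - X n \<in> env_sets u (X n)"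
      by (rule AE_quenched_law_step) (rule env_sets_in_step_sets)
    then have "AE X in quenched_law (env_sets u). X \<notin> ?B"
      by (rule AE_mp) (auto simp: env_sets_def intro!: AE_I2 split: if_splits)
    then show ?thesis using B by (subst (asm) AE_iff_measurable[of ?B]) (auto simp: sets_walk_law sets_quenched_law)
  qed
  then have "emeasure walk_law ?B = 0" using B by (simp add: emeasure_walk_law sets_walk_law)
  then show ?thesis using B by (subst AE_iff_measurable[of ?B]) auto
qed

lemma AE_walk_law_LIMSEQ:
  "AE X in walk_law. (\<lambda>n. (1 / real n) *\<^sub>R map_prod real_of_int real_of_int (X n))
    \<longlonglongrightarrow> inverse mean_exit_time *\<^sub>R (1, 1)"
proof -
  have height: "AE X in walk_law.
      (\<lambda>j. (real_of_int (snd (X (j\<^sup>2))) - real (j\<^sup>2) / mean_exit_time) / real (j\<^sup>2)) \<longlonglongrightarrow> 0"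
    by (rule walk.AE_LIMSEQ_along_squares[where f = "\<lambda>n X. real_of_int (snd (X n)) - real n / mean_exit_time"
        and \<epsilon>\<^sub>0 = "1 / mean_exit_time"]) (use mean_exit_time_pos prob_height_deviation in auto)
  have diagonal: "AE X in walk_law.
      (\<lambda>j. real_of_int (fst (X (j\<^sup>2)) - snd (X (j\<^sup>2))) / real (j\<^sup>2)) \<longlonglongrightarrow> 0"
  proof (rule walk.AE_LIMSEQ_along_squares[where f = "\<lambda>n X. real_of_int (fst (X n) - snd (X n))" and \<epsilon>\<^sub>0 = 1])
    fix \<epsilon> :: real assume "0 < \<epsilon>"
    have "walk.prob {X \<in> space walk_law. \<epsilon> * real n \<le> \<bar>real_of_int (fst (X n) - snd (X n))\<bar>} \<le> (1 / \<epsilon>\<^sup>2) / real n"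
      if "n \<ge> 1" for n
      using prob_diagonal[of "\<epsilon> * real n" n] that \<open>0 < \<epsilon>\<close> by (simp add: power_mult_distrib power2_eq_square field_simps)
    then show "\<exists>C. eventually (\<lambda>n. walk.prob {X \<in> space walk_law. \<epsilon> * real n \<le>
        \<bar>real_of_int (fst (X n) - snd (X n))\<bar>} \<le> C / real n) sequentially"
      unfolding eventually_sequentially by blast
  qed auto
  have "AE X in walk_law. \<forall>n. X (Suc n) - X n \<in> {e1, e2, - e1}"
    using AE_walk_law_step by (simp add: AE_all_countable)
  with height diagonal show ?thesis
  proof eventually_elim
    case (elim X)
    have fst_step: "fst (X (Suc n)) - fst (X n) \<in> {1, 0, -1}" and snd_step: "snd (X (Suc n)) - snd (X n) \<in> {0, 1}" for n
    proof -
      define d where "d = X (Suc n) - X n"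
      have "fst (X (Suc n)) - fst (X n) = fst d" "snd (X (Suc n)) - snd (X n) = snd d" by (simp_all add: d_def)
      moreover have "d \<in> {e1, e2, - e1}" using elim(3) by (simp add: d_def)
      ultimately show "fst (X (Suc n)) - fst (X n) \<in> {1, 0, -1}" "snd (X (Suc n)) - snd (X n) \<in> {0, 1}"
        by (auto simp: e1_def e2_def)
    qed
    let ?c = "inverse mean_exit_time"
    have "(\<lambda>j. (real_of_int (snd (X (j\<^sup>2))) - real (j\<^sup>2) / mean_exit_time) / real (j\<^sup>2) + ?c) \<longlonglongrightarrow> 0 + ?c"
      using elim(1) by (intro tendsto_add tendsto_const)
    moreover have "eventually (\<lambda>j. (real_of_int (snd (X (j\<^sup>2))) - real (j\<^sup>2) / mean_exit_time) / real (j\<^sup>2) + ?c =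
        real_of_int (snd (X (j\<^sup>2))) / real (j\<^sup>2)) sequentially"
      using eventually_ge_at_top[of 1]
    proof eventually_elim
      case (elim j)
      have "(y - t / mean_exit_time) / t + ?c = y / t" if "t \<noteq> 0" for y t
        using that mean_exit_time_pos by (simp add: field_simps)
      then show ?case using elim by (metis One_nat_def not_one_le_zero of_nat_eq_0_iff power_eq_0_iff)
    qed
    ultimately have snd_sq: "(\<lambda>j. real_of_int (snd (X (j\<^sup>2))) / real (j\<^sup>2)) \<longlonglongrightarrow> ?c"
      using Lim_transform_eventually by fastforce
    have "(\<lambda>j. real_of_int (fst (X (j\<^sup>2)) - snd (X (j\<^sup>2))) / real (j\<^sup>2) + real_of_int (snd (X (j\<^sup>2))) / real (j\<^sup>2))
        \<longlonglongrightarrow> 0 + ?c"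
      using elim(2) snd_sq by (intro tendsto_add)
    then have fst_sq: "(\<lambda>j. real_of_int (fst (X (j\<^sup>2))) / real (j\<^sup>2)) \<longlonglongrightarrow> ?c"
      by (simp add: diff_divide_distrib)
    have "(\<lambda>n. real_of_int (snd (X n)) / real n) \<longlonglongrightarrow> ?c"
    proof (rule LIMSEQ_from_squares[OF _ snd_sq])
      show "\<bar>real_of_int (snd (X (Suc n))) - real_of_int (snd (X n))\<bar> \<le> 1" for n
        using snd_step[of n] unfolding of_int_diff[symmetric] by auto
    qed
    moreover have "(\<lambda>n. real_of_int (fst (X n)) / real n) \<longlonglongrightarrow> ?c"
    proof (rule LIMSEQ_from_squares[OF _ fst_sq])
      show "\<bar>real_of_int (fst (X (Suc n))) - real_of_int (fst (X n))\<bar> \<le> 1" for n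
        using fst_step[of n] unfolding of_int_diff[symmetric] by auto
    qed
    ultimately have "(\<lambda>n. (real_of_int (fst (X n)) / real n, real_of_int (snd (X n)) / real n)) \<longlonglongrightarrow> (?c, ?c)"
      by (intro tendsto_Pair)
    then show ?case by (simp add: map_prod_def case_prod_beta)
  qed
qed

text \<open>The two given probabilities add up to one, so almost surely every one of the countably
  many sites has one of the two step sets. The environment is then a function of the independent up
  indicators \<open>U\<close>, whose joint law is \<nu>.\<close>

lemma annealed_law_eq_walk_law:
  fixes M :: "'w measure" and G :: "site \<Rightarrow> 'w \<Rightarrow> site set"
  assumes M: "prob_space M" and ind: "prob_space.indep_vars M (\<lambda>_. count_space step_sets) G UNIV"
    and up: "\<And>x. measure M {\<omega> \<in> space M. G x \<omega> = {e1, e2}} = p"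
    and flat: "\<And>x. measure M {\<omega> \<in> space M. G x \<omega> = {e1, - e1}} = 1 - p"
  shows "annealed_law M G = walk_law"
proof (rule measure_eqI)
  interpret M: prob_space M by (rule M)
  have G: "G x \<in> M \<rightarrow>\<^sub>M count_space step_sets" for x
    using ind unfolding M.indep_vars_def by blast
  note [measurable] = G
  show sets: "sets (annealed_law M G) = sets walk_law"
    by (simp add: sets_annealed_law[OF M G] sets_walk_law)
  define U where "U = (\<lambda>\<omega> x. G x \<omega> = {e1, e2})"
  have ind_U: "M.indep_vars (\<lambda>_. count_space UNIV) (\<lambda>x \<omega>. U \<omega> x) UNIV"
    unfolding U_def by (rule M.indep_vars_compose2[OF ind]) auto
  have [measurable]: "(\<lambda>\<omega>. U \<omega> x) \<in> M \<rightarrow>\<^sub>M count_space UNIV" for x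
    using ind_U unfolding M.indep_vars_def by blast
  have events: "{\<omega> \<in> space M. G x \<omega> = S} \<in> sets M" for x S
  proof -
    have "{\<omega> \<in> space M. G x \<omega> = S} = G x -` ({S} \<inter> step_sets) \<inter> space M"
      using measurable_space[OF G[of x]] by auto
    then show ?thesis using measurable_sets[OF G[of x], of "{S} \<inter> step_sets"] by simp
  qed
  have ne: "{e1, e2} \<noteq> {e1, - e1}" using site_vectors_distinct by (auto simp: doubleton_eq_iff)
  have AE_G: "AE \<omega> in M. G x \<omega> = {e1, e2} \<or> G x \<omega> = {e1, - e1}" for x
  proof -
    have "M.prob ({\<omega> \<in> space M. G x \<omega> = {e1, e2}} \<union> {\<omega> \<in> space M. G x \<omega> = {e1, - e1}}) = p + (1 - p)"
      using ne by (subst M.finite_measure_Union) (auto simp: events up flat)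
    then have "AE \<omega> in M. \<omega> \<in> {\<omega> \<in> space M. G x \<omega> = {e1, e2}} \<union> {\<omega> \<in> space M. G x \<omega> = {e1, - e1}}"
      by (intro M.prob_eq_1[THEN iffD1] sets.Un events) simp
    then show ?thesis by (rule AE_mp) (rule AE_I2, auto)
  qed
  have distr_U: "distr M (count_space UNIV) (\<lambda>\<omega>. U \<omega> x) = measure_pmf (bernoulli_pmf p)" for x
  proof (rule measure_eqI_countable[where A = UNIV])
    fix b :: bool
    have pT: "emeasure M {\<omega> \<in> space M. U \<omega> x} = ennreal p"
      by (simp add: U_def M.emeasure_eq_measure up)
    have pF: "emeasure M {\<omega> \<in> space M. \<not> U \<omega> x} = ennreal (1 - p)"
      using M.prob_neg[of "\<lambda>\<omega>. U \<omega> x"] by (simp add: U_def M.emeasure_eq_measure up events)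
    have "emeasure (distr M (count_space UNIV) (\<lambda>\<omega>. U \<omega> x)) {b} = emeasure M {\<omega> \<in> space M. U \<omega> x = b}"
      by (subst emeasure_distr) (auto intro!: arg_cong[where f = "emeasure M"])
    also have "\<dots> = emeasure (measure_pmf (bernoulli_pmf p)) {b}"
      using pT pF p_pos p_less_1 by (cases b) (simp_all add: emeasure_pmf_single)
    finally show "emeasure (distr M (count_space UNIV) (\<lambda>\<omega>. U \<omega> x)) {b} = emeasure (measure_pmf (bernoulli_pmf p)) {b}" .
  qed auto
  have U_PiM: "U \<in> M \<rightarrow>\<^sub>M PiM UNIV (\<lambda>_. count_space UNIV)"
    using measurable_restrict[of UNIV "\<lambda>x \<omega>. U \<omega> x" M "\<lambda>_. count_space UNIV"] by (simp add: restrict_UNIV)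
  then have [measurable]: "U \<in> M \<rightarrow>\<^sub>M \<nu>"
    using measurable_cong_sets[OF refl sets_\<nu>] by blast
  have "distr M (PiM UNIV (\<lambda>_. count_space UNIV)) (\<lambda>\<omega>. \<lambda>x\<in>UNIV. U \<omega> x) =
      PiM UNIV (\<lambda>x. distr M (count_space UNIV) (\<lambda>\<omega>. U \<omega> x))"
    using ind_U by (subst (asm) M.indep_vars_iff_distr_eq_PiM') auto
  also have "\<dots> = \<nu>" by (simp add: distr_U \<nu>_def)
  finally have "distr M (PiM UNIV (\<lambda>_. count_space UNIV)) U = \<nu>" by (simp add: restrict_UNIV)
  moreover have "distr M (PiM UNIV (\<lambda>_. count_space UNIV)) U = distr M \<nu> U"
    by (rule distr_cong) (simp_all add: sets_\<nu>)
  ultimately have distr: "distr M \<nu> U = \<nu>" by simp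
  fix A assume "A \<in> sets (annealed_law M G)"
  then have A: "A \<in> sets path_space" by (simp add: sets sets_walk_law)
  have "(\<lambda>u. emeasure (quenched_law (env_sets u)) A) \<in> borel_measurable \<nu>"
    by (rule measurable_compose[OF measurable_quenched_law[OF measurable_env_sets] measurable_emeasure_subprob_algebra[OF A]])
  note [measurable] = this
  have "AE \<omega> in M. \<forall>x. G x \<omega> = {e1, e2} \<or> G x \<omega> = {e1, - e1}"
    using AE_G by (simp add: AE_all_countable)
  then have G_eq: "AE \<omega> in M. (\<lambda>x. G x \<omega>) = env_sets (U \<omega>)"
    by (rule AE_mp) (rule AE_I2, auto simp: env_sets_def U_def fun_eq_iff)
  have "(\<integral>\<^sup>+\<omega>. emeasure (quenched_law (\<lambda>x. G x \<omega>)) A \<partial>M) = (\<integral>\<^sup>+\<omega>. emeasure (quenched_law (env_sets (U \<omega>))) A \<partial>M)"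
    by (rule nn_integral_cong_AE, rule AE_mp[OF G_eq], rule AE_I2) simp
  also have "\<dots> = (\<integral>\<^sup>+u. emeasure (quenched_law (env_sets u)) A \<partial>distr M \<nu> U)"
    by (subst nn_integral_distr) auto
  finally show "emeasure (annealed_law M G) A = emeasure walk_law A"
    by (simp add: emeasure_annealed_law[OF M G A] emeasure_walk_law[OF A] distr)
qed

text \<open>Every function of the discrete variable \<open>X n\<close> is measurable, so it suffices
  to express convergence with countably many tolerances. Measurability of the event turns the almost
  sure statement into a probability.\<close>

lemma sets_LIMSEQ_walk:
  fixes f :: "nat \<Rightarrow> site \<Rightarrow> 'b :: metric_space"
  shows "{X \<in> space walk_law. (\<lambda>n. f n (X n)) \<longlonglongrightarrow> L} \<in> sets walk_law"
proof -
  have "(\<lambda>n. f n (X n)) \<longlonglongrightarrow> L \<longleftrightarrow> (\<forall>i. \<exists>N. \<forall>n\<ge>N. dist (f n (X n)) L < 1 / real (Suc i))" for X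
  proof
    assume R: "\<forall>i. \<exists>N. \<forall>n\<ge>N. dist (f n (X n)) L < 1 / real (Suc i)"
    show "(\<lambda>n. f n (X n)) \<longlonglongrightarrow> L"
    proof (rule metric_LIMSEQ_I)
      fix r :: real assume "0 < r"
      then obtain i where i: "1 / real (Suc i) < r"
        using reals_Archimedean[of r] by (auto simp: inverse_eq_divide)
      obtain N where "\<forall>n\<ge>N. dist (f n (X n)) L < 1 / real (Suc i)" using R by blast
      then have "\<forall>n\<ge>N. dist (f n (X n)) L < r" using less_trans[OF _ i] by blast
      then show "\<exists>N. \<forall>n\<ge>N. dist (f n (X n)) L < r" ..
    qed
  next
    assume "(\<lambda>n. f n (X n)) \<longlonglongrightarrow> L"
    then show "\<forall>i. \<exists>N. \<forall>n\<ge>N. dist (f n (X n)) L < 1 / real (Suc i)"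
      by (intro allI metric_LIMSEQ_D) auto
  qed
  then have "{X \<in> space walk_law. (\<lambda>n. f n (X n)) \<longlonglongrightarrow> L} =
      {X \<in> space walk_law. \<forall>i. \<exists>N. \<forall>n\<ge>N. dist (f n (X n)) L < 1 / real (Suc i)}" by simp
  also have "\<dots> \<in> sets walk_law" by measurable
  finally show ?thesis .
qed

end

theorem mainTheorem4:
  fixes M :: "'w measure" and G :: "site \<Rightarrow> 'w \<Rightarrow> site set" and p :: real
  assumes "0 < p" and "p < 1"
    and "prob_space M"
    and "prob_space.indep_vars M (\<lambda>_. count_space step_sets) G UNIV"
    and "\<And>x. measure M {\<omega> \<in> space M. G x \<omega> = {e1, e2}} = p"
    and "\<And>x. measure M {\<omega> \<in> space M. G x \<omega> = {e1, - e1}} = 1 - p"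
  shows "measure (annealed_law M G)
    {X \<in> space (annealed_law M G).
      (\<lambda>n. (1 / real n) *\<^sub>R map_prod real_of_int real_of_int (X n)) \<longlonglongrightarrow>
        inverse (1 / p\<^sup>2 + (1 - p)\<^sup>2 / (2 * p * (1 - p + p * ln p))) *\<^sub>R (1, 1)} = 1"
proof -
  interpret bernoulli_environment p by unfold_locales (rule assms)+
  have law: "annealed_law M G = walk_law" by (rule annealed_law_eq_walk_law[OF assms(3-6)])
  show ?thesis
    unfolding law mean_exit_time_def[symmetric]
    by (subst walk.prob_Collect_eq_1)
      (rule sets_LIMSEQ_walk[where f = "\<lambda>n x. (1 / real n) *\<^sub>R map_prod real_of_int real_of_int x"],
       rule AE_walk_law_LIMSEQ)
qed

end
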